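(* Assume that the controlled wave problem $\Phi'+A\Phi+\mathbf F\mathbf 1_\omega+G(\Phi)=0$ on $(0,T)$, $\Phi(0,\cdot)=\Phi_0$, $\Phi(T,\cdot)=\Phi_T$, possesses a control of the form $\mathbf F\mathbf 1_\omega=(0,f\mathbf 1_\omega)$ with $f\in L^2((0,T)\times\omega)$, and that $\sigma\in C^2(\mathbb R)$ is not a polynomial. Suppose moreover that $G(\Phi)=(0,g(u))$ for $\Phi=(u,z)$, where $g:H_0^1(\Omega)\to L^2(\Omega)$ is Lipschitz continuous with constant $L_g$. Let $P\in\mathbb N^*$ be fixed. Let $\theta_c=(A^c_j,W^c_j,B^c_j)_{j=1}^{P_c}$, $A^c_j,W^c_j,B^c_j\in\mathbb R^{m_c}$, be control parameters such that, for a prescribed tolerance $\epsilon_c>0$, the neural control $\widetilde{\mathbf F}_{\theta_c}\mathbf 1_\omega=(0,\widetilde f_{\theta_c}\mathbf 1_\omega)$ with $\widetilde f_{\theta_c}(t,x)=\sum_{j=1}^{P_c}c_j(t;\theta_c)e_j(x)$, $c_j(t;\theta_c)=A^c_j\cdot\sigma(W^c_jt+B^c_j)$, satisfies $\|\widetilde{\mathbf F}_{\theta_c}\mathbf 1_\omega-\mathbf F\mathbf 1_\omega\|_{L^2((0,T);\mathcal E)}<\epsilon_c$. Let $(a_1^*(\cdot;\theta_c),\dots,a_P^*(\cdot;\theta_c))$ be the Galerkin coefficient solution of the projected system driven by this control, $$(a_j^* )''(t)+(\mu_j+\alpha)a_j^*(t)+\Bigl\langle g\Bigl(\sum_{\ell=1}^Pa_\ell^*(t)e_\ell\Bigr),e_j\Bigr\rangle_{L^2(\Omega)}+\sum_{\ell=1}^PM_{j\ell}\,c_\ell(t;\theta_c)=0,\quad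 t\in(0,T),\ j=1,\dots,P,$$ and assume that $a_j^*(\cdot;\theta_c)\in W^{2,2}(0,T)$ for $j=1,\dots,P$. Then, for every $\epsilon>0$, there exist a sufficiently large width $m_a\in\mathbb N^*$ and parameters $\theta_a=(A^a_j,W^a_j,B^a_j)_{j=1}^P\in(\mathbb R^{m_a})^{3P}$ such that, with $\theta=(\theta_a,\theta_c)$ and $a_j(t;\theta)=A^a_j\cdot\sigma(W^a_jt+B^a_j)$, $$\sum_{j=1}^P\|R_j(\cdot;\theta)\|_{L^2(0,T)}^2<\epsilon,$$ where $$R_j(t;\theta)=a_j''(t;\theta)+(\mu_j+\alpha)a_j(t;\theta)+\Bigl\langle g\Bigl(\sum_{\ell=1}^Pa_\ell(t;\theta)e_\ell\Bigr),e_j\Bigr\rangle_{L^2(\Omega)}+\sum_{\ell=1}^PM_{j\ell}\,c_\ell(t;\theta_c).$$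
   Context: $\Omega=(0,1)^N$, $\omega\subset\Omega$ is a nonempty open subset with characteristic function $\mathbf 1_\omega$, $T>0$, $\alpha\ge 0$ is a real constant, $\mathbb N^*=\{1,2,\dots\}$. States and controls are real-valued. $H_0^1(\Omega)$ carries the norm $\|u\|_{H_0^1}^2=\int_\Omega(|\nabla u|^2+\alpha|u|^2)dx$, and the energy space $\mathcal E=H_0^1(\Omega)\times L^2(\Omega)$ the norm $\|(u,z)\|_{\mathcal E}^2=\|u\|_{H_0^1}^2+\|z\|_{L^2}^2$. The operator $A$ has domain $D(A)=(H^2(\Omega)\cap H^1_0(\Omega))\times H_0^1(\Omega)$ and $A(u,z)=(-z,\,-\Delta u+\alpha u)$. The nonlinearity $g:\mathbb R\to\mathbb R$ is identified with its Nemytskii operator. $\Phi_0,\Phi_T\in\mathcal E$ are the prescribed initial and target states. Standing assumption: $(\omega,T)$ satisfies the Geometric Control Condition, i.e. every optical ray propagating in $\Omega$ and reflecting on $\partial\Omega$ enters $\omega$ within the time interval $(0,T)$. For $k\in(\mathbb N^* )^N$ the Dirichlet eigenfunctions of $-\Delta$ are $e_k(x)=2^{N/2}\prod_{j=1}^N\sin(k_j\pi x_j)$, with eigenvalues $\mu_k=\pi^2\sum_j k_j^2$; they are enumerated as $e_j,\mu_j$, $j\in\mathbb N^*$, by ordering the multi-indices by increasing $\sum_j k_j^2$, ties being broken lexicographically. $M_{j\ell}=\int_\omega e_j(x)e_\ell(x)\,dx$. The function $\sigma$ acts componentwise on vectors and "$\cdot$" is the Euclidean inner product. By convention $c_\ell(\cdot;\theta_c)\equiv0$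 for $\ell>P_c$. *)

theory Defs
  imports
    "HOL-Analysis.Analysis"
    "HOL-Library.Function_Algebras"
    "HOL-Computational_Algebra.Polynomial"
begin

text \<open>
  Elements of Lebesgue and Sobolev spaces are represented by functions on the whole space that are
  only relevant almost everywhere on the open set \<open>U\<close>; membership in these spaces, norms and inner
  products are unaffected by changes on null sets and outside \<open>U\<close>.
\<close>

definition l2_space :: "'a::euclidean_space set \<Rightarrow> ('a \<Rightarrow> real) set" where
  "l2_space U = {f. f \<in> borel_measurable (lebesgue_on U) \<and> integrable (lebesgue_on U) (\<lambda>x. (f x)\<^sup>2)}"

definition l2_inner :: "'a::euclidean_space set \<Rightarrow> ('a \<Rightarrow> real) \<Rightarrow> ('a \<Rightarrow> real) \<Rightarrow> real" where
  "l2_inner U f h = (\<integral>x. f x * h x \<partial>lebesgue_on U)"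

definition l2_norm :: "'a::euclidean_space set \<Rightarrow> ('a \<Rightarrow> real) \<Rightarrow> real" where
  "l2_norm U f = sqrt (l2_inner U f f)"

text \<open>
  Sobolev spaces follow the conventions of Brezis, \<^emph>\<open>Functional Analysis, Sobolev Spaces and Partial
  Differential Equations\<close>: test functions are compactly supported \<open>C\<^sup>1\<close> functions (using smooth ones
  gives the same weak derivatives and the same closure), and second-order spaces are obtained by
  iterating first-order ones.
\<close>

definition test_functions :: "'a::euclidean_space set \<Rightarrow> ('a \<Rightarrow> real) set" where
  "test_functions U = {\<phi>. (\<forall>x. \<phi> differentiable (at x)) \<and>
     (\<forall>b\<in>Basis. continuous_on UNIV (\<lambda>x. frechet_derivative \<phi> (at x) b)) \<and>
     compact (closure {x. \<phi> x \<noteq> 0}) \<and> closure {x. \<phi> x \<noteq> 0} \<subseteq> U}"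

definition is_weak_deriv ::
    "'a::euclidean_space set \<Rightarrow> 'a \<Rightarrow> ('a \<Rightarrow> real) \<Rightarrow> ('a \<Rightarrow> real) \<Rightarrow> bool" where
  "is_weak_deriv U b f h \<longleftrightarrow> (\<forall>\<phi>\<in>test_functions U.
     (\<integral>x. f x * frechet_derivative \<phi> (at x) b \<partial>lebesgue_on U) =
     - (\<integral>x. h x * \<phi> x \<partial>lebesgue_on U))"

text \<open>A representative of the weak derivative, which is unique almost everywhere on \<open>U\<close>.\<close>

definition weak_deriv :: "'a::euclidean_space set \<Rightarrow> 'a \<Rightarrow> ('a \<Rightarrow> real) \<Rightarrow> ('a \<Rightarrow> real)" where
  "weak_deriv U b f = (SOME h. h \<in> l2_space U \<and> is_weak_deriv U b f h)"

definition H1_space :: "'a::euclidean_space set \<Rightarrow> ('a \<Rightarrow> real) set" where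
  "H1_space U = {f \<in> l2_space U. \<forall>b\<in>Basis. \<exists>h\<in>l2_space U. is_weak_deriv U b f h}"

text \<open>For an interval \<open>U\<close> of the real line this is \<open>W\<^sup>2\<^sup>,\<^sup>2(U)\<close>.\<close>

definition H2_space :: "'a::euclidean_space set \<Rightarrow> ('a \<Rightarrow> real) set" where
  "H2_space U = {f \<in> H1_space U. \<forall>b\<in>Basis. weak_deriv U b f \<in> H1_space U}"

definition H1_norm :: "'a::euclidean_space set \<Rightarrow> ('a \<Rightarrow> real) \<Rightarrow> real" where
  "H1_norm U f = sqrt ((l2_norm U f)\<^sup>2 + (\<Sum>b\<in>Basis. (l2_norm U (weak_deriv U b f))\<^sup>2))"

definition H10_space :: "'a::euclidean_space set \<Rightarrow> ('a \<Rightarrow> real) set" where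
  "H10_space U = {f \<in> H1_space U. \<forall>\<epsilon>>0. \<exists>\<phi>\<in>test_functions U. H1_norm U (f - \<phi>) < \<epsilon>}"

definition laplacian :: "'a::euclidean_space set \<Rightarrow> ('a \<Rightarrow> real) \<Rightarrow> ('a \<Rightarrow> real)" where
  "laplacian U f = (\<lambda>x. \<Sum>b\<in>Basis. weak_deriv U b (weak_deriv U b f) x)"

definition H10_inner :: "'a::euclidean_space set \<Rightarrow> real \<Rightarrow> ('a \<Rightarrow> real) \<Rightarrow> ('a \<Rightarrow> real) \<Rightarrow> real" where
  "H10_inner U \<alpha> u v =
     (\<integral>x. (\<Sum>b\<in>Basis. weak_deriv U b u x * weak_deriv U b v x) + \<alpha> * u x * v x \<partial>lebesgue_on U)"

definition H10_norm :: "'a::euclidean_space set \<Rightarrow> real \<Rightarrow> ('a \<Rightarrow> real) \<Rightarrow> real" where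
  "H10_norm U \<alpha> u = sqrt (H10_inner U \<alpha> u u)"

definition cube :: "(real^'n::finite) set" where
  "cube = {x. \<forall>i. 0 < x $ i \<and> x $ i < 1}"

type_synonym 'n state = "(real^'n \<Rightarrow> real) \<times> (real^'n \<Rightarrow> real)"

definition energy_space :: "'n::finite state set" where
  "energy_space = H10_space cube \<times> l2_space cube"

definition energy_inner :: "real \<Rightarrow> 'n::finite state \<Rightarrow> 'n state \<Rightarrow> real" where
  "energy_inner \<alpha> \<Phi> \<Psi> = H10_inner cube \<alpha> (fst \<Phi>) (fst \<Psi>) + l2_inner cube (snd \<Phi>) (snd \<Psi>)"

definition energy_norm :: "real \<Rightarrow> 'n::finite state \<Rightarrow> real" where
  "energy_norm \<alpha> \<Phi> = sqrt ((H10_norm cube \<alpha> (fst \<Phi>))\<^sup>2 + (l2_norm cube (snd \<Phi>))\<^sup>2)"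

definition same_state :: "'n::finite state \<Rightarrow> 'n state \<Rightarrow> bool" where
  "same_state \<Phi> \<Psi> \<longleftrightarrow> (AE x in lebesgue_on cube. fst \<Phi> x = fst \<Psi> x \<and> snd \<Phi> x = snd \<Psi> x)"

definition wave_domain :: "'n::finite state set" where
  "wave_domain = (H2_space cube \<inter> H10_space cube) \<times> H10_space cube"

definition wave_op :: "real \<Rightarrow> 'n::finite state \<Rightarrow> 'n state" where
  "wave_op \<alpha> \<Phi> = (\<lambda>x. - snd \<Phi> x, \<lambda>x. - laplacian cube (fst \<Phi>) x + \<alpha> * fst \<Phi> x)"

definition localize :: "(real^'n) set \<Rightarrow> 'n::finite state \<Rightarrow> 'n state" where
  "localize \<omega> \<Phi> = (\<lambda>x. fst \<Phi> x * indicator \<omega> x, \<lambda>x. snd \<Phi> x * indicator \<omega> x)"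

definition energy_L2_norm :: "real \<Rightarrow> real \<Rightarrow> (real \<Rightarrow> 'n::finite state) \<Rightarrow> real" where
  "energy_L2_norm \<alpha> T \<Psi> = sqrt (\<integral>t. (energy_norm \<alpha> (\<Psi> t))\<^sup>2 \<partial>lebesgue_on {0<..<T})"

text \<open>
  \<open>W\<close> is the integral of \<open>\<Psi>\<close> over \<open>I\<close> in the energy space. The vector-valued integral is
  tested against all elements of this separable Hilbert space; it agrees with the Bochner integral
  whenever the latter exists.
\<close>

definition has_energy_integral ::
    "real \<Rightarrow> (real \<Rightarrow> 'n::finite state) \<Rightarrow> real set \<Rightarrow> 'n state \<Rightarrow> bool" where
  "has_energy_integral \<alpha> \<Psi> I W \<longleftrightarrow>
     W \<in> energy_space \<and> (AE s in lebesgue_on I. \<Psi> s \<in> energy_space) \<and>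
     (\<forall>V\<in>energy_space. integrable (lebesgue_on I) (\<lambda>s. energy_inner \<alpha> (\<Psi> s) V) \<and>
        (\<integral>s. energy_inner \<alpha> (\<Psi> s) V \<partial>lebesgue_on I) = energy_inner \<alpha> W V)"

text \<open>
  Mild solutions of \<open>\<Phi>' + A \<Phi> + F 1\<^sub>\<omega> + G(\<Phi>) = 0\<close>, \<open>\<Phi>(0) = \<Phi>\<^sub>0\<close>, in the sense of
  Engel and Nagel: \<open>\<Phi>\<close> is continuous with values in the energy space, and for every \<open>t\<close> the
  integral of \<open>\<Phi>\<close> over \<open>(0,t)\<close> lies in \<open>D(A)\<close> and
  \<open>\<Phi>(t) = \<Phi>\<^sub>0 - A (\<integral>\<^sub>0\<^sup>t \<Phi>) - \<integral>\<^sub>0\<^sup>t (F 1\<^sub>\<omega> + G(\<Phi>))\<close>.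
\<close>

definition mild_solution ::
    "real \<Rightarrow> (real^'n::finite) set \<Rightarrow> real \<Rightarrow> ('n state \<Rightarrow> 'n state) \<Rightarrow> (real \<Rightarrow> 'n state)
      \<Rightarrow> 'n state \<Rightarrow> (real \<Rightarrow> 'n state) \<Rightarrow> bool" where
  "mild_solution \<alpha> \<omega> T G F \<Phi>0 \<Phi> \<longleftrightarrow>
     (\<forall>t\<in>{0..T}. \<Phi> t \<in> energy_space \<and>
        ((\<lambda>s. energy_norm \<alpha> (\<Phi> s - \<Phi> t)) \<longlongrightarrow> 0) (at t within {0..T})) \<and>
     (\<forall>t\<in>{0..T}. \<exists>W K. W \<in> wave_domain \<and> has_energy_integral \<alpha> \<Phi> {0<..<t} W \<and>
        has_energy_integral \<alpha> (\<lambda>s. localize \<omega> (F s) + G (\<Phi> s)) {0<..<t} K \<and>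
        same_state (\<Phi> t) (\<Phi>0 - wave_op \<alpha> W - K))"

definition exact_control ::
    "real \<Rightarrow> (real^'n::finite) set \<Rightarrow> real \<Rightarrow> ('n state \<Rightarrow> 'n state) \<Rightarrow> 'n state \<Rightarrow> 'n state
      \<Rightarrow> (real \<Rightarrow> 'n state) \<Rightarrow> bool" where
  "exact_control \<alpha> \<omega> T G \<Phi>0 \<Phi>T F \<longleftrightarrow>
     (\<exists>\<Phi>. mild_solution \<alpha> \<omega> T G F \<Phi>0 \<Phi> \<and> same_state (\<Phi> 0) \<Phi>0 \<and> same_state (\<Phi> T) \<Phi>T)"

text \<open>
  Unit-speed rays of geometric optics in the cube. \<open>R\<close> is the set of times at which the ray is on the
  boundary. The outward normals are plus or minus the coordinate vectors, so that the law of reflection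
  reverses exactly the velocity components normal to the faces being hit; on an edge or a corner all
  faces that meet there reflect. Finiteness of \<open>R\<close> excludes rays that glide inside the boundary,
  which could never enter an open subset of the open cube.
\<close>

definition optical_ray :: "real \<Rightarrow> (real \<Rightarrow> real^'n::finite) \<Rightarrow> bool" where
  "optical_ray T \<gamma> \<longleftrightarrow> continuous_on {0..T} \<gamma> \<and> \<gamma> ` {0..T} \<subseteq> closure cube \<and>
     (let R = {t \<in> {0..T}. \<gamma> t \<in> frontier cube} in
      finite R \<and>
      (\<exists>v. (\<forall>t\<in>{0..T} - R. norm (v t) = 1 \<and> (\<gamma> has_vector_derivative v t) (at t within {0..T})) \<and>
           (\<forall>s t. 0 \<le> s \<and> s \<le> t \<and> t \<le> T \<and> {s..t} \<inter> R = {} \<longrightarrow> v s = v t) \<and>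
           (\<forall>t\<in>R. 0 < t \<and> t < T \<longrightarrow>
              (\<exists>vl vr. (v \<longlongrightarrow> vl) (at_left t) \<and> (v \<longlongrightarrow> vr) (at_right t) \<and>
                 (\<forall>i. vr $ i = (if \<gamma> t $ i \<in> {0, 1} then - vl $ i else vl $ i))))))"

definition geometric_control :: "(real^'n::finite) set \<Rightarrow> real \<Rightarrow> bool" where
  "geometric_control \<omega> T \<longleftrightarrow> (\<forall>\<gamma>. optical_ray T \<gamma> \<longrightarrow> (\<exists>t\<in>{0<..<T}. \<gamma> t \<in> \<omega>))"

definition multi_indices :: "(nat^'n::finite) set" where
  "multi_indices = {k. \<forall>i. 1 \<le> k $ i}"

definition index_less :: "nat^'n::{finite,linorder} \<Rightarrow> nat^'n::{finite,linorder} \<Rightarrow> bool" where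
  "index_less k l \<longleftrightarrow> (\<Sum>i\<in>UNIV. (k $ i)\<^sup>2) < (\<Sum>i\<in>UNIV. (l $ i)\<^sup>2) \<or>
     (\<Sum>i\<in>UNIV. (k $ i)\<^sup>2) = (\<Sum>i\<in>UNIV. (l $ i)\<^sup>2) \<and>
     (\<exists>i. k $ i < l $ i \<and> (\<forall>i'<i. k $ i' = l $ i'))"

text \<open>The \<open>j\<close>-th multi-index, counting from \<open>j = 1\<close>.\<close>

definition multi_index :: "nat \<Rightarrow> nat^'n::{finite,linorder}" where
  "multi_index j = (THE k. k \<in> multi_indices \<and> card {l \<in> multi_indices. index_less l k} + 1 = j)"

definition eigfun :: "nat \<Rightarrow> real^'n::{finite,linorder} \<Rightarrow> real" where
  "eigfun j x = 2 powr (real CARD('n) / 2) *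
     (\<Prod>i\<in>UNIV. sin (real ((multi_index j :: nat^'n::{finite,linorder}) $ i) * pi * x $ i))"

text \<open>The type argument carries the dimension.\<close>

definition eigval :: "'n::{finite,linorder} itself \<Rightarrow> nat \<Rightarrow> real" where
  "eigval _ j = pi\<^sup>2 * (\<Sum>i\<in>UNIV. (real ((multi_index j :: nat^'n::{finite,linorder}) $ i))\<^sup>2)"

definition M_coeff :: "(real^'n::{finite,linorder}) set \<Rightarrow> nat \<Rightarrow> nat \<Rightarrow> real" where
  "M_coeff \<omega> j l = (\<integral>x. eigfun j x * eigfun l x \<partial>lebesgue_on \<omega>)"

definition C2_function :: "(real \<Rightarrow> real) \<Rightarrow> bool" where
  "C2_function \<sigma> \<longleftrightarrow> (\<exists>\<sigma>1 \<sigma>2. (\<forall>x. (\<sigma> has_real_derivative \<sigma>1 x) (at x)) \<and>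
     (\<forall>x. (\<sigma>1 has_real_derivative \<sigma>2 x) (at x)) \<and> continuous_on UNIV \<sigma>2)"

text \<open>
  \<open>A \<cdot> \<sigma>(W t + B)\<close>. Vectors of \<open>\<real>\<^sup>m\<close> are functions on \<open>nat\<close>, of which only the values below \<open>m\<close> are
  used, since the width is quantified inside statements. Parameter families \<open>A j i\<close> have the
  index \<open>j\<close> of the network first and the component \<open>i < m\<close> second.
\<close>

definition net :: "(real \<Rightarrow> real) \<Rightarrow> nat \<Rightarrow> (nat \<Rightarrow> real) \<Rightarrow> (nat \<Rightarrow> real) \<Rightarrow> (nat \<Rightarrow> real) \<Rightarrow> real \<Rightarrow> real" where
  "net \<sigma> m A W B t = (\<Sum>i<m. A i * \<sigma> (W i * t + B i))"

definition control_coeff ::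
    "(real \<Rightarrow> real) \<Rightarrow> nat \<Rightarrow> nat \<Rightarrow> (nat \<Rightarrow> nat \<Rightarrow> real) \<Rightarrow> (nat \<Rightarrow> nat \<Rightarrow> real) \<Rightarrow> (nat \<Rightarrow> nat \<Rightarrow> real)
      \<Rightarrow> nat \<Rightarrow> real \<Rightarrow> real" where
  "control_coeff \<sigma> Pc m A W B l t = (if l \<le> Pc then net \<sigma> m (A l) (W l) (B l) t else 0)"

definition neural_control :: "nat \<Rightarrow> (nat \<Rightarrow> real \<Rightarrow> real) \<Rightarrow> real \<Rightarrow> real^'n::{finite,linorder} \<Rightarrow> real" where
  "neural_control Pc c t x = (\<Sum>j=1..Pc. c j t * eigfun j x)"

text \<open>
  Left-hand side of the \<open>j\<close>-th Galerkin equation, for coefficients \<open>a\<close> with second derivatives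
  \<open>a2\<close> (weak or classical).
\<close>

definition galerkin_lhs ::
    "real \<Rightarrow> (real^'n::{finite,linorder}) set \<Rightarrow> (real \<Rightarrow> real) \<Rightarrow> nat \<Rightarrow> (nat \<Rightarrow> real \<Rightarrow> real)
      \<Rightarrow> (nat \<Rightarrow> real \<Rightarrow> real) \<Rightarrow> (nat \<Rightarrow> real \<Rightarrow> real) \<Rightarrow> nat \<Rightarrow> real \<Rightarrow> real" where
  "galerkin_lhs \<alpha> \<omega> g P c a a2 j t =
     a2 j t + (eigval TYPE('n) j + \<alpha>) * a j t +
     l2_inner (cube :: (real^'n::{finite,linorder}) set) (g \<circ> (\<lambda>x. \<Sum>l=1..P. a l t * eigfun l x)) (eigfun j) +
     (\<Sum>l=1..P. M_coeff \<omega> j l * c l t)"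

end

theory Submission
  imports Defs
begin

text \<open>
  The residual of a tuple of networks \<open>a\<close> is compared with the left-hand side of the Galerkin system
  at the solution \<open>as\<close>, which vanishes almost everywhere. In the difference the control terms cancel,
  and the nonlinear term is a Lipschitz function of the coefficient vector
  (\<open>galerkin_nonlinearity_Lipschitz\<close>). Hence \<open>R\<^sub>j\<close> is bounded almost everywhere by a constant times
  \<open>\<bar>a\<^sub>j'' - as\<^sub>j''\<bar> + \<Sum>\<^sub>l \<bar>a\<^sub>l - as\<^sub>l\<bar>\<close>, and it is enough to approximate every \<open>as\<^sub>l\<close> by a network in such a
  way that the functions and their second derivatives are close in \<open>L\<^sup>2\<close> (\<open>nets_dense_H2\<close>).

  For the Lipschitz bound, \<open>\<Sum>\<^sub>l d\<^sub>l e\<^sub>l\<close> has to be an element of \<open>H\<^sub>0\<^sup>1\<close> whose norm is bounded by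
  \<open>\<Sum>\<^sub>l \<bar>d\<^sub>l\<bar>\<close>. These functions are smooth and vanish linearly at the faces of the cube, so multiplying
  them with cutoff functions of the cube gives approximating test functions
  (\<open>H10_space_vanishing_boundary\<close>). The norms are defined by weak derivatives; they are computed from
  the gradient because classical derivatives are weak derivatives (\<open>C1_is_weak_deriv\<close>, by translation
  invariance of the Lebesgue integral) and weak derivatives are unique almost everywhere
  (\<open>weak_deriv_unique\<close>, by the fundamental lemma of the calculus of variations).

  For the density in \<open>H\<^sup>2(0,T)\<close>, the second derivative is treated first. Since
  \<open>(\<sigma>(w t + b))'' = w\<^sup>2 \<sigma>''(w t + b)\<close> and \<open>\<sigma>''\<close> is again continuous and not a polynomial, the second
  derivatives of networks are uniformly dense in the continuous functions on \<open>[0,T]\<close>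
  (\<open>nonpolynomial_nets_dense\<close>),
  and therefore \<open>L\<^sup>2\<close>-dense. A network whose second derivative is close to \<open>u''\<close> differs from \<open>u\<close> by an
  affine function up to a small error; this is the Poincare inequality \<open>weak_Poincare\<close>, used twice.
  The affine function is corrected by a constant, which is a network with inner weight \<open>0\<close>, and by a
  multiple of \<open>(\<sigma>(w t + b) - \<sigma> b) / w\<close> with a small \<open>w\<close>, whose second derivative is of order \<open>w\<close>.

  The uniform density is proved in the manner of Leshno, Lin, Pinkus and Schocken, with averages over
  intervals instead of smooth mollifiers. Let \<open>F\<close> arise from a continuous function \<open>\<tau>\<close> by integrating \<open>k\<close>
  times over a sliding window of length \<open>h\<close>. Then \<open>F(w t + b)\<close> is a limit of networks with activation
  \<open>\<tau>\<close>, and so is its \<open>k\<close>-th derivative with respect to \<open>w\<close>, which is \<open>t\<^sup>k\<close> times the \<open>k\<close>-th difference of \<open>\<tau>\<close>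
  of step \<open>h\<close> at \<open>w t + b\<close>. For \<open>w = 0\<close> this is a multiple of \<open>t\<^sup>k\<close>. If the factor vanished for all \<open>b\<close>
  and all \<open>h\<close>, then \<open>\<tau>\<close> would be a polynomial (\<open>Frechet_polynomial\<close>). So every monomial is a limit of
  networks, and the Weierstrass theorem applies.
\<close>

section \<open>Square-integrable functions\<close>

lemma l2_spaceD:
  assumes "f \<in> l2_space U"
  shows "f \<in> borel_measurable (lebesgue_on U)" "integrable (lebesgue_on U) (\<lambda>x. (f x)\<^sup>2)"
  using assms by (auto simp: l2_space_def)

lemma l2_space_integrable_mult:
  assumes "f \<in> l2_space U" "h \<in> l2_space U"
  shows "integrable (lebesgue_on U) (\<lambda>x. f x * h x)"
proof (rule Bochner_Integration.integrable_bound)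
  show "integrable (lebesgue_on U) (\<lambda>x. (f x)\<^sup>2 + (h x)\<^sup>2)"
    using assms by (simp add: l2_spaceD)
  show "(\<lambda>x. f x * h x) \<in> borel_measurable (lebesgue_on U)"
    using assms by (intro borel_measurable_times l2_spaceD(1))
  have "\<bar>a * b\<bar> \<le> a\<^sup>2 + b\<^sup>2" for a b :: real
  proof -
    have "2 * (\<bar>a\<bar> * \<bar>b\<bar>) \<le> a\<^sup>2 + b\<^sup>2"
      using sum_squares_bound[of "\<bar>a\<bar>" "\<bar>b\<bar>"] by (simp add: mult.assoc)
    moreover have "0 \<le> \<bar>a\<bar> * \<bar>b\<bar>" by simp
    ultimately show ?thesis unfolding abs_mult by linarith
  qed
  then show "AE x in lebesgue_on U. norm (f x * h x) \<le> norm ((f x)\<^sup>2 + (h x)\<^sup>2)"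
    by (intro always_eventually allI) (metis real_norm_def abs_of_nonneg add_nonneg_nonneg zero_le_power2)
qed

lemma l2_space_add:
  assumes "f \<in> l2_space U" "h \<in> l2_space U"
  shows "(\<lambda>x. f x + h x) \<in> l2_space U"
proof -
  have "integrable (lebesgue_on U) (\<lambda>x. ((f x)\<^sup>2 + (h x)\<^sup>2) + 2 * (f x * h x))"
    using l2_spaceD(2)[OF assms(1)] l2_spaceD(2)[OF assms(2)] l2_space_integrable_mult[OF assms]
    by simp
  moreover have "(\<lambda>x. (f x + h x)\<^sup>2) = (\<lambda>x. ((f x)\<^sup>2 + (h x)\<^sup>2) + 2 * (f x * h x))"
    by (rule ext) (simp add: power2_sum)
  ultimately show ?thesis
    using borel_measurable_add[OF l2_spaceD(1)[OF assms(1)] l2_spaceD(1)[OF assms(2)]]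
    unfolding l2_space_def mem_Collect_eq by metis
qed

lemma l2_space_cmult: "f \<in> l2_space U \<Longrightarrow> (\<lambda>x. c * f x) \<in> l2_space U"
  by (auto simp: l2_space_def power_mult_distrib)

lemma l2_space_diff:
  assumes "f \<in> l2_space U" "h \<in> l2_space U"
  shows "(\<lambda>x. f x - h x) \<in> l2_space U"
  using l2_space_add[OF assms(1) l2_space_cmult[OF assms(2), of "-1"]] by simp

lemma l2_space_sum:
  "(\<And>i. i \<in> I \<Longrightarrow> f i \<in> l2_space U) \<Longrightarrow> (\<lambda>x. \<Sum>i\<in>I. f i x) \<in> l2_space U"
proof (induction I rule: infinite_finite_induct)
  case (insert i I)
  then show ?case using l2_space_add[of "f i" U "\<lambda>x. \<Sum>i\<in>I. f i x"] by simp
qed (simp_all add: l2_space_def)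

lemma l2_inner_self_nonneg: "0 \<le> l2_inner U f f"
  by (auto simp: l2_inner_def)

lemma l2_norm_nonneg [simp]: "0 \<le> l2_norm U f"
  by (simp add: l2_norm_def l2_inner_self_nonneg)

lemma l2_norm_power2: "(l2_norm U f)\<^sup>2 = (\<integral>x. (f x)\<^sup>2 \<partial>lebesgue_on U)"
  using l2_inner_self_nonneg[of U f]
  by (simp add: l2_norm_def) (simp add: l2_inner_def power2_eq_square)

lemma l2_inner_diff_left:
  assumes "f \<in> l2_space U" "h \<in> l2_space U" "k \<in> l2_space U"
  shows "l2_inner U (\<lambda>x. f x - h x) k = l2_inner U f k - l2_inner U h k"
  by (simp add: l2_inner_def left_diff_distrib Bochner_Integration.integral_diff
      l2_space_integrable_mult assms)

text \<open>
  The quadratic polynomial \<open>t \<mapsto> \<parallel>f + t h\<parallel>\<^sup>2\<close> is nonnegative, and its value at the minimum gives the claim.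
  If \<open>\<parallel>h\<parallel> = 0\<close>, it is affine in \<open>t\<close>, which forces the inner product to vanish.
\<close>

lemma l2_inner_Cauchy_Schwarz:
  assumes f: "f \<in> l2_space U" and h: "h \<in> l2_space U"
  shows "\<bar>l2_inner U f h\<bar> \<le> l2_norm U f * l2_norm U h"
proof -
  define a b c where "a = l2_inner U f f" and "b = l2_inner U f h" and "c = l2_inner U h h"
  have quad: "0 \<le> a + 2 * t * b + t\<^sup>2 * c" for t
  proof -
    have "l2_inner U (\<lambda>x. f x + t * h x) (\<lambda>x. f x + t * h x) =
        (\<integral>x. (f x * f x + (2 * t) * (f x * h x)) + t\<^sup>2 * (h x * h x) \<partial>lebesgue_on U)"
      unfolding l2_inner_def by (rule Bochner_Integration.integral_cong) (auto simp: algebra_simps power2_eq_square)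
    also have "\<dots> = a + 2 * t * b + t\<^sup>2 * c"
      using l2_space_integrable_mult[OF f f] l2_space_integrable_mult[OF f h]
        l2_space_integrable_mult[OF h h] by (simp add: a_def b_def c_def l2_inner_def)
    finally show ?thesis
      using l2_inner_self_nonneg[of U "\<lambda>x. f x + t * h x"] by simp
  qed
  have nn: "0 \<le> a" "0 \<le> c" by (auto simp: a_def c_def l2_inner_self_nonneg)
  have "b\<^sup>2 \<le> a * c"
  proof (cases "c = 0")
    case True
    have "b = 0"
    proof (rule ccontr)
      assume "b \<noteq> 0"
      then have "2 * (- (a + 1) / (2 * b)) * b = - (a + 1)" by simp
      then show False using quad[of "- (a + 1) / (2 * b)"] unfolding True mult_zero_right by linarith
    qed
    then show ?thesis using nn by simp
  next
    case False
    then have "c > 0" using nn by simp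
    have "a + 2 * (- b / c) * b + (- b / c)\<^sup>2 * c = a - b\<^sup>2 / c"
      using \<open>c > 0\<close> by (simp add: power2_eq_square)
    then have "b\<^sup>2 / c \<le> a" using quad[of "- b / c"] by linarith
    then show ?thesis using \<open>c > 0\<close> by (simp add: pos_divide_le_eq)
  qed
  then have "sqrt (b\<^sup>2) \<le> sqrt (a * c)" by (rule real_sqrt_le_mono)
  then show ?thesis by (simp add: real_sqrt_mult l2_norm_def a_def b_def c_def)
qed

lemma l2_norm_triangle:
  assumes f: "f \<in> l2_space U" and h: "h \<in> l2_space U"
  shows "l2_norm U (\<lambda>x. f x + h x) \<le> l2_norm U f + l2_norm U h"
proof (rule power2_le_imp_le)
  have "(l2_norm U (\<lambda>x. f x + h x))\<^sup>2 =
      (\<integral>x. ((f x)\<^sup>2 + (h x)\<^sup>2) + 2 * (f x * h x) \<partial>lebesgue_on U)"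
    unfolding l2_norm_power2 by (rule Bochner_Integration.integral_cong) (auto simp: power2_sum)
  also have "\<dots> = (l2_norm U f)\<^sup>2 + (l2_norm U h)\<^sup>2 + 2 * l2_inner U f h"
    using l2_spaceD(2)[OF f] l2_spaceD(2)[OF h] l2_space_integrable_mult[OF f h]
    by (simp add: l2_norm_power2 l2_inner_def)
  also have "\<dots> \<le> (l2_norm U f + l2_norm U h)\<^sup>2"
    using l2_inner_Cauchy_Schwarz[OF f h] by (simp add: power2_sum)
  finally show "(l2_norm U (\<lambda>x. f x + h x))\<^sup>2 \<le> (l2_norm U f + l2_norm U h)\<^sup>2" .
qed simp

lemma l2_norm_cmult: "l2_norm U (\<lambda>x. c * f x) = \<bar>c\<bar> * l2_norm U f"
proof -
  have "l2_norm U (\<lambda>x. c * f x) = sqrt (c\<^sup>2 * l2_inner U f f)"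
    by (simp add: l2_norm_def l2_inner_def power2_eq_square mult.assoc mult.left_commute)
  then show ?thesis by (simp add: real_sqrt_mult l2_norm_def)
qed

lemma l2_norm_minus_commute: "l2_norm U (\<lambda>x. f x - h x) = l2_norm U (\<lambda>x. h x - f x)"
  using l2_norm_cmult[of U "-1" "\<lambda>x. h x - f x"] by simp

lemma l2_norm_triangle_diff:
  assumes "f \<in> l2_space U" "h \<in> l2_space U" "k \<in> l2_space U"
  shows "l2_norm U (\<lambda>x. f x - k x) \<le> l2_norm U (\<lambda>x. f x - h x) + l2_norm U (\<lambda>x. h x - k x)"
  using l2_norm_triangle[OF l2_space_diff[OF assms(1,2)] l2_space_diff[OF assms(2,3)]] by simp

lemma l2_norm_sum:
  "(\<And>i. i \<in> I \<Longrightarrow> f i \<in> l2_space U) \<Longrightarrow>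
    l2_norm U (\<lambda>x. \<Sum>i\<in>I. f i x) \<le> (\<Sum>i\<in>I. l2_norm U (f i))"
proof (induction I rule: infinite_finite_induct)
  case (insert i I)
  then show ?case
    using l2_norm_triangle[of "f i" U "\<lambda>x. \<Sum>i\<in>I. f i x"] l2_space_sum[of I f U]
    by fastforce
qed (simp_all add: l2_norm_def l2_inner_def)

lemma l2_norm_mono_AE:
  assumes f: "f \<in> borel_measurable (lebesgue_on U)" and h: "h \<in> l2_space U"
    and le: "AE x in lebesgue_on U. \<bar>f x\<bar> \<le> \<bar>h x\<bar>"
  shows "f \<in> l2_space U" "l2_norm U f \<le> l2_norm U h"
proof -
  have le2: "AE x in lebesgue_on U. (f x)\<^sup>2 \<le> (h x)\<^sup>2"
    using le by eventually_elim (simp add: abs_le_square_iff)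
  have "integrable (lebesgue_on U) (\<lambda>x. (f x)\<^sup>2)"
    using l2_spaceD(2)[OF h] by (rule Bochner_Integration.integrable_bound) (use f le2 in auto)
  then show fl: "f \<in> l2_space U" using f by (simp add: l2_space_def)
  have "(l2_norm U f)\<^sup>2 \<le> (l2_norm U h)\<^sup>2"
    unfolding l2_norm_power2 by (rule integral_mono_AE) (use l2_spaceD[OF fl] l2_spaceD[OF h] le2 in auto)
  then show "l2_norm U f \<le> l2_norm U h" by (rule power2_le_imp_le) simp
qed

lemma l2_norm_cong_AE:
  assumes "f \<in> borel_measurable (lebesgue_on U)" "h \<in> borel_measurable (lebesgue_on U)"
    and "AE x in lebesgue_on U. f x = h x"
  shows "l2_norm U f = l2_norm U h"
proof -
  have "l2_inner U f f = l2_inner U h h"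
    unfolding l2_inner_def by (rule integral_cong_AE) (use assms in auto)
  then show ?thesis by (simp add: l2_norm_def)
qed

lemma integrable_bounded_lebesgue_on:
  assumes U: "U \<in> lmeasurable" and f: "f \<in> borel_measurable (lebesgue_on U)"
    and le: "\<And>x. x \<in> U \<Longrightarrow> \<bar>f x\<bar> \<le> (B::real)"
  shows "integrable (lebesgue_on U) f"
proof -
  interpret finite_measure "lebesgue_on U" by (rule finite_measure_lebesgue_on[OF U])
  show ?thesis by (rule integrable_const_bound[of _ B]) (use f le in auto)
qed

lemma l2_bounded:
  assumes U: "U \<in> lmeasurable" and f: "f \<in> borel_measurable (lebesgue_on U)"
    and le: "\<And>x. x \<in> U \<Longrightarrow> \<bar>f x\<bar> \<le> B" and B: "0 \<le> B"
  shows "f \<in> l2_space U" "l2_norm U f \<le> B * sqrt (measure lebesgue U)"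
proof -
  have meas: "measure (lebesgue_on U) U = measure lebesgue U"
    by (rule measure_restrict_space) (use U in auto)
  have const: "(\<lambda>x. B) \<in> l2_space U"
    using U by (auto simp: l2_space_def intro!: integrable_bounded_lebesgue_on)
  have nc: "l2_norm U (\<lambda>x. B) = B * sqrt (measure lebesgue U)"
    using B by (simp add: l2_norm_def l2_inner_def meas real_sqrt_mult)
  have "AE x in lebesgue_on U. \<bar>f x\<bar> \<le> \<bar>B\<bar>"
    using le B by (intro AE_I2) auto
  from l2_norm_mono_AE[OF f const this] nc
  show "f \<in> l2_space U" "l2_norm U f \<le> B * sqrt (measure lebesgue U)" by auto
qed

lemma continuous_measurable_lebesgue_on:
  fixes f :: "'a::euclidean_space \<Rightarrow> real"
  assumes "continuous_on UNIV f"
  shows "f \<in> borel_measurable (lebesgue_on U)"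
  using borel_measurable_continuous_onI[OF assms]
  by (intro measurable_restrict_space1 measurable_completion) simp

lemma continuous_bounded_on_bounded:
  fixes f :: "'a::euclidean_space \<Rightarrow> real"
  assumes "bounded U" "continuous_on UNIV f"
  obtains B where "0 \<le> B" "\<And>x. x \<in> U \<Longrightarrow> \<bar>f x\<bar> \<le> B"
proof -
  have cpt: "compact (closure U)" using assms(1) by (simp add: compact_closure)
  have cont: "continuous_on (closure U) f" using assms(2) continuous_on_subset by blast
  obtain B where B: "\<forall>y \<in> f ` closure U. norm y \<le> B"
    using compact_imp_bounded[OF compact_continuous_image[OF cont cpt]] unfolding bounded_iff by blast
  show ?thesis
  proof (rule that[of "max B 0"])
    fix x assume "x \<in> U"
    then have "norm (f x) \<le> B" using B closure_subset by blast
    then show "\<bar>f x\<bar> \<le> max B 0" by simp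
  qed simp
qed

lemma continuous_in_l2_space:
  fixes f :: "'a::euclidean_space \<Rightarrow> real"
  assumes "bounded U" "U \<in> sets lebesgue" "continuous_on UNIV f"
  shows "f \<in> l2_space U"
proof -
  obtain B where "0 \<le> B" "\<And>x. x \<in> U \<Longrightarrow> \<bar>f x\<bar> \<le> B"
    by (rule continuous_bounded_on_bounded[OF assms(1,3)]) blast
  then show ?thesis
    using assms by (intro l2_bounded(1)[where B = B] bounded_set_imp_lmeasurable
        continuous_measurable_lebesgue_on)
qed

lemma tendsto_l2_norm_dominated_by:
  assumes f: "\<And>n. f n \<in> borel_measurable (lebesgue_on U)" and w: "w \<in> l2_space U"
    and bd: "\<And>n x. x \<in> U \<Longrightarrow> \<bar>f n x\<bar> \<le> \<bar>w x\<bar>"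
    and lim: "AE x in lebesgue_on U. (\<lambda>n. f n x) \<longlonglongrightarrow> 0"
  shows "(\<lambda>n. l2_norm U (f n)) \<longlonglongrightarrow> 0"
proof -
  have "(\<lambda>n. \<integral>x. (f n x)\<^sup>2 \<partial>lebesgue_on U) \<longlonglongrightarrow> (\<integral>x. 0 \<partial>lebesgue_on U)"
  proof (rule integral_dominated_convergence[where w = "\<lambda>x. (w x)\<^sup>2"])
    show "integrable (lebesgue_on U) (\<lambda>x. (w x)\<^sup>2)" by (rule l2_spaceD(2)[OF w])
    show "AE x in lebesgue_on U. (\<lambda>n. (f n x)\<^sup>2) \<longlonglongrightarrow> 0"
      using lim by eventually_elim (rule tendsto_null_power, simp_all)
    show "AE x in lebesgue_on U. norm ((f n x)\<^sup>2) \<le> (w x)\<^sup>2" for n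
      using bd[of _ n] by (intro AE_I2) (simp add: abs_le_square_iff[symmetric])
  qed (use f in simp_all)
  then have "(\<lambda>n. (l2_norm U (f n))\<^sup>2) \<longlonglongrightarrow> 0" by (simp add: l2_norm_power2)
  then have "(\<lambda>n. sqrt ((l2_norm U (f n))\<^sup>2)) \<longlonglongrightarrow> sqrt 0" by (rule tendsto_real_sqrt)
  then show ?thesis by simp
qed

lemma tendsto_l2_norm_dominated:
  assumes U: "U \<in> lmeasurable" and f: "\<And>n. f n \<in> borel_measurable (lebesgue_on U)"
    and bd: "\<And>n x. x \<in> U \<Longrightarrow> \<bar>f n x\<bar> \<le> B"
    and lim: "AE x in lebesgue_on U. (\<lambda>n. f n x) \<longlonglongrightarrow> 0"
  shows "(\<lambda>n. l2_norm U (f n)) \<longlonglongrightarrow> 0"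
proof (rule tendsto_l2_norm_dominated_by[OF f _ _ lim])
  show "(\<lambda>x. B) \<in> l2_space U" by (rule l2_bounded(1)[OF U, of _ "\<bar>B\<bar>"]) auto
  show "\<bar>f n x\<bar> \<le> \<bar>B\<bar>" if "x \<in> U" for n x using bd[OF that] by (rule order_trans) simp
qed

section \<open>Continuously differentiable functions\<close>

text \<open>
  The regularity of test functions, without the condition on the support.
\<close>

definition C1 :: "('a::euclidean_space \<Rightarrow> real) \<Rightarrow> bool" where
  "C1 f \<longleftrightarrow> (\<forall>x. f differentiable (at x)) \<and>
     (\<forall>b\<in>Basis. continuous_on UNIV (\<lambda>x. frechet_derivative f (at x) b))"

abbreviation partial :: "'a::euclidean_space \<Rightarrow> ('a \<Rightarrow> real) \<Rightarrow> 'a \<Rightarrow> real" where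
  "partial b f x \<equiv> frechet_derivative f (at x) b"

lemma C1_I:
  assumes "\<And>x. (f has_derivative D x) (at x)"
    and "\<And>b. b \<in> Basis \<Longrightarrow> continuous_on UNIV (\<lambda>x. D x b)"
  shows "C1 f"
proof -
  have "frechet_derivative f (at x) = D x" for x
    using frechet_derivative_at[OF assms(1)] by simp
  then show ?thesis using assms unfolding C1_def differentiable_def by auto
qed

lemma C1_has_derivative: "C1 f \<Longrightarrow> (f has_derivative frechet_derivative f (at x)) (at x)"
  by (simp add: C1_def frechet_derivative_works[symmetric])

lemma C1_continuous_partial: "C1 f \<Longrightarrow> b \<in> Basis \<Longrightarrow> continuous_on UNIV (partial b f)"
  by (simp add: C1_def)

lemma C1_continuous: "C1 f \<Longrightarrow> continuous_on S f"
  by (meson C1_def continuous_at_imp_continuous_on differentiable_imp_continuous_within)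

lemma partial_eqI: "(f has_derivative D) (at x) \<Longrightarrow> partial b f x = D b"
  using frechet_derivative_at by metis

lemma partial_add: "C1 f \<Longrightarrow> C1 h \<Longrightarrow> partial b (\<lambda>x. f x + h x) x = partial b f x + partial b h x"
  using partial_eqI[OF has_derivative_add[OF C1_has_derivative C1_has_derivative]] .

lemma C1_add: "C1 f \<Longrightarrow> C1 h \<Longrightarrow> C1 (\<lambda>x. f x + h x)"
  by (rule C1_I, rule has_derivative_add[OF C1_has_derivative C1_has_derivative])
    (auto intro!: continuous_intros C1_continuous_partial)

lemma partial_cmult: "C1 f \<Longrightarrow> partial b (\<lambda>x. c * f x) x = c * partial b f x"
  using partial_eqI[OF has_derivative_mult_right[OF C1_has_derivative]] .

lemma C1_cmult: "C1 f \<Longrightarrow> C1 (\<lambda>x. c * f x)"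
  by (rule C1_I, rule has_derivative_mult_right[OF C1_has_derivative])
    (auto intro!: continuous_intros C1_continuous_partial)

lemma C1_diff: "C1 f \<Longrightarrow> C1 h \<Longrightarrow> C1 (\<lambda>x. f x - h x)"
  by (rule C1_I, rule has_derivative_diff[OF C1_has_derivative C1_has_derivative])
    (auto intro!: continuous_intros C1_continuous_partial)

lemma partial_diff: "C1 f \<Longrightarrow> C1 h \<Longrightarrow> partial b (\<lambda>x. f x - h x) x = partial b f x - partial b h x"
  using partial_eqI[OF has_derivative_diff[OF C1_has_derivative C1_has_derivative]] .

lemma partial_mult:
  "C1 f \<Longrightarrow> C1 h \<Longrightarrow> partial b (\<lambda>x. f x * h x) x = f x * partial b h x + partial b f x * h x"
  using partial_eqI[OF has_derivative_mult[OF C1_has_derivative C1_has_derivative]] .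

lemma C1_mult: "C1 f \<Longrightarrow> C1 h \<Longrightarrow> C1 (\<lambda>x. f x * h x)"
  by (rule C1_I, rule has_derivative_mult[OF C1_has_derivative C1_has_derivative])
    (auto intro!: continuous_on_add continuous_on_mult C1_continuous_partial C1_continuous[of f]
      C1_continuous[of h])

lemma C1_const: "C1 (\<lambda>x. c)"
  by (rule C1_I, rule has_derivative_const) auto

lemma partial_const: "partial b (\<lambda>x. c) x = 0"
  using partial_eqI[OF has_derivative_const] .

lemma C1_sum: "(\<And>i. i \<in> I \<Longrightarrow> C1 (f i)) \<Longrightarrow> C1 (\<lambda>x. \<Sum>i\<in>I. f i x)"
  by (induction I rule: infinite_finite_induct) (auto simp: C1_const intro!: C1_add)

lemma partial_sum:
  "(\<And>i. i \<in> I \<Longrightarrow> C1 (f i)) \<Longrightarrow> partial b (\<lambda>x. \<Sum>i\<in>I. f i x) x = (\<Sum>i\<in>I. partial b (f i) x)"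
proof (induction I rule: infinite_finite_induct)
  case (insert i I)
  then have "partial b (\<lambda>x. f i x + (\<Sum>i\<in>I. f i x)) x = partial b (f i) x + partial b (\<lambda>x. \<Sum>i\<in>I. f i x) x"
    by (intro partial_add C1_sum) auto
  with insert show ?case by simp
qed (simp_all add: partial_const)

lemma C1_prod: "(\<And>i. i \<in> I \<Longrightarrow> C1 (f i)) \<Longrightarrow> C1 (\<lambda>x. \<Prod>i\<in>I. f i x)"
  by (induction I rule: infinite_finite_induct) (auto simp: C1_const intro!: C1_mult)

lemma has_derivative_real_compose:
  assumes "C1 f" "(h has_real_derivative h') (at (f x))"
  shows "((\<lambda>x. h (f x)) has_derivative (\<lambda>v. h' * frechet_derivative f (at x) v)) (at x)"
  using diff_chain_at[OF C1_has_derivative[OF assms(1)] has_field_derivative_imp_has_derivative[OF assms(2)]]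
  by (simp add: o_def)

lemma C1_compose:
  assumes "C1 f" "\<And>s. (h has_real_derivative h' s) (at s)" "continuous_on UNIV h'"
  shows "C1 (\<lambda>x. h (f x))"
  by (rule C1_I, rule has_derivative_real_compose[OF assms(1,2)])
    (auto intro!: continuous_on_mult C1_continuous_partial[OF assms(1)] C1_continuous[OF assms(1)]
      continuous_on_compose2[OF assms(3)])

lemma partial_compose:
  assumes "C1 f" "\<And>s. (h has_real_derivative h' s) (at s)"
  shows "partial b (\<lambda>x. h (f x)) x = h' (f x) * partial b f x"
  using partial_eqI[OF has_derivative_real_compose[OF assms]] .

lemma C1_inner: "C1 (\<lambda>x. x \<bullet> i)"
  by (rule C1_I[of _ "\<lambda>x y. y \<bullet> i"]) (auto intro!: derivative_eq_intros)

lemma partial_inner: "partial b (\<lambda>x. x \<bullet> i) x = b \<bullet> i"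
  by (rule partial_eqI) (auto intro!: derivative_eq_intros)

lemma C1_real:
  assumes "\<And>s. (h has_real_derivative h' s) (at s)" "continuous_on UNIV h'"
  shows "C1 (h :: real \<Rightarrow> real)" "partial 1 h s = h' s"
  using C1_compose[OF C1_inner[of "1::real"] assms]
    partial_compose[OF C1_inner[of "1::real"] assms(1), where b = 1 and x = s] partial_inner[of 1 1 s]
  by (simp_all add: inner_real_def)

lemma test_functions_iff:
  "\<phi> \<in> test_functions U \<longleftrightarrow> C1 \<phi> \<and> compact (closure {x. \<phi> x \<noteq> 0}) \<and> closure {x. \<phi> x \<noteq> 0} \<subseteq> U"
  by (auto simp: test_functions_def C1_def)

lemma partial_zero_outside_support:
  assumes "x \<notin> closure {x. \<phi> x \<noteq> (0::real)}"
  shows "partial b \<phi> x = 0"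
proof (rule partial_eqI)
  show "(\<phi> has_derivative (\<lambda>h. 0)) (at x)"
  proof (rule has_derivative_transform_within_open[of "\<lambda>x. 0" _ x UNIV "- closure {x. \<phi> x \<noteq> 0}"])
    show "0 = \<phi> y" if "y \<in> - closure {x. \<phi> x \<noteq> 0}" for y
      using that closure_subset[of "{x. \<phi> x \<noteq> 0}"] by auto
  qed (use assms in \<open>auto simp: has_derivative_const\<close>)
qed

section \<open>Cutoff functions of boxes\<close>

lemma has_real_derivative_pos_part_power2:
  "((\<lambda>s::real. (max 0 s)\<^sup>2) has_real_derivative 2 * max 0 s) (at s)"
proof -
  consider "s < 0" | "s = 0" | "s > 0" by linarith
  then show ?thesis
  proof cases
    case 1
    have "((\<lambda>s. 0) has_real_derivative 2 * max 0 s) (at s)" using 1 by simp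
    then show ?thesis
      by (rule has_field_derivative_transform_within_open[of _ _ _ "{..<0}"]) (use 1 in auto)
  next
    case 3
    have "((\<lambda>s. s\<^sup>2) has_real_derivative 2 * max 0 s) (at s)"
      using 3 by (auto intro!: derivative_eq_intros)
    then show ?thesis
      by (rule has_field_derivative_transform_within_open[of _ _ _ "{0<..}"]) (use 3 in auto)
  next
    case 2
    have "((\<lambda>h. ((max 0 (0 + h))\<^sup>2 - (max 0 0)\<^sup>2) / h) \<longlongrightarrow> 0) (at (0::real))"
    proof (rule tendsto_0_le[where K = 1])
      show "((\<lambda>h::real. h) \<longlongrightarrow> 0) (at 0)" by (rule tendsto_ident_at)
      show "\<forall>\<^sub>F h::real in at 0. norm (((max 0 (0 + h))\<^sup>2 - (max 0 0)\<^sup>2) / h) \<le> norm h * 1"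
        by (intro always_eventually allI) (auto simp: max_def power2_eq_square)
    qed
    then show ?thesis using 2 by (simp add: DERIV_def)
  qed
qed

text \<open>
  The rational function \<open>q / (1 + q)\<close> of \<open>q = (s - 1)\<^sub>+\<^sup>2\<close>: a step from \<open>0\<close> to \<open>1\<close> that is continuously
  differentiable, vanishes up to \<open>s = 1\<close>, and approaches \<open>1\<close> so fast that \<open>s\<^sup>2 ramp' s\<close> and
  \<open>s (1 - ramp s)\<close> stay bounded for positive \<open>s\<close>.
\<close>

definition ramp :: "real \<Rightarrow> real" where
  "ramp s = (max 0 (s - 1))\<^sup>2 / (1 + (max 0 (s - 1))\<^sup>2)"

definition ramp' :: "real \<Rightarrow> real" where
  "ramp' s = 2 * max 0 (s - 1) / (1 + (max 0 (s - 1))\<^sup>2)\<^sup>2"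

lemma one_add_power2_pos: "0 < 1 + (x::real)\<^sup>2"
  by (simp add: add_pos_nonneg)

lemma has_real_derivative_ramp: "(ramp has_real_derivative ramp' s) (at s)"
proof -
  define q where "q = (\<lambda>s::real. (max 0 (s - 1))\<^sup>2)"
  have "((\<lambda>s. s - 1) has_real_derivative 1) (at s)" by (auto intro!: derivative_eq_intros)
  then have q: "(q has_real_derivative 2 * max 0 (s - 1)) (at s)"
    unfolding q_def using DERIV_chain2[where f = "\<lambda>s. (max 0 s)\<^sup>2" and g = "\<lambda>s. s - 1" and x = s,
      OF has_real_derivative_pos_part_power2, of 1 UNIV] by simp
  have nz: "1 + q s \<noteq> 0" using one_add_power2_pos[of "max 0 (s - 1)"] by (simp add: q_def)
  have "((\<lambda>s. q s / (1 + q s)) has_real_derivative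
      (2 * max 0 (s - 1) * (1 + q s) - q s * (2 * max 0 (s - 1))) / ((1 + q s) * (1 + q s))) (at s)"
    using nz by (auto intro!: derivative_eq_intros q)
  moreover have "(2 * max 0 (s - 1) * (1 + q s) - q s * (2 * max 0 (s - 1))) / ((1 + q s) * (1 + q s)) = ramp' s"
    by (simp add: ramp'_def q_def power2_eq_square algebra_simps)
  moreover have "ramp = (\<lambda>s. q s / (1 + q s))" by (rule ext) (simp add: ramp_def q_def)
  ultimately show ?thesis by simp
qed

lemma continuous_ramp': "continuous_on UNIV ramp'"
  unfolding ramp'_def[abs_def]
  by (intro continuous_intros) (metis one_add_power2_pos less_irrefl zero_eq_power2)

lemma ramp_nonneg [simp]: "0 \<le> ramp s" and ramp_le_1 [simp]: "ramp s \<le> 1"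
  using one_add_power2_pos[of "max 0 (s - 1)"] by (auto simp: ramp_def)

lemma ramp_eq_0: "s \<le> 1 \<Longrightarrow> ramp s = 0"
  by (simp add: ramp_def)

lemma ramp'_nonneg [simp]: "0 \<le> ramp' s"
  by (simp add: ramp'_def)

lemma ramp'_eq_0: "s \<le> 1 \<Longrightarrow> ramp' s = 0"
  by (simp add: ramp'_def)

text \<open>
  This decay pays for the factor \<open>n\<close> in the derivative of \<open>ramp (n d)\<close>: multiplied by a function of
  size \<open>d\<close>, that derivative stays bounded and tends to \<open>0\<close> as \<open>n\<close> grows.
\<close>

lemma power2_mult_ramp'_le: "s\<^sup>2 * ramp' s \<le> 4"
proof (cases "s \<le> 1")
  case False
  define u where "u = s - 1"
  have u: "0 < u" "s = u + 1" using False by (auto simp: u_def)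
  have "(u + 1)\<^sup>2 \<le> 2 * (1 + u\<^sup>2)" "2 * u \<le> 1 + u\<^sup>2"
    using zero_le_power2[of "u - 1"] by (simp_all add: power2_eq_square algebra_simps)
  then have "(u + 1)\<^sup>2 * (2 * u) \<le> (2 * (1 + u\<^sup>2)) * (1 + u\<^sup>2)"
    using u by (intro mult_mono) auto
  moreover have "0 \<le> (1 + u\<^sup>2)\<^sup>2" by simp
  ultimately have "(u + 1)\<^sup>2 * (2 * u) \<le> 4 * (1 + u\<^sup>2)\<^sup>2"
    unfolding power2_eq_square[of "1 + u\<^sup>2"] mult.assoc by linarith
  moreover have "ramp' s = 2 * u / (1 + u\<^sup>2)\<^sup>2" using u by (simp add: ramp'_def)
  moreover have "0 < (1 + u\<^sup>2)\<^sup>2" using one_add_power2_pos[of u] by simp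
  ultimately show ?thesis using u(2) by (simp add: pos_divide_le_eq)
qed (simp add: ramp'_eq_0)

lemma mult_ramp'_le:
  assumes "0 < s" shows "s * ramp' s \<le> 4 / s" "s * ramp' s \<le> 4"
proof -
  show 1: "s * ramp' s \<le> 4 / s"
    using power2_mult_ramp'_le[of s] assms by (simp add: pos_le_divide_eq power2_eq_square algebra_simps)
  show "s * ramp' s \<le> 4"
  proof (cases "s \<le> 1")
    case False
    then have "4 / s \<le> 4" by (simp add: divide_le_eq)
    with 1 show ?thesis by linarith
  qed (simp add: ramp'_eq_0)
qed

lemma one_minus_ramp_le:
  assumes "0 < s" shows "1 - ramp s \<le> 2 / s"
proof (cases "s \<le> 1")
  case True
  then have "1 \<le> 2 / s" using assms by simp
  then show ?thesis using True by (simp add: ramp_eq_0)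
next
  case False
  define u where "u = s - 1"
  have u: "0 < u" "s = u + 1" using False by (auto simp: u_def)
  have pos: "0 < 1 + u\<^sup>2" by (rule one_add_power2_pos)
  have "1 - ramp s = 1 / (1 + u\<^sup>2)"
    using u pos by (simp add: ramp_def diff_divide_eq_iff)
  also have "\<dots> \<le> 2 / s"
  proof -
    have "2 * u \<le> 1 + u\<^sup>2" using zero_le_power2[of "u - 1"]
      by (simp add: power2_eq_square algebra_simps)
    moreover have "0 \<le> u\<^sup>2" by simp
    ultimately have "u + 1 \<le> 2 * (1 + u\<^sup>2)" unfolding distrib_left by linarith
    then show ?thesis using pos u by (simp add: frac_le_eq divide_le_eq pos_le_divide_eq mult.commute)
  qed
  finally show ?thesis .
qed

text \<open>
  Inside the box this is positive and comparable to the distance from the nearer of the two faces orthogonal to \<open>i\<close>.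
\<close>

definition edge :: "'a::euclidean_space \<Rightarrow> 'a \<Rightarrow> 'a \<Rightarrow> 'a \<Rightarrow> real" where
  "edge a b i x = (x \<bullet> i - a \<bullet> i) * (b \<bullet> i - x \<bullet> i)"

text \<open>
  Test functions on the box that converge to its indicator function.
\<close>

definition cutoff :: "'a::euclidean_space \<Rightarrow> 'a \<Rightarrow> nat \<Rightarrow> 'a \<Rightarrow> real" where
  "cutoff a b n x = (\<Prod>i\<in>Basis. ramp (real n * edge a b i x))"

lemma C1_edge: "C1 (edge a b i)"
  unfolding edge_def[abs_def] by (intro C1_mult C1_diff C1_inner C1_const)

lemma partial_edge:
  "partial j (edge a b i) x = (j \<bullet> i) * (a \<bullet> i + b \<bullet> i - 2 * (x \<bullet> i))"
proof -
  have "partial j (edge a b i) x = (x \<bullet> i - a \<bullet> i) * partial j (\<lambda>x. b \<bullet> i - x \<bullet> i) x +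
      partial j (\<lambda>x. x \<bullet> i - a \<bullet> i) x * (b \<bullet> i - x \<bullet> i)"
    unfolding edge_def[abs_def] by (intro partial_mult C1_diff C1_inner C1_const)
  also have "\<dots> = (j \<bullet> i) * (a \<bullet> i + b \<bullet> i - 2 * (x \<bullet> i))"
    by (simp add: partial_diff C1_inner C1_const partial_inner partial_const algebra_simps)
  finally show ?thesis .
qed

lemma C1_ramp_edge: "C1 (\<lambda>x. ramp (real n * edge a b i x))"
  using C1_compose[OF C1_cmult[OF C1_edge] has_real_derivative_ramp continuous_ramp'] .

lemma C1_cutoff: "C1 (cutoff a b n)"
  unfolding cutoff_def[abs_def] by (intro C1_prod C1_ramp_edge)

lemma cutoff_nonneg [simp]: "0 \<le> cutoff a b n x" and cutoff_le_1 [simp]: "cutoff a b n x \<le> 1"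
  by (auto simp: cutoff_def intro!: prod_nonneg prod_le_1)

lemma edge_pos_iff:
  assumes "a \<bullet> i < b \<bullet> i" shows "0 < edge a b i x \<longleftrightarrow> a \<bullet> i < x \<bullet> i \<and> x \<bullet> i < b \<bullet> i"
  using assms by (auto simp: edge_def zero_less_mult_iff)

lemma cutoff_nonzero_imp:
  assumes "cutoff a b n x \<noteq> 0" "i \<in> Basis" shows "1 \<le> real n * edge a b i x"
proof (rule ccontr)
  assume "\<not> ?thesis"
  then have "ramp (real n * edge a b i x) = 0" by (simp add: ramp_eq_0)
  then show False using assms by (auto simp: cutoff_def prod_zero_iff)
qed

lemma closure_support_cutoff:
  "closure {x. cutoff a b n x \<noteq> 0} \<subseteq> {x. \<forall>i\<in>Basis. 1 \<le> real n * edge a b i x}"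
proof (rule closure_minimal)
  have "closed (\<Inter>i\<in>Basis. {x. 1 \<le> real n * edge a b i x})"
    unfolding edge_def by (intro closed_INT ballI closed_Collect_le continuous_intros)
  moreover have "(\<Inter>i\<in>Basis. {x. 1 \<le> real n * edge a b i x}) = {x. \<forall>i\<in>Basis. 1 \<le> real n * edge a b i x}"
    by auto
  ultimately show "closed {x. \<forall>i\<in>Basis. 1 \<le> real n * edge a b i x}" by simp
qed (use cutoff_nonzero_imp in blast)

lemma closure_support_cutoff_box:
  assumes "box a b \<noteq> {}"
  shows "closure {x. cutoff a b n x \<noteq> 0} \<subseteq> box a b"
proof
  fix x assume "x \<in> closure {x. cutoff a b n x \<noteq> 0}"
  then have "\<forall>i\<in>Basis. 1 \<le> real n * edge a b i x" using closure_support_cutoff by blast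
  then have "\<forall>i\<in>Basis. 0 < edge a b i x"
    by (metis less_le_trans of_nat_0_le_iff zero_less_mult_pos zero_less_one mult_zero_left
        of_nat_0_less_iff not_one_le_zero of_nat_0 gr0I)
  then show "x \<in> box a b" using assms by (simp add: mem_box edge_pos_iff box_ne_empty)
qed

lemma cutoff_in_test_functions:
  assumes "box a b \<noteq> {}" "box a b \<subseteq> U"
  shows "cutoff a b n \<in> test_functions U"
proof -
  have "bounded {x. cutoff a b n x \<noteq> 0}"
    using closure_support_cutoff_box[OF assms(1), of n] closure_subset bounded_box bounded_subset
    by (metis subset_trans)
  then show ?thesis
    using closure_support_cutoff_box[OF assms(1), of n] assms(2)
    by (auto simp: test_functions_iff C1_cutoff compact_closure)
qed

lemma ramp_mult_tendsto_1:
  assumes "0 < y" shows "(\<lambda>n. ramp (real n * y)) \<longlonglongrightarrow> 1"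
proof -
  have "(\<lambda>n. 1 - ramp (real n * y)) \<longlonglongrightarrow> 0"
  proof (rule tendsto_sandwich[of "\<lambda>n. 0" _ _ "\<lambda>n. (2 / y) * inverse (real n)"])
    show "\<forall>\<^sub>F n in sequentially. 1 - ramp (real n * y) \<le> (2 / y) * inverse (real n)"
      using eventually_gt_at_top[of 0]
    proof eventually_elim
      case (elim n)
      then show ?case using one_minus_ramp_le[of "real n * y"] assms by (simp add: field_simps)
    qed
    show "(\<lambda>n. (2 / y) * inverse (real n)) \<longlonglongrightarrow> 0"
      using tendsto_mult_right_zero[OF lim_inverse_n, of "2 / y"] by simp
  qed auto
  from tendsto_diff[OF tendsto_const[of 1] this] show ?thesis by simp
qed

lemma cutoff_tendsto:
  assumes "box a b \<noteq> {}"
  shows "(\<lambda>n. cutoff a b n x) \<longlonglongrightarrow> indicator (box a b) x"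
proof (cases "x \<in> box a b")
  case True
  have "(\<lambda>n. \<Prod>i\<in>Basis. ramp (real n * edge a b i x)) \<longlonglongrightarrow> (\<Prod>i\<in>(Basis::'a set). 1)"
    using True assms
    by (intro tendsto_prod ramp_mult_tendsto_1) (auto simp: mem_box edge_pos_iff box_ne_empty)
  then show ?thesis using True by (simp add: cutoff_def)
next
  case False
  then have "cutoff a b n x = 0" for n
    using closure_support_cutoff_box[OF assms, of n] closure_subset[of "{x. cutoff a b n x \<noteq> 0}"] by blast
  then show ?thesis using False by simp
qed

section \<open>Classical and weak derivatives\<close>

lemma integral_lebesgue_on_eq_lborel:
  fixes f :: "'a::euclidean_space \<Rightarrow> real"
  assumes U: "U \<in> sets lebesgue" and f: "f \<in> borel_measurable borel" and z: "\<And>x. x \<notin> U \<Longrightarrow> f x = 0"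
  shows "(\<integral>x. f x \<partial>lebesgue_on U) = (\<integral>x. f x \<partial>lborel)"
proof -
  have "(\<integral>x. f x \<partial>lebesgue_on U) = (\<integral>x. indicator U x *\<^sub>R f x \<partial>lebesgue)"
    by (rule integral_restrict_space) (use U in auto)
  also have "(\<lambda>x. indicator U x *\<^sub>R f x) = f" by (rule ext) (auto simp: indicator_def z)
  also have "(\<integral>x. f x \<partial>lebesgue) = (\<integral>x. f x \<partial>lborel)"
    by (rule integral_completion) (use f in simp)
  finally show ?thesis .
qed

lemma integrable_lborel_compact_support:
  fixes f :: "'a::euclidean_space \<Rightarrow> real"
  assumes "continuous_on UNIV f" "compact K" "\<And>x. x \<notin> K \<Longrightarrow> f x = 0"
  shows "integrable lborel f"
proof -
  have "integrable lborel (\<lambda>x. indicator K x *\<^sub>R f x)"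
    using assms by (intro borel_integrable_compact) (auto intro: continuous_on_subset)
  also have "(\<lambda>x. indicator K x *\<^sub>R f x) = f" by (rule ext) (auto simp: indicator_def assms(3))
  finally show ?thesis .
qed

lemma integral_lborel_shift:
  fixes f :: "'a::euclidean_space \<Rightarrow> real"
  assumes "f \<in> borel_measurable borel"
  shows "(\<integral>x. f (c + x) \<partial>lborel) = (\<integral>x. f x \<partial>lborel)"
proof -
  have "(\<integral>x. f x \<partial>lborel) = (\<integral>x. f x \<partial>distr lborel borel ((+) c))" by (simp add: lborel_distr_plus)
  also have "\<dots> = (\<integral>x. f (c + x) \<partial>lborel)" by (rule integral_distr) (use assms in auto)
  finally show ?thesis by simp
qed

lemma has_real_derivative_along:
  assumes "C1 f"
  shows "((\<lambda>t. f (x + t *\<^sub>R b)) has_real_derivative partial b f (x + t *\<^sub>R b)) (at t)"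
proof -
  have "((\<lambda>t. x + t *\<^sub>R b) has_derivative (\<lambda>h. h *\<^sub>R b)) (at t)"
    by (auto intro!: derivative_eq_intros)
  from diff_chain_at[OF this C1_has_derivative[OF assms]]
  have "((\<lambda>t. f (x + t *\<^sub>R b)) has_derivative (\<lambda>h. frechet_derivative f (at (x + t *\<^sub>R b)) (h *\<^sub>R b))) (at t)"
    by (simp add: o_def)
  moreover have "frechet_derivative f (at y) (h *\<^sub>R b) = partial b f y * h" for y h
    using linear_scale[OF has_derivative_linear[OF C1_has_derivative[OF assms]], of y h b] by simp
  ultimately show ?thesis by (simp add: has_field_derivative_def)
qed

text \<open>
  The difference quotients in direction \<open>b\<close> have integral \<open>0\<close> by translation invariance. By the mean
  value theorem they are bounded, uniformly in the step, by a multiple of the indicator of a ball, so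
  that their integrals converge to that of the partial derivative.
\<close>

lemma integral_partial_eq_0:
  fixes \<psi> :: "'a::euclidean_space \<Rightarrow> real"
  assumes \<psi>: "C1 \<psi>" and cpt: "compact (closure {x. \<psi> x \<noteq> 0})" and b: "b \<in> Basis"
  shows "(\<integral>x. partial b \<psi> x \<partial>lborel) = 0"
proof -
  define K where "K = closure {x. \<psi> x \<noteq> 0}"
  have cpt: "compact K" using cpt by (simp add: K_def)
  let ?q = "\<lambda>n x. real (Suc n) * (\<psi> (x + (1 / real (Suc n)) *\<^sub>R b) - \<psi> x)"
  have cont: "continuous_on UNIV \<psi>" "continuous_on UNIV (partial b \<psi>)"
    using \<psi> b by (auto intro: C1_continuous C1_continuous_partial)
  have zero: "\<psi> x = 0" "partial b \<psi> x = 0" if "x \<notin> K" for x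
    using that closure_subset[of "{x. \<psi> x \<noteq> 0}"] partial_zero_outside_support[of x \<psi>]
    unfolding K_def by blast+
  obtain R where R: "\<And>x. x \<in> K \<Longrightarrow> norm x \<le> R"
    using compact_imp_bounded[OF cpt] unfolding bounded_iff by blast
  obtain B where B: "0 \<le> B" "\<And>x. x \<in> K \<Longrightarrow> \<bar>partial b \<psi> x\<bar> \<le> B"
    by (rule continuous_bounded_on_bounded[OF compact_imp_bounded[OF cpt] cont(2)]) blast
  have B': "\<bar>partial b \<psi> x\<bar> \<le> B" for x
    using B zero[of x] by (cases "x \<in> K") auto
  have meas: "\<psi> \<in> borel_measurable borel" "partial b \<psi> \<in> borel_measurable borel"
    using cont by (auto intro: borel_measurable_continuous_onI)
  have int: "integrable lborel \<psi>"
    using integrable_lborel_compact_support[OF cont(1) cpt zero(1)] .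
  have far: "\<psi> (x + (1 / real (Suc n)) *\<^sub>R b) = 0" if x: "x \<notin> cball (0::'a) (R + 1)" for n x
  proof -
    define h where "h = (1 / real (Suc n)) *\<^sub>R b"
    have "norm h \<le> 1" using b by (simp add: h_def)
    moreover have "R + 1 < norm x" using x by simp
    moreover have "norm x \<le> norm (x + h) + norm h" using norm_triangle_ineq4[of "x + h" h] by simp
    ultimately have "R < norm (x + h)" by linarith
    then show ?thesis using R[of "x + h"] zero(1)[of "x + h"] unfolding h_def by linarith
  qed
  have cont_shift: "continuous_on UNIV (\<lambda>x. \<psi> (x + c))" for c
    by (rule continuous_on_compose2[OF cont(1)]) (auto intro!: continuous_intros)
  have qint: "(\<integral>x. ?q n x \<partial>lborel) = 0" for n
  proof -
    have "(\<integral>x. \<psi> (x + (1 / real (Suc n)) *\<^sub>R b) \<partial>lborel) = (\<integral>x. \<psi> x \<partial>lborel)"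
      using integral_lborel_shift[OF meas(1), of "(1 / real (Suc n)) *\<^sub>R b"] by (simp add: add.commute)
    moreover have "integrable lborel (\<lambda>x. \<psi> (x + (1 / real (Suc n)) *\<^sub>R b))"
    proof (rule integrable_lborel_compact_support[of _ "cball (0::'a) (R + 1)"])
      show "continuous_on UNIV (\<lambda>x. \<psi> (x + (1 / real (Suc n)) *\<^sub>R b))" by (rule cont_shift)
    qed (use far in auto)
    ultimately show ?thesis using int by simp
  qed
  have "(\<lambda>n. \<integral>x. ?q n x \<partial>lborel) \<longlonglongrightarrow> (\<integral>x. partial b \<psi> x \<partial>lborel)"
  proof (rule integral_dominated_convergence[where w = "\<lambda>x. B * indicator (cball (0::'a) (R + 1)) x"])
    show "integrable lborel (\<lambda>x. B * indicator (cball (0::'a) (R + 1)) x)"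
      by (intro integrable_mult_right integrable_real_indicator)
        (simp_all add: emeasure_lborel_cball_finite[unfolded infinity_ennreal_def])
    show "AE x in lborel. (\<lambda>n. ?q n x) \<longlonglongrightarrow> partial b \<psi> x"
    proof (rule always_eventually, rule allI)
      fix x
      have "((\<lambda>h. (\<psi> (x + h *\<^sub>R b) - \<psi> x) / h) \<longlongrightarrow> partial b \<psi> x) (at 0)"
        using has_real_derivative_along[OF \<psi>, of x b 0] by (simp add: DERIV_def)
      moreover have "filterlim (\<lambda>n. 1 / real (Suc n)) (at 0) sequentially"
        unfolding filterlim_at using LIMSEQ_Suc[OF lim_1_over_n] by auto
      ultimately have "(\<lambda>n. (\<psi> (x + (1 / real (Suc n)) *\<^sub>R b) - \<psi> x) / (1 / real (Suc n))) \<longlonglongrightarrow> partial b \<psi> x"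
        by (rule filterlim_compose)
      then show "(\<lambda>n. ?q n x) \<longlonglongrightarrow> partial b \<psi> x" by (simp add: mult.commute)
    qed
    fix n
    show "AE x in lborel. norm (?q n x) \<le> B * indicator (cball (0::'a) (R + 1)) x"
    proof (rule always_eventually, rule allI)
      fix x
      let ?h = "1 / real (Suc n)"
      have "\<exists>z>0. z < ?h \<and> \<psi> (x + ?h *\<^sub>R b) - \<psi> (x + 0 *\<^sub>R b) = (?h - 0) * partial b \<psi> (x + z *\<^sub>R b)"
        by (rule MVT2) (auto intro!: has_real_derivative_along \<psi>)
      then obtain z where z: "\<psi> (x + ?h *\<^sub>R b) - \<psi> x = ?h * partial b \<psi> (x + z *\<^sub>R b)" by auto
      have q: "?q n x = partial b \<psi> (x + z *\<^sub>R b)" unfolding z by (simp del: of_nat_Suc)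
      show "norm (?q n x) \<le> B * indicator (cball (0::'a) (R + 1)) x"
      proof (cases "x \<in> cball (0::'a) (R + 1)")
        case True
        then show ?thesis unfolding q using B' by simp
      next
        case False
        then have "\<psi> (x + ?h *\<^sub>R b) = 0" by (rule far)
        moreover have "\<psi> x = 0" using False R[of x] zero[of x] by (auto simp: dist_norm)
        ultimately show ?thesis using False by simp
      qed
    qed
    have "continuous_on UNIV (?q n)" by (intro continuous_intros cont_shift cont(1))
    then show "?q n \<in> borel_measurable lborel" by (simp add: borel_measurable_continuous_onI)
    show "partial b \<psi> \<in> borel_measurable lborel" using meas(2) by simp
  qed
  then have "(\<lambda>n. 0) \<longlonglongrightarrow> (\<integral>x. partial b \<psi> x \<partial>lborel)" unfolding qint .
  from LIMSEQ_unique[OF this tendsto_const] show ?thesis .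
qed

lemma closure_support_mult: "closure {x. f x * \<phi> x \<noteq> (0::real)} \<subseteq> closure {x. \<phi> x \<noteq> 0}"
  by (rule closure_mono) auto

text \<open>
  Integration by parts: the product of \<open>f\<close> and a test function has compact support, so the integral of
  its partial derivative vanishes.
\<close>

lemma C1_is_weak_deriv:
  assumes f: "C1 f" and U: "U \<in> sets lebesgue" and b: "b \<in> Basis"
  shows "is_weak_deriv U b f (partial b f)"
  unfolding is_weak_deriv_def
proof
  fix \<phi> assume "\<phi> \<in> test_functions U"
  then have \<phi>: "C1 \<phi>" and cpt: "compact (closure {x. \<phi> x \<noteq> 0})" and sub: "closure {x. \<phi> x \<noteq> 0} \<subseteq> U"
    by (auto simp: test_functions_iff)
  define K where "K = closure {x. \<phi> x \<noteq> 0}"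
  have K: "compact K" "K \<subseteq> U" using cpt sub by (simp_all add: K_def)
  have z: "\<phi> x = 0" "partial b \<phi> x = 0" if "x \<notin> K" for x
    using that closure_subset[of "{x. \<phi> x \<noteq> 0}"] partial_zero_outside_support[of x \<phi>]
    unfolding K_def by blast+
  have zU: "\<phi> x = 0" "partial b \<phi> x = 0" if "x \<notin> U" for x
    using z[of x] K(2) that by blast+
  have c: "continuous_on UNIV (\<lambda>x. f x * partial b \<phi> x)" "continuous_on UNIV (\<lambda>x. partial b f x * \<phi> x)"
    using continuous_on_mult[OF C1_continuous[OF f] C1_continuous_partial[OF \<phi> b]]
      continuous_on_mult[OF C1_continuous_partial[OF f b] C1_continuous[OF \<phi>]] by auto
  have i: "integrable lborel (\<lambda>x. f x * partial b \<phi> x)" "integrable lborel (\<lambda>x. partial b f x * \<phi> x)"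
    using integrable_lborel_compact_support[OF c(1) K(1)]
      integrable_lborel_compact_support[OF c(2) K(1)] by (simp_all add: z)
  have "closure {x. f x * \<phi> x \<noteq> 0} = closure {x. \<phi> x \<noteq> 0} \<inter> closure {x. f x * \<phi> x \<noteq> 0}"
    using closure_support_mult[of f \<phi>] by blast
  then have cm: "compact (closure {x. f x * \<phi> x \<noteq> 0})"
    using compact_Int_closed[OF cpt closed_closure] by metis
  have "0 = (\<integral>x. f x * partial b \<phi> x + partial b f x * \<phi> x \<partial>lborel)"
    using integral_partial_eq_0[OF C1_mult[OF f \<phi>] cm b] unfolding partial_mult[OF f \<phi>] by simp
  also have "\<dots> = (\<integral>x. f x * partial b \<phi> x \<partial>lborel) + (\<integral>x. partial b f x * \<phi> x \<partial>lborel)"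
    using i by simp
  also have "(\<integral>x. f x * partial b \<phi> x \<partial>lborel) = (\<integral>x. f x * partial b \<phi> x \<partial>lebesgue_on U)"
    by (rule integral_lebesgue_on_eq_lborel[symmetric, OF U borel_measurable_continuous_onI[OF c(1)]])
      (simp add: zU)
  also have "(\<integral>x. partial b f x * \<phi> x \<partial>lborel) = (\<integral>x. partial b f x * \<phi> x \<partial>lebesgue_on U)"
    by (rule integral_lebesgue_on_eq_lborel[symmetric, OF U borel_measurable_continuous_onI[OF c(2)]])
      (simp add: zU)
  finally show "(\<integral>x. f x * partial b \<phi> x \<partial>lebesgue_on U) = - (\<integral>x. partial b f x * \<phi> x \<partial>lebesgue_on U)"
    by linarith
qed

text \<open>
  The positive and the negative part of \<open>f\<close> are densities of two measures that agree on all boxes. Boxes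
  are stable under intersection and generate the Borel sets, so the measures and then the densities
  coincide; two functions with disjoint supports that coincide are \<open>0\<close>.
\<close>

lemma AE_zero_of_box_integrals:
  fixes f :: "'a::euclidean_space \<Rightarrow> real"
  assumes f: "integrable lborel f"
    and boxes: "\<And>a b. (\<integral>x. indicator (box a b) x * f x \<partial>lborel) = 0"
  shows "AE x in lborel. f x = 0"
proof -
  have fm: "f \<in> borel_measurable lborel" using f by simp
  let ?M = "density lborel (\<lambda>x. ennreal (f x))" and ?N = "density lborel (\<lambda>x. ennreal (- f x))"
  let ?E = "range (\<lambda>(a, b). box a b :: 'a set)"
  have part: "integrable lborel (\<lambda>x. indicator (box a b) x * max 0 (s * f x))" for a b :: 'a and s
  proof (rule Bochner_Integration.integrable_bound[of _ "\<lambda>x. s * f x"])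
    show "integrable lborel (\<lambda>x. s * f x)" using f by simp
    show "(\<lambda>x. indicator (box a b) x * max 0 (s * f x)) \<in> borel_measurable lborel"
      using fm by measurable
  qed (auto simp: indicator_def max_def)
  have em: "emeasure (density lborel (\<lambda>x. ennreal (s * f x))) (box a b) =
      ennreal (\<integral>x. indicator (box a b) x * max 0 (s * f x) \<partial>lborel)" for a b :: 'a and s
  proof -
    have "emeasure (density lborel (\<lambda>x. ennreal (s * f x))) (box a b) =
        (\<integral>\<^sup>+x. ennreal (indicator (box a b) x * max 0 (s * f x)) \<partial>lborel)"
      using fm by (subst emeasure_density) (auto intro!: nn_integral_cong
          simp: indicator_def max_def ennreal_neg)
    also have "\<dots> = ennreal (\<integral>x. indicator (box a b) x * max 0 (s * f x) \<partial>lborel)"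
      by (rule nn_integral_eq_integral[OF part]) (auto simp: indicator_def)
    finally show ?thesis .
  qed
  have eq: "(\<integral>x. indicator (box a b) x * max 0 (1 * f x) \<partial>lborel) =
      (\<integral>x. indicator (box a b) x * max 0 (- 1 * f x) \<partial>lborel)" for a b :: 'a
  proof -
    have "(\<integral>x. indicator (box a b) x * max 0 (1 * f x) \<partial>lborel) -
        (\<integral>x. indicator (box a b) x * max 0 (- 1 * f x) \<partial>lborel) =
        (\<integral>x. indicator (box a b) x * max 0 (1 * f x) - indicator (box a b) x * max 0 (- 1 * f x) \<partial>lborel)"
      by (rule Bochner_Integration.integral_diff[symmetric, OF part part])
    also have "\<dots> = (\<integral>x. indicator (box a b) x * f x \<partial>lborel)"
      by (rule Bochner_Integration.integral_cong) (auto simp: indicator_def max_def)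
    finally show ?thesis using boxes[of a b] by linarith
  qed
  have "?M = ?N"
  proof (rule measure_eqI_generator_eq)
    show "Int_stable ?E" by (auto simp: Int_stable_def Int_interval box_Int_box)
    show "sets ?M = sigma_sets UNIV ?E" "sets ?N = sigma_sets UNIV ?E"
      by (simp_all add: borel_eq_box)
    let ?A = "\<lambda>n::nat. box (- (real n *\<^sub>R One)) (real n *\<^sub>R One) :: 'a set"
    show "range ?A \<subseteq> ?E" "(\<Union>i. ?A i) = UNIV"
      unfolding UN_box_eq_UNIV by auto
    show "emeasure ?M (?A i) \<noteq> \<infinity>" for i
      using em[of 1] by simp
    show "emeasure ?M X = emeasure ?N X" if XE: "X \<in> ?E" for X
    proof -
      obtain a b :: 'a where X: "X = box a b" using XE by auto
      show ?thesis using em[of 1 a b] em[of "-1" a b] eq[of a b] unfolding X by simp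
    qed
  qed auto
  moreover have "(\<lambda>x. ennreal (f x)) \<in> borel_measurable lborel" "(\<lambda>x. ennreal (- f x)) \<in> borel_measurable lborel"
    using fm by measurable
  ultimately have "AE x in lborel. ennreal (f x) = ennreal (- f x)"
    using sigma_finite_measure.density_unique_iff[OF lborel.sigma_finite_measure_axioms] by blast
  then show ?thesis
  proof eventually_elim
    case (elim x)
    then show ?case
      by (cases "f x > 0"; cases "f x < 0") (auto simp: ennreal_neg)
  qed
qed

text \<open>
  Testing with the cutoff functions of smaller boxes gives, in the limit, that \<open>h\<close> has integral \<open>0\<close> over
  each of them. The previous lemma is then applied to a Borel representative of \<open>h\<close>, extended by \<open>0\<close>.
\<close>

lemma fundamental_lemma_box:
  fixes h :: "'a::euclidean_space \<Rightarrow> real"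
  assumes h: "integrable (lebesgue_on (box a b)) h"
    and test: "\<And>\<phi>. \<phi> \<in> test_functions (box a b) \<Longrightarrow> (\<integral>x. h x * \<phi> x \<partial>lebesgue_on (box a b)) = 0"
  shows "AE x in lebesgue_on (box a b). h x = 0"
proof -
  let ?U = "box a b"
  \<comment> \<open>only boxes inside the given one carry test functions of it\<close>
  have box_int: "(\<integral>x. h x * indicator (box c d) x \<partial>lebesgue_on ?U) = 0" if ne: "box c d \<noteq> {}" and sub: "box c d \<subseteq> ?U" for c d
  proof -
    have "(\<lambda>n. \<integral>x. h x * cutoff c d n x \<partial>lebesgue_on ?U) \<longlonglongrightarrow> (\<integral>x. h x * indicator (box c d) x \<partial>lebesgue_on ?U)"
    proof (rule integral_dominated_convergence[where w = "\<lambda>x. \<bar>h x\<bar>"])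
      show "(\<lambda>x. h x * indicator (box c d) x) \<in> borel_measurable (lebesgue_on ?U)"
        by (intro borel_measurable_times borel_measurable_integrable[OF h] borel_measurable_indicator
            sets_restrict_space_iff[THEN iffD2]) (use sub in auto)
      show "(\<lambda>x. h x * cutoff c d n x) \<in> borel_measurable (lebesgue_on ?U)" for n
        by (intro borel_measurable_times borel_measurable_integrable[OF h]
            continuous_measurable_lebesgue_on C1_continuous C1_cutoff)
      show "integrable (lebesgue_on ?U) (\<lambda>x. \<bar>h x\<bar>)" using h by simp
      show "AE x in lebesgue_on ?U. (\<lambda>n. h x * cutoff c d n x) \<longlonglongrightarrow> h x * indicator (box c d) x"
        by (intro always_eventually allI tendsto_mult tendsto_const cutoff_tendsto ne)
      show "AE x in lebesgue_on ?U. norm (h x * cutoff c d n x) \<le> \<bar>h x\<bar>" for n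
        by (intro always_eventually allI) (simp add: abs_mult mult_left_le)
    qed
    moreover have "(\<integral>x. h x * cutoff c d n x \<partial>lebesgue_on ?U) = 0" for n
      using test[OF cutoff_in_test_functions[OF ne sub]] .
    ultimately have "(\<lambda>n. 0) \<longlonglongrightarrow> (\<integral>x. h x * indicator (box c d) x \<partial>lebesgue_on ?U)" by simp
    from LIMSEQ_unique[OF tendsto_const this] show ?thesis by simp
  qed
  define h0 where "h0 = (\<lambda>x. indicator ?U x * h x)"
  have U: "?U \<in> sets lebesgue" by simp
  have h0: "integrable lebesgue h0"
    using h U unfolding h0_def by (subst (asm) integrable_restrict_space) auto
  obtain f where f: "f \<in> borel_measurable lborel" and hf: "AE x in lborel. h0 x = f x"
    using completion_ex_borel_measurable_real[OF borel_measurable_integrable[OF h0]] by blast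
  have hf': "AE x in lebesgue. h0 x = f x" using hf by (rule AE_completion)
  have fl: "f \<in> borel_measurable lebesgue" using f by (rule measurable_completion)
  have "integrable lebesgue f"
    using integrable_cong_AE[OF borel_measurable_integrable[OF h0] fl hf'] h0 by simp
  then have fi: "integrable lborel f" using integrable_completion[OF f] by simp
  have "AE x in lborel. f x = 0"
  proof (rule AE_zero_of_box_integrals[OF fi])
    fix c d :: 'a
    obtain c' d' where cd: "box c d \<inter> ?U = box c' d'" using box_Int_box by blast
    have "(\<integral>x. indicator (box c d) x * f x \<partial>lborel) = (\<integral>x. indicator (box c d) x * f x \<partial>lebesgue)"
      by (rule integral_completion[symmetric]) (use f in measurable)
    also have "\<dots> = (\<integral>x. indicator (box c d) x * h0 x \<partial>lebesgue)"
    proof (rule integral_cong_AE)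
      show "(\<lambda>x. indicator (box c d) x * f x) \<in> borel_measurable lebesgue"
        by (intro borel_measurable_times fl borel_measurable_indicator) simp
      show "(\<lambda>x. indicator (box c d) x * h0 x) \<in> borel_measurable lebesgue"
        by (intro borel_measurable_times borel_measurable_integrable[OF h0] borel_measurable_indicator) simp
      show "AE x in lebesgue. indicator (box c d) x * f x = indicator (box c d) x * h0 x"
        using hf' by eventually_elim simp
    qed
    also have "\<dots> = (\<integral>x. indicator ?U x *\<^sub>R (h x * indicator (box c' d') x) \<partial>lebesgue)"
      by (rule Bochner_Integration.integral_cong) (auto simp: h0_def cd[symmetric] indicator_def)
    also have "\<dots> = (\<integral>x. h x * indicator (box c' d') x \<partial>lebesgue_on ?U)"
      by (rule integral_restrict_space[symmetric]) simp
    also have "\<dots> = 0"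
    proof (cases "box c' d' = {}")
      case True then show ?thesis by simp
    next
      case False then show ?thesis using box_int[OF False] cd by blast
    qed
    finally show "(\<integral>x. indicator (box c d) x * f x \<partial>lborel) = 0" .
  qed
  then have "AE x in lebesgue. f x = 0" by (rule AE_completion)
  with hf' have "AE x in lebesgue. x \<in> ?U \<longrightarrow> h x = 0"
    by eventually_elim (auto simp: h0_def)
  then show ?thesis by (subst AE_restrict_space_iff) auto
qed

lemma weak_deriv_unique:
  fixes f :: "'a::euclidean_space \<Rightarrow> real"
  assumes h: "h \<in> l2_space (box a b)" "is_weak_deriv (box a b) e f h"
    and k: "k \<in> l2_space (box a b)" "is_weak_deriv (box a b) e f k"
  shows "AE x in lebesgue_on (box a b). h x = k x"
proof -
  let ?U = "box a b"
  have one: "(\<lambda>x. 1) \<in> l2_space ?U"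
    by (rule continuous_in_l2_space) auto
  have i: "integrable (lebesgue_on ?U) (\<lambda>x. h x - k x)"
    using l2_space_integrable_mult[OF l2_space_diff[OF h(1) k(1)] one] by simp
  have "AE x in lebesgue_on ?U. h x - k x = 0"
  proof (rule fundamental_lemma_box[OF i])
    fix \<phi> assume \<phi>: "\<phi> \<in> test_functions ?U"
    then have "\<phi> \<in> l2_space ?U"
      by (intro continuous_in_l2_space) (auto simp: test_functions_iff C1_continuous)
    then have "(\<integral>x. (h x - k x) * \<phi> x \<partial>lebesgue_on ?U) =
        (\<integral>x. h x * \<phi> x \<partial>lebesgue_on ?U) - (\<integral>x. k x * \<phi> x \<partial>lebesgue_on ?U)"
      using l2_inner_diff_left[OF h(1) k(1)] by (simp add: l2_inner_def)
    also have "\<dots> = 0"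
      using h(2)[unfolded is_weak_deriv_def, rule_format, OF \<phi>]
        k(2)[unfolded is_weak_deriv_def, rule_format, OF \<phi>] by linarith
    finally show "(\<integral>x. (h x - k x) * \<phi> x \<partial>lebesgue_on ?U) = 0" .
  qed
  then show ?thesis by simp
qed

lemma weak_deriv_properties:
  assumes "\<exists>h\<in>l2_space U. is_weak_deriv U e f h"
  shows "weak_deriv U e f \<in> l2_space U" "is_weak_deriv U e f (weak_deriv U e f)"
proof -
  have "weak_deriv U e f \<in> l2_space U \<and> is_weak_deriv U e f (weak_deriv U e f)"
    unfolding weak_deriv_def
    by (rule someI_ex[of "\<lambda>h. h \<in> l2_space U \<and> is_weak_deriv U e f h"]) (use assms in blast)
  then show "weak_deriv U e f \<in> l2_space U" "is_weak_deriv U e f (weak_deriv U e f)" by blast+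
qed

text \<open>
  The representative that \<open>weak_deriv\<close> selects is arbitrary, so that it can agree with the classical
  derivative only almost everywhere.
\<close>

lemma weak_deriv_C1:
  fixes f :: "'a::euclidean_space \<Rightarrow> real"
  assumes f: "C1 f" and e: "e \<in> Basis"
  shows "weak_deriv (box a b) e f \<in> l2_space (box a b)"
    and "AE x in lebesgue_on (box a b). weak_deriv (box a b) e f x = partial e f x"
proof -
  have p: "partial e f \<in> l2_space (box a b)"
    by (rule continuous_in_l2_space) (auto intro: C1_continuous_partial[OF f e])
  have w: "is_weak_deriv (box a b) e f (partial e f)"
    by (rule C1_is_weak_deriv[OF f _ e]) simp
  have ex: "\<exists>h\<in>l2_space (box a b). is_weak_deriv (box a b) e f h" using p w by blast
  show "weak_deriv (box a b) e f \<in> l2_space (box a b)" by (rule weak_deriv_properties(1)[OF ex])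
  show "AE x in lebesgue_on (box a b). weak_deriv (box a b) e f x = partial e f x"
    by (rule weak_deriv_unique[OF weak_deriv_properties[OF ex] p w])
qed

lemma C1_in_H1_space:
  fixes f :: "'a::euclidean_space \<Rightarrow> real"
  assumes f: "C1 f" shows "f \<in> H1_space (box a b)"
  unfolding H1_space_def
proof (intro CollectI conjI ballI)
  show "f \<in> l2_space (box a b)"
    by (rule continuous_in_l2_space) (auto intro: C1_continuous[OF f])
  fix e :: 'a assume e: "e \<in> Basis"
  have "partial e f \<in> l2_space (box a b)"
    by (rule continuous_in_l2_space) (auto intro: C1_continuous_partial[OF f e])
  moreover have "is_weak_deriv (box a b) e f (partial e f)"
    by (rule C1_is_weak_deriv[OF f _ e]) simp
  ultimately show "\<exists>h\<in>l2_space (box a b). is_weak_deriv (box a b) e f h" by blast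
qed

lemma H1_norm_C1:
  fixes f :: "'a::euclidean_space \<Rightarrow> real"
  assumes f: "C1 f"
  shows "H1_norm (box a b) f =
    sqrt ((l2_norm (box a b) f)\<^sup>2 + (\<Sum>e\<in>Basis. (l2_norm (box a b) (partial e f))\<^sup>2))"
proof -
  have "l2_norm (box a b) (weak_deriv (box a b) e f) = l2_norm (box a b) (partial e f)" if "e \<in> Basis" for e
    by (rule l2_norm_cong_AE[OF l2_spaceD(1)[OF weak_deriv_C1(1)[OF f that]]
        continuous_measurable_lebesgue_on[OF C1_continuous_partial[OF f that]] weak_deriv_C1(2)[OF f that]])
  then show ?thesis by (simp add: H1_norm_def)
qed

section \<open>Eigenfunctions in the Sobolev space\<close>

lemma partial_prod_eq_0:
  "(\<And>i. i \<in> I \<Longrightarrow> C1 (f i)) \<Longrightarrow> (\<And>i. i \<in> I \<Longrightarrow> partial e (f i) x = 0) \<Longrightarrow>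
    partial e (\<lambda>x. \<Prod>i\<in>I. f i x) x = 0"
proof (induction I rule: infinite_finite_induct)
  case (insert i I)
  then have "partial e (\<lambda>x. f i x * (\<Prod>i\<in>I. f i x)) x =
      f i x * partial e (\<lambda>x. \<Prod>i\<in>I. f i x) x + partial e (f i) x * (\<Prod>i\<in>I. f i x)"
    by (intro partial_mult C1_prod) auto
  with insert show ?case by simp
qed (simp_all add: partial_const)

lemma partial_cutoff:
  assumes e: "e \<in> Basis"
  shows "partial e (cutoff a b n) x =
    ramp' (real n * edge a b e x) * (real n * (a \<bullet> e + b \<bullet> e - 2 * (x \<bullet> e))) *
    (\<Prod>i\<in>Basis - {e}. ramp (real n * edge a b i x))"
proof -
  let ?r = "\<lambda>i x. ramp (real n * edge a b i x)"
  have r: "partial e (?r i) x = ramp' (real n * edge a b i x) * (real n * partial e (edge a b i) x)" for i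
  proof -
    have "partial e (?r i) x = ramp' (real n * edge a b i x) * partial e (\<lambda>x. real n * edge a b i x) x"
      by (rule partial_compose[OF C1_cmult[OF C1_edge] has_real_derivative_ramp])
    also have "partial e (\<lambda>x. real n * edge a b i x) x = real n * partial e (edge a b i) x"
      by (rule partial_cmult[OF C1_edge])
    finally show ?thesis .
  qed
  have "cutoff a b n = (\<lambda>x. ?r e x * (\<Prod>i\<in>Basis - {e}. ?r i x))"
    by (rule ext) (simp add: cutoff_def prod.remove[OF finite_Basis e])
  then have "partial e (cutoff a b n) x = ?r e x * partial e (\<lambda>x. \<Prod>i\<in>Basis - {e}. ?r i x) x +
      partial e (?r e) x * (\<Prod>i\<in>Basis - {e}. ?r i x)"
    by (simp only:) (intro partial_mult C1_prod C1_ramp_edge)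
  moreover have "partial e (\<lambda>x. \<Prod>i\<in>Basis - {e}. ?r i x) x = 0"
    by (rule partial_prod_eq_0[OF C1_ramp_edge]) (use e in \<open>auto simp: r partial_edge inner_Basis\<close>)
  ultimately show ?thesis using e by (simp add: r partial_edge)
qed

text \<open>
  Near the faces the derivative of the cutoff is of order \<open>n\<close>, but it is concentrated where
  \<open>n * edge a b e x\<close> is of order \<open>1\<close>; a factor \<open>F\<close> of the size of \<open>edge a b e x\<close> compensates for it.
\<close>

lemma abs_mult_partial_cutoff_le:
  assumes x: "x \<in> box a b" and e: "e \<in> Basis" and F: "\<bar>F\<bar> \<le> C * edge a b e x" and n: "0 < n"
  shows "\<bar>F * partial e (cutoff a b n) x\<bar> \<le> 4 * C * (b \<bullet> e - a \<bullet> e)"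
    and "\<bar>F * partial e (cutoff a b n) x\<bar> \<le> 4 * C * (b \<bullet> e - a \<bullet> e) / (real n * edge a b e x)"
proof -
  let ?d = "edge a b e x" and ?w = "b \<bullet> e - a \<bullet> e" and ?p = "\<Prod>i\<in>Basis - {e}. ramp (real n * edge a b i x)"
  have ab: "a \<bullet> e < x \<bullet> e" "x \<bullet> e < b \<bullet> e" using x e by (auto simp: mem_box)
  have d: "0 < ?d" using ab by (simp add: edge_def)
  have C: "0 \<le> C" using F d by (smt (verit) zero_le_mult_iff abs_ge_zero)
  have p: "0 \<le> ?p" "?p \<le> 1" by (auto intro!: prod_nonneg prod_le_1)
  have "\<bar>F * partial e (cutoff a b n) x\<bar> =
      \<bar>F\<bar> * (ramp' (real n * ?d) * (real n * \<bar>a \<bullet> e + b \<bullet> e - 2 * (x \<bullet> e)\<bar>) * ?p)"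
    using p by (simp add: partial_cutoff[OF e] abs_mult)
  also have "\<dots> \<le> (C * ?d) * (ramp' (real n * ?d) * (real n * ?w) * 1)"
    using F p ab C d by (intro mult_mono mult_nonneg_nonneg) auto
  also have "\<dots> = C * ?w * ((real n * ?d) * ramp' (real n * ?d))" by simp
  finally have le: "\<bar>F * partial e (cutoff a b n) x\<bar> \<le> C * ?w * ((real n * ?d) * ramp' (real n * ?d))" .
  have nd: "0 < real n * ?d" using n d by simp
  have cw: "0 \<le> C * ?w" using C ab by simp
  show "\<bar>F * partial e (cutoff a b n) x\<bar> \<le> 4 * C * ?w"
    using le mult_left_mono[OF mult_ramp'_le(2)[OF nd] cw] by simp
  show "\<bar>F * partial e (cutoff a b n) x\<bar> \<le> 4 * C * ?w / (real n * ?d)"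
  proof -
    have "C * ?w * (4 / (real n * ?d)) = 4 * C * ?w / (real n * ?d)" by simp
    then show ?thesis using le mult_left_mono[OF mult_ramp'_le(1)[OF nd] cw] by linarith
  qed
qed

text \<open>
  The functions \<open>cutoff a b n * F\<close> are test functions and approximate \<open>F\<close> in \<open>H\<^sup>1\<close>. In the gradient of the
  error, the term with the derivative of the cutoff is bounded and tends to \<open>0\<close> pointwise because \<open>F\<close>
  vanishes linearly at the faces, so dominated convergence applies.
\<close>

lemma H10_space_vanishing_boundary:
  fixes F :: "'a::euclidean_space \<Rightarrow> real"
  assumes ne: "box a b \<noteq> {}" and F: "C1 F"
    and bd: "\<And>x e. x \<in> box a b \<Longrightarrow> e \<in> Basis \<Longrightarrow> \<bar>F x\<bar> \<le> C * edge a b e x"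
  shows "F \<in> H10_space (box a b)"
proof -
  let ?U = "box a b"
  define \<phi> where "\<phi> n = (\<lambda>x. cutoff a b (Suc n) x * F x)" for n
  define \<psi> where "\<psi> n = (\<lambda>x. F x - \<phi> n x)" for n
  have \<phi>: "C1 (\<phi> n)" and \<psi>: "C1 (\<psi> n)" for n
    unfolding \<psi>_def \<phi>_def by (intro C1_diff C1_mult C1_cutoff F)+
  have Um: "?U \<in> lmeasurable" by (rule bounded_set_imp_lmeasurable) auto
  have test: "\<phi> n \<in> test_functions ?U" for n
  proof -
    have c: "cutoff a b (Suc n) \<in> test_functions ?U" by (rule cutoff_in_test_functions[OF ne order_refl])
    have sub: "closure {x. \<phi> n x \<noteq> 0} \<subseteq> closure {x. cutoff a b (Suc n) x \<noteq> 0}"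
      unfolding \<phi>_def by (rule closure_mono) auto
    then have "closure {x. \<phi> n x \<noteq> 0} = closure {x. cutoff a b (Suc n) x \<noteq> 0} \<inter> closure {x. \<phi> n x \<noteq> 0}"
      by blast
    moreover have "compact (closure {x. cutoff a b (Suc n) x \<noteq> 0})"
      using c unfolding test_functions_iff by blast
    ultimately have "compact (closure {x. \<phi> n x \<noteq> 0})"
      using compact_Int_closed[OF _ closed_closure] by metis
    then show ?thesis using \<phi> sub c unfolding test_functions_iff by blast
  qed
  have pt: "(\<lambda>n. cutoff a b (Suc n) x) \<longlonglongrightarrow> 1" if "x \<in> ?U" for x
    using LIMSEQ_Suc[OF cutoff_tendsto[OF ne, of x]] that by simp
  have AE_U: "AE x in lebesgue_on ?U. P x" if "\<And>x. x \<in> ?U \<Longrightarrow> P x" for P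
    by (rule AE_I2) (use that in simp)
  obtain B0 where B0: "\<And>x. x \<in> ?U \<Longrightarrow> \<bar>F x\<bar> \<le> B0"
    by (rule continuous_bounded_on_bounded[OF bounded_box C1_continuous[OF F]]) blast
  have lim0: "(\<lambda>n. l2_norm ?U (\<psi> n)) \<longlonglongrightarrow> 0"
  proof (rule tendsto_l2_norm_dominated[OF Um, where B = B0])
    show "\<psi> n \<in> borel_measurable (lebesgue_on ?U)" for n
      by (rule continuous_measurable_lebesgue_on[OF C1_continuous[OF \<psi>]])
    have eq: "\<psi> n x = (1 - cutoff a b (Suc n) x) * F x" for n x
      by (simp add: \<psi>_def \<phi>_def algebra_simps)
    show "\<bar>\<psi> n x\<bar> \<le> B0" if "x \<in> ?U" for n x
    proof -
      have "\<bar>\<psi> n x\<bar> \<le> 1 * \<bar>F x\<bar>"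
        unfolding eq abs_mult by (rule mult_right_mono) auto
      then show ?thesis using B0[OF that] by simp
    qed
    show "AE x in lebesgue_on ?U. (\<lambda>n. \<psi> n x) \<longlonglongrightarrow> 0"
    proof (rule AE_U)
      fix x assume "x \<in> ?U"
      from tendsto_mult[OF tendsto_diff[OF tendsto_const[of 1] pt[OF this]] tendsto_const[of "F x"]]
      show "(\<lambda>n. \<psi> n x) \<longlonglongrightarrow> 0" by (simp add: eq)
    qed
  qed
  have lim1: "(\<lambda>n. l2_norm ?U (partial e (\<psi> n))) \<longlonglongrightarrow> 0" if e: "e \<in> Basis" for e
  proof -
    obtain B1 where B1: "\<And>x. x \<in> ?U \<Longrightarrow> \<bar>partial e F x\<bar> \<le> B1"
      by (rule continuous_bounded_on_bounded[OF bounded_box C1_continuous_partial[OF F e]]) blast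
    have eq: "partial e (\<psi> n) x = (1 - cutoff a b (Suc n) x) * partial e F x - F x * partial e (cutoff a b (Suc n)) x" for n x
    proof -
      have "partial e (\<psi> n) x = partial e F x - partial e (\<phi> n) x"
        unfolding \<psi>_def by (rule partial_diff[OF F \<phi>])
      also have "partial e (\<phi> n) x = cutoff a b (Suc n) x * partial e F x + partial e (cutoff a b (Suc n)) x * F x"
        unfolding \<phi>_def by (rule partial_mult[OF C1_cutoff F])
      finally show ?thesis by (simp add: algebra_simps)
    qed
    show ?thesis
    proof (rule tendsto_l2_norm_dominated[OF Um, where B = "B1 + 4 * C * (b \<bullet> e - a \<bullet> e)"])
      show "partial e (\<psi> n) \<in> borel_measurable (lebesgue_on ?U)" for n
        by (rule continuous_measurable_lebesgue_on[OF C1_continuous_partial[OF \<psi> e]])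
      show "\<bar>partial e (\<psi> n) x\<bar> \<le> B1 + 4 * C * (b \<bullet> e - a \<bullet> e)" if x: "x \<in> ?U" for n x
      proof -
        have "\<bar>(1 - cutoff a b (Suc n) x) * partial e F x\<bar> \<le> 1 * \<bar>partial e F x\<bar>"
          unfolding abs_mult by (rule mult_right_mono) auto
        moreover have "\<bar>F x * partial e (cutoff a b (Suc n)) x\<bar> \<le> 4 * C * (b \<bullet> e - a \<bullet> e)"
          by (rule abs_mult_partial_cutoff_le(1)[OF x e bd[OF x e]]) simp
        ultimately show ?thesis unfolding eq using B1[OF x] by linarith
      qed
      show "AE x in lebesgue_on ?U. (\<lambda>n. partial e (\<psi> n) x) \<longlonglongrightarrow> 0"
      proof (rule AE_U)
        fix x assume x: "x \<in> ?U"
        let ?K = "4 * C * (b \<bullet> e - a \<bullet> e) / edge a b e x"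
        have "(\<lambda>n. F x * partial e (cutoff a b (Suc n)) x) \<longlonglongrightarrow> 0"
        proof (rule tendsto_0_le[where K = 1])
          show "(\<lambda>n. ?K * inverse (real (Suc n))) \<longlonglongrightarrow> 0"
            using tendsto_mult_right_zero[OF LIMSEQ_inverse_real_of_nat, of ?K] by simp
          show "\<forall>\<^sub>F n in sequentially. norm (F x * partial e (cutoff a b (Suc n)) x)
              \<le> norm (?K * inverse (real (Suc n))) * 1"
          proof (intro always_eventually allI)
            fix n
            have "4 * C * (b \<bullet> e - a \<bullet> e) / (real (Suc n) * edge a b e x) = ?K * inverse (real (Suc n))"
              by (simp add: field_simps del: of_nat_Suc)
            then have "\<bar>F x * partial e (cutoff a b (Suc n)) x\<bar> \<le> ?K * inverse (real (Suc n))"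
              using abs_mult_partial_cutoff_le(2)[OF x e bd[OF x e], of "Suc n"] by simp
            then show "norm (F x * partial e (cutoff a b (Suc n)) x) \<le> norm (?K * inverse (real (Suc n))) * 1"
              unfolding real_norm_def by linarith
          qed
        qed
        from tendsto_diff[OF tendsto_mult[OF tendsto_diff[OF tendsto_const[of 1] pt[OF x]]
              tendsto_const[of "partial e F x"]] this]
        show "(\<lambda>n. partial e (\<psi> n) x) \<longlonglongrightarrow> 0" by (simp add: eq)
      qed
    qed
  qed
  have "(\<lambda>n. H1_norm ?U (\<psi> n)) \<longlonglongrightarrow> sqrt (0\<^sup>2 + (\<Sum>e\<in>(Basis::'a set). 0\<^sup>2))"
    unfolding H1_norm_C1[OF \<psi>] by (intro tendsto_real_sqrt tendsto_add tendsto_sum tendsto_power lim0 lim1)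
  then have lim: "(\<lambda>n. H1_norm ?U (\<psi> n)) \<longlonglongrightarrow> 0" by simp
  show ?thesis
    unfolding H10_space_def
  proof (intro CollectI conjI allI impI)
    show "F \<in> H1_space ?U" by (rule C1_in_H1_space[OF F])
    fix \<epsilon> :: real assume "0 < \<epsilon>"
    then have "\<forall>\<^sub>F n in sequentially. H1_norm ?U (\<psi> n) < \<epsilon>" by (rule order_tendstoD(2)[OF lim])
    then obtain n where "H1_norm ?U (\<psi> n) < \<epsilon>" by (auto simp: eventually_sequentially)
    moreover have "F - \<phi> n = \<psi> n" by (rule ext) (simp add: \<psi>_def)
    ultimately show "\<exists>\<phi>\<in>test_functions ?U. H1_norm ?U (F - \<phi>) < \<epsilon>" using test by metis
  qed
qed

lemma H10_norm_C1_le: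
  fixes F :: "'a::euclidean_space \<Rightarrow> real"
    and \<alpha> :: real
  assumes F: "C1 F" and \<alpha>: "0 \<le> \<alpha>" and B: "0 \<le> B"
    and F_le: "\<And>x. x \<in> box a b \<Longrightarrow> \<bar>F x\<bar> \<le> B"
    and dF_le: "\<And>x e. x \<in> box a b \<Longrightarrow> e \<in> Basis \<Longrightarrow> \<bar>partial e F x\<bar> \<le> B"
  shows "H10_norm (box a b) \<alpha> F \<le> B * sqrt ((real DIM('a) + \<alpha>) * measure lebesgue (box a b))"
proof -
  let ?U = "box a b" and ?w = "\<lambda>e. weak_deriv (box a b) e F"
  have Um: "?U \<in> lmeasurable" by (rule bounded_set_imp_lmeasurable) auto
  have Fl: "F \<in> l2_space ?U" by (rule continuous_in_l2_space) (auto intro: C1_continuous[OF F])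
  have int: "integrable (lebesgue_on ?U) (\<lambda>x. (\<Sum>e\<in>Basis. ?w e x * ?w e x) + \<alpha> * F x * F x)"
    unfolding mult.assoc
    by (intro Bochner_Integration.integrable_add Bochner_Integration.integrable_sum integrable_mult_right
        l2_space_integrable_mult weak_deriv_C1(1)[OF F] Fl)
  have "H10_inner ?U \<alpha> F F \<le> (\<integral>x. (real DIM('a) + \<alpha>) * B\<^sup>2 \<partial>lebesgue_on ?U)"
    unfolding H10_inner_def
  proof (rule integral_mono_AE[OF int])
    show "integrable (lebesgue_on ?U) (\<lambda>x. (real DIM('a) + \<alpha>) * B\<^sup>2)"
      by (rule integrable_bounded_lebesgue_on[OF Um, of _ "\<bar>(real DIM('a) + \<alpha>) * B\<^sup>2\<bar>"]) auto
    have "AE x in lebesgue_on ?U. \<forall>e\<in>Basis. ?w e x = partial e F x"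
      by (rule AE_ball_countable') (auto intro: weak_deriv_C1(2)[OF F] countable_finite)
    moreover have "AE x in lebesgue_on ?U. x \<in> ?U" by (rule AE_I2) simp
    ultimately show "AE x in lebesgue_on ?U. (\<Sum>e\<in>Basis. ?w e x * ?w e x) + \<alpha> * F x * F x \<le> (real DIM('a) + \<alpha>) * B\<^sup>2"
    proof eventually_elim
      case (elim x)
      have sq: "y * y \<le> B\<^sup>2" if "\<bar>y\<bar> \<le> B" for y
        using power_mono[OF that abs_ge_zero, of 2] by (simp add: power2_eq_square abs_mult[symmetric])
      have "(\<Sum>e\<in>Basis. ?w e x * ?w e x) \<le> of_nat (card (Basis :: 'a set)) * B\<^sup>2"
        by (rule sum_bounded_above) (use elim dF_le sq in auto)
      moreover have "\<alpha> * (F x * F x) \<le> \<alpha> * B\<^sup>2"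
        using sq[OF F_le[OF elim(2)]] \<alpha> by (rule mult_left_mono)
      ultimately show ?case by (simp add: distrib_right mult.assoc)
    qed
  qed
  also have "\<dots> = B\<^sup>2 * ((real DIM('a) + \<alpha>) * measure lebesgue ?U)"
    using measure_restrict_space[of ?U lebesgue ?U] by (simp add: mult.commute mult.left_commute)
  finally have "H10_norm ?U \<alpha> F \<le> sqrt (B\<^sup>2 * ((real DIM('a) + \<alpha>) * measure lebesgue ?U))"
    unfolding H10_norm_def by (rule real_sqrt_le_mono)
  then show ?thesis using B by (simp add: real_sqrt_mult)
qed

lemma cube_eq_box: "(cube :: (real^'n::finite) set) = box 0 1"
  by (auto simp: cube_def mem_box_cart)

lemma cube_nonempty: "box 0 (1::real^'n::finite) \<noteq> {}"
proof -
  have "(\<chi> i. 1 / 2 :: real^'n) \<in> box 0 1" by (simp add: mem_box_cart)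
  then show ?thesis by blast
qed

lemma eigfun_eq:
  "(eigfun j :: real^'n::{finite,linorder} \<Rightarrow> real) = (\<lambda>x. 2 powr (real CARD('n) / 2) *
     (\<Prod>i\<in>UNIV. sin ((real ((multi_index j :: (nat, 'n) vec) $ i) * pi) * (x \<bullet> axis i 1))))"
  by (rule ext) (simp add: eigfun_def inner_axis)

lemma C1_eigfun: "C1 (eigfun j :: real^'n::{finite,linorder} \<Rightarrow> real)"
proof -
  have "C1 (\<lambda>x::(real, 'n) vec. sin (c * (x \<bullet> axis i 1)))" for c i
    by (rule C1_compose[OF C1_inner, of "\<lambda>s. sin (c * s)" "\<lambda>s. c * cos (c * s)"])
      (auto intro!: derivative_eq_intros continuous_intros)
  then show ?thesis unfolding eigfun_eq by (intro C1_cmult C1_prod)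
qed

text \<open>
  On the left half of the interval this is \<open>\<bar>sin y\<bar> \<le> \<bar>y\<bar>\<close>. The right half is reflected to the left one:
  as \<open>k\<close> is an integer, \<open>\<bar>sin (k \<pi> t)\<bar>\<close> is symmetric about \<open>t = 1 / 2\<close>.
\<close>

lemma abs_sin_nat_pi_le:
  assumes "0 < t" "t < 1"
  shows "\<bar>sin (real k * pi * t)\<bar> \<le> 2 * (real k * pi) * (t * (1 - t))"
proof -
  have half: "\<bar>sin (real k * pi * s)\<bar> \<le> 2 * (real k * pi) * (s * (1 - s))" if "0 < s" "s \<le> 1 / 2" for s
  proof -
    have "\<bar>sin (real k * pi * s)\<bar> \<le> real k * pi * s"
      using abs_sin_x_le_abs_x[of "real k * pi * s"] that by (simp add: abs_mult)
    also have "\<dots> = (real k * pi) * (s * 1)" by simp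
    also have "\<dots> \<le> (real k * pi) * (s * (2 * (1 - s)))"
      using that by (intro mult_left_mono) auto
    finally show ?thesis by (simp add: mult.assoc mult.left_commute)
  qed
  show ?thesis
  proof (cases "t \<le> 1 / 2")
    case True then show ?thesis using half assms by blast
  next
    case False
    have "sin (real k * pi * t) = - (cos (real k * pi) * sin (real k * pi * (1 - t)))"
      using sin_diff[of "real k * pi" "real k * pi * (1 - t)"] by (simp add: right_diff_distrib)
    then have "\<bar>sin (real k * pi * t)\<bar> = \<bar>sin (real k * pi * (1 - t))\<bar>"
      by (simp add: abs_mult)
    also have "\<dots> \<le> 2 * (real k * pi) * ((1 - t) * (1 - (1 - t)))"
      using False assms by (intro half) auto
    finally show ?thesis by (simp add: mult.commute)
  qed
qed

text \<open>
  For \<open>e\<close> the \<open>i\<close>-th basis vector, the factor \<open>sin (k\<^sub>i \<pi> x\<^sub>i)\<close> vanishes linearly at \<open>x\<^sub>i = 0\<close> and \<open>x\<^sub>i = 1\<close>,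
  and the other factors are at most \<open>1\<close> in absolute value.
\<close>

lemma eigfun_le_edge:
  "\<exists>C\<ge>0. \<forall>x\<in>box 0 1. \<forall>e\<in>Basis. \<bar>eigfun j (x :: real^'n::{finite,linorder})\<bar> \<le> C * edge 0 1 e x"
proof -
  let ?k = "multi_index j :: (nat, 'n) vec"
  let ?A = "2 powr (real CARD('n) / 2) :: real"
  define S where "S = (\<Sum>i\<in>UNIV. real (?k $ i))"
  show ?thesis
  proof (intro exI[of _ "?A * (2 * (S * pi))"] conjI ballI)
    show "0 \<le> ?A * (2 * (S * pi))" by (simp add: S_def sum_nonneg)
    fix x e :: "(real, 'n) vec" assume x: "x \<in> box 0 1" and "e \<in> Basis"
    then obtain i where e: "e = axis i 1" by (auto simp: Basis_vec_def)
    have xi: "0 < x $ i" "x $ i < 1" using x by (auto simp: mem_box_cart)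
    have "\<bar>\<Prod>i\<in>UNIV. sin (real (?k $ i) * pi * x $ i)\<bar> =
        \<bar>sin (real (?k $ i) * pi * x $ i)\<bar> * (\<Prod>i\<in>UNIV - {i}. \<bar>sin (real (?k $ i) * pi * x $ i)\<bar>)"
      unfolding abs_prod by (rule prod.remove) auto
    also have "\<dots> \<le> (2 * (real (?k $ i) * pi) * (x $ i * (1 - x $ i))) * 1"
      by (intro mult_mono abs_sin_nat_pi_le xi prod_le_1) (use xi in \<open>auto intro: prod_nonneg\<close>)
    also have "\<dots> \<le> (2 * (S * pi)) * (x $ i * (1 - x $ i)) * 1"
    proof -
      have "real (?k $ i) \<le> S" unfolding S_def by (rule member_le_sum) auto
      then show ?thesis using xi by (intro mult_right_mono mult_left_mono) auto
    qed
    also have "x $ i * (1 - x $ i) = edge 0 1 e x"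
      by (simp add: edge_def e inner_axis)
    finally have "\<bar>\<Prod>i\<in>UNIV. sin (real (?k $ i) * pi * x $ i)\<bar> \<le> (2 * (S * pi)) * edge 0 1 e x" by simp
    then show "\<bar>eigfun j x\<bar> \<le> ?A * (2 * (S * pi)) * edge 0 1 e x"
      unfolding eigfun_def abs_mult mult.assoc[of ?A] by (simp add: mult_left_mono)
  qed
qed

lemma C1_eigfun_combination:
  "C1 (\<lambda>x::real^'n::{finite,linorder}. \<Sum>l\<in>I. d l * eigfun l x)"
  by (intro C1_sum C1_cmult C1_eigfun)

lemma eigfun_combination_in_H10:
  "(\<lambda>x::real^'n::{finite,linorder}. \<Sum>l\<in>I. d l * eigfun l x) \<in> H10_space cube"
proof -
  obtain C where C: "\<And>j x e. x \<in> box 0 1 \<Longrightarrow> e \<in> Basis \<Longrightarrow> \<bar>eigfun j (x :: (real, 'n) vec)\<bar> \<le> C j * edge 0 1 e x"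
    using eigfun_le_edge by metis
  show ?thesis
    unfolding cube_eq_box
  proof (rule H10_space_vanishing_boundary[OF cube_nonempty C1_eigfun_combination,
        where C = "\<Sum>l\<in>I. \<bar>d l\<bar> * C l"])
    fix x e :: "(real, 'n) vec" assume "x \<in> box 0 1" "e \<in> Basis"
    note Cx = C[OF this]
    have "\<bar>\<Sum>l\<in>I. d l * eigfun l x\<bar> \<le> (\<Sum>l\<in>I. \<bar>d l * eigfun l x\<bar>)" by (rule sum_abs)
    also have "\<dots> \<le> (\<Sum>l\<in>I. \<bar>d l\<bar> * C l * edge 0 1 e x)"
      by (rule sum_mono) (use Cx in \<open>simp add: abs_mult mult.assoc mult_left_mono\<close>)
    finally show "\<bar>\<Sum>l\<in>I. d l * eigfun l x\<bar> \<le> (\<Sum>l\<in>I. \<bar>d l\<bar> * C l) * edge 0 1 e x"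
      by (simp add: sum_distrib_right)
  qed
qed

lemma eigfun_in_l2_space: "(eigfun j :: real^'n::{finite,linorder} \<Rightarrow> real) \<in> l2_space cube"
  unfolding cube_eq_box by (rule continuous_in_l2_space) (auto intro: C1_continuous[OF C1_eigfun])

text \<open>
  On the cube, each eigenfunction and its partial derivatives are bounded, hence the combination and its
  partial derivatives are bounded by a multiple of \<open>\<Sum>\<^sub>l \<bar>d\<^sub>l\<bar>\<close>.
\<close>

lemma H10_norm_eigfun_combination_le:
  assumes \<alpha>: "0 \<le> \<alpha>" and I: "finite I"
  shows "\<exists>K\<ge>0. \<forall>d. H10_norm cube \<alpha> (\<lambda>x::real^'n::{finite,linorder}. \<Sum>l\<in>I. d l * eigfun l x)
    \<le> K * (\<Sum>l\<in>I. \<bar>d l\<bar>)"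
proof -
  have "\<exists>B\<ge>0. \<forall>x\<in>box 0 1. \<bar>eigfun l (x::(real, 'n) vec)\<bar> \<le> B \<and> (\<forall>e\<in>Basis. \<bar>partial e (eigfun l) x\<bar> \<le> B)" for l
  proof -
    have "\<exists>B\<ge>0. \<forall>x\<in>box 0 1. \<bar>f x\<bar> \<le> B" if "continuous_on UNIV f" for f :: "(real, 'n) vec \<Rightarrow> real"
      by (rule continuous_bounded_on_bounded[OF bounded_box that]) blast
    then have b0: "\<exists>B\<ge>0. \<forall>x\<in>box 0 1. \<bar>eigfun l (x::(real, 'n) vec)\<bar> \<le> B"
      and b1: "\<forall>e\<in>Basis. \<exists>B\<ge>0. \<forall>x\<in>box 0 1. \<bar>partial e (eigfun l) (x::(real, 'n) vec)\<bar> \<le> B"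
      using C1_continuous[OF C1_eigfun] C1_continuous_partial[OF C1_eigfun] by blast+
    obtain B0 where B0: "B0 \<ge> 0" "\<forall>x\<in>box 0 1. \<bar>eigfun l (x::(real, 'n) vec)\<bar> \<le> B0" using b0 by blast
    obtain B1 where B1: "\<forall>e\<in>Basis. B1 e \<ge> 0 \<and> (\<forall>x\<in>box 0 1. \<bar>partial e (eigfun l) (x::(real, 'n) vec)\<bar> \<le> B1 e)"
      using bchoice[OF b1] by blast
    have "0 \<le> (\<Sum>e\<in>Basis. B1 e)" using B1 by (intro sum_nonneg) blast
    moreover have "B1 e \<le> (\<Sum>e\<in>Basis. B1 e)" if "e \<in> Basis" for e
      using B1 that by (intro member_le_sum) auto
    ultimately show ?thesis
      using B0 B1 by (intro exI[of _ "B0 + (\<Sum>e\<in>Basis. B1 e)"]) fastforce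
  qed
  then obtain B where B0: "\<And>l. B l \<ge> 0"
    and B: "\<And>l x. x \<in> box 0 1 \<Longrightarrow> \<bar>eigfun l (x::(real, 'n) vec)\<bar> \<le> B l"
    and dB: "\<And>l x e. x \<in> box 0 1 \<Longrightarrow> e \<in> Basis \<Longrightarrow> \<bar>partial e (eigfun l) (x::(real, 'n) vec)\<bar> \<le> B l"
    by metis
  define M where "M = (\<Sum>l\<in>I. B l)"
  have BM: "B l \<le> M" if "l \<in> I" for l
    unfolding M_def using B0 that I by (intro member_le_sum) auto
  have M: "0 \<le> M" using B0 by (simp add: M_def sum_nonneg)
  let ?s = "sqrt ((real DIM((real, 'n) vec) + \<alpha>) * measure lebesgue (box 0 (1::(real, 'n) vec)))"
  have comb: "\<bar>\<Sum>l\<in>I. d l * y l\<bar> \<le> M * (\<Sum>l\<in>I. \<bar>d l\<bar>)" if y: "\<And>l. \<bar>y l\<bar> \<le> B l" for d y :: "nat \<Rightarrow> real"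
  proof -
    have "\<bar>\<Sum>l\<in>I. d l * y l\<bar> \<le> (\<Sum>l\<in>I. \<bar>d l * y l\<bar>)" by (rule sum_abs)
    also have "\<dots> \<le> (\<Sum>l\<in>I. \<bar>d l\<bar> * M)"
    proof (rule sum_mono)
      fix l assume "l \<in> I"
      then have "\<bar>y l\<bar> \<le> M" using y[of l] BM[of l] by linarith
      then show "\<bar>d l * y l\<bar> \<le> \<bar>d l\<bar> * M" by (simp add: abs_mult mult_left_mono)
    qed
    finally show ?thesis by (simp add: sum_distrib_left mult.commute)
  qed
  show ?thesis
  proof (intro exI[of _ "M * ?s"] conjI allI)
    show "0 \<le> M * ?s" using M \<alpha> by simp
    fix d :: "nat \<Rightarrow> real"
    have p: "partial e (\<lambda>x. \<Sum>l\<in>I. d l * eigfun l x) x = (\<Sum>l\<in>I. d l * partial e (eigfun l) x)" for e and x :: "(real, 'n) vec"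
    proof -
      have "partial e (\<lambda>x. \<Sum>l\<in>I. d l * eigfun l x) x = (\<Sum>l\<in>I. partial e (\<lambda>x. d l * eigfun l x) x)"
        by (rule partial_sum[OF C1_cmult[OF C1_eigfun]])
      then show ?thesis by (simp add: partial_cmult[OF C1_eigfun])
    qed
    have "H10_norm (box 0 1) \<alpha> (\<lambda>x::(real, 'n) vec. \<Sum>l\<in>I. d l * eigfun l x) \<le> (M * (\<Sum>l\<in>I. \<bar>d l\<bar>)) * ?s"
    proof (rule H10_norm_C1_le[OF C1_eigfun_combination \<alpha>])
      show "0 \<le> M * (\<Sum>l\<in>I. \<bar>d l\<bar>)" using M by (simp add: sum_nonneg)
      show "\<bar>\<Sum>l\<in>I. d l * eigfun l x\<bar> \<le> M * (\<Sum>l\<in>I. \<bar>d l\<bar>)" if "x \<in> box 0 1" for x :: "(real, 'n) vec"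
        using comb B[OF that] .
      show "\<bar>partial e (\<lambda>x. \<Sum>l\<in>I. d l * eigfun l x) x\<bar> \<le> M * (\<Sum>l\<in>I. \<bar>d l\<bar>)"
        if "x \<in> box 0 1" "e \<in> Basis" for x e :: "(real, 'n) vec"
        unfolding p using comb dB[OF that] .
    qed
    then show "H10_norm cube \<alpha> (\<lambda>x::(real, 'n) vec. \<Sum>l\<in>I. d l * eigfun l x) \<le> M * ?s * (\<Sum>l\<in>I. \<bar>d l\<bar>)"
      unfolding cube_eq_box by (simp add: mult.commute mult.left_commute)
  qed
qed

section \<open>Density of compactly supported continuous functions\<close>

definition clamp_abs :: "real \<Rightarrow> real \<Rightarrow> real" where
  "clamp_abs M y = max (- M) (min M y)"

lemma continuous_clamp_abs: "continuous_on S (clamp_abs M)"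
  unfolding clamp_abs_def[abs_def] by (intro continuous_intros)

lemma abs_clamp_abs_le: "0 \<le> M \<Longrightarrow> \<bar>clamp_abs M y\<bar> \<le> M"
  and abs_diff_clamp_abs_le: "0 \<le> M \<Longrightarrow> \<bar>y - clamp_abs M y\<bar> \<le> \<bar>y\<bar>"
  and clamp_abs_eq: "\<bar>y\<bar> \<le> M \<Longrightarrow> clamp_abs M y = y"
  by (auto simp: clamp_abs_def)

lemma clamp_abs_measurable:
  "f \<in> borel_measurable N \<Longrightarrow> (\<lambda>x. clamp_abs M (f x)) \<in> borel_measurable N"
  by (rule borel_measurable_continuous_on[OF continuous_clamp_abs])

lemma l2_truncation:
  assumes f: "f \<in> l2_space U" and \<epsilon>: "0 < \<epsilon>"
  shows "\<exists>M\<ge>0. l2_norm U (\<lambda>x. f x - clamp_abs M (f x)) < \<epsilon>"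
proof -
  have "(\<lambda>n. l2_norm U (\<lambda>x. f x - clamp_abs (real n) (f x))) \<longlonglongrightarrow> 0"
  proof (rule tendsto_l2_norm_dominated_by[OF _ f])
    show "(\<lambda>x. f x - clamp_abs (real n) (f x)) \<in> borel_measurable (lebesgue_on U)" for n
      by (intro borel_measurable_diff clamp_abs_measurable l2_spaceD(1)[OF f])
    show "\<bar>f x - clamp_abs (real n) (f x)\<bar> \<le> \<bar>f x\<bar>" for n x
      by (rule abs_diff_clamp_abs_le) simp
    show "AE x in lebesgue_on U. (\<lambda>n. f x - clamp_abs (real n) (f x)) \<longlonglongrightarrow> 0"
    proof (intro always_eventually allI)
      fix x
      obtain m :: nat where m: "\<bar>f x\<bar> \<le> real m" using real_arch_simple by blast
      have "\<forall>\<^sub>F n in sequentially. f x - clamp_abs (real n) (f x) = 0"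
        using eventually_ge_at_top[of m] by eventually_elim (use m in \<open>simp add: clamp_abs_eq\<close>)
      then show "(\<lambda>n. f x - clamp_abs (real n) (f x)) \<longlonglongrightarrow> 0" by (rule tendsto_eventually)
    qed
  qed
  then have "\<forall>\<^sub>F n in sequentially. l2_norm U (\<lambda>x. f x - clamp_abs (real n) (f x)) < \<epsilon>"
    by (rule order_tendstoD(2)[OF _ \<epsilon>])
  then obtain n :: nat where "l2_norm U (\<lambda>x. f x - clamp_abs (real n) (f x)) < \<epsilon>"
    by (auto simp: eventually_sequentially)
  then show ?thesis by (intro exI[of _ "real n"]) simp
qed

text \<open>
  A measurable function is a limit almost everywhere of continuous functions. To turn this into
  \<open>L\<^sup>2\<close> convergence, \<open>f\<close> is first truncated at a level \<open>M\<close>; the continuous functions are truncated at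
  the same level and multiplied by cutoff functions, and then dominated convergence applies. That \<open>\<psi>\<close>
  vanishes wherever \<open>cutoff a b n\<close> does says that its support is a compact subset of the box.
\<close>

lemma l2_dense_continuous_compact_support:
  fixes f :: "'a::euclidean_space \<Rightarrow> real"
  assumes ne: "box a b \<noteq> {}" and f: "f \<in> l2_space (box a b)" and \<epsilon>: "0 < \<epsilon>"
  shows "\<exists>\<psi> n. continuous_on UNIV \<psi> \<and> (\<forall>x. cutoff a b n x = 0 \<longrightarrow> \<psi> x = 0) \<and>
    l2_norm (box a b) (\<lambda>x. f x - \<psi> x) < \<epsilon>"
proof -
  let ?U = "box a b"
  have Um: "?U \<in> lmeasurable" by (rule bounded_set_imp_lmeasurable) auto
  obtain M where M: "0 \<le> M" and fM: "l2_norm ?U (\<lambda>x. f x - clamp_abs M (f x)) < \<epsilon> / 2"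
    using l2_truncation[OF f, of "\<epsilon> / 2"] \<epsilon> by auto
  let ?f = "\<lambda>x. clamp_abs M (f x)"
  have fm: "?f \<in> borel_measurable (lebesgue_on ?U)" by (rule clamp_abs_measurable[OF l2_spaceD(1)[OF f]])
  have fl: "?f \<in> l2_space ?U" by (rule l2_bounded(1)[OF Um fm abs_clamp_abs_le[OF M] M])
  have "(\<lambda>x. if x \<in> ?U then f x else 0) \<in> borel_measurable lebesgue"
    using borel_measurable_if[of ?U f] l2_spaceD(1)[OF f] by simp
  then have "(\<lambda>x. if x \<in> ?U then f x else 0) measurable_on ?U"
    by (rule lebesgue_measurable_imp_measurable_on) simp
  then obtain N h where N: "negligible N" and h: "\<And>n. continuous_on UNIV (h n)"
    and lim: "\<And>x. x \<notin> N \<Longrightarrow> (\<lambda>n. h n x) \<longlonglongrightarrow> (if x \<in> ?U then if x \<in> ?U then f x else 0 else 0)"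
    unfolding measurable_on_def by blast
  define \<psi> where "\<psi> n = (\<lambda>x. cutoff a b n x * clamp_abs M (h n x))" for n
  have cont: "continuous_on UNIV (\<psi> n)" for n
    unfolding \<psi>_def
    by (intro continuous_on_mult C1_continuous[OF C1_cutoff]
        continuous_on_compose2[OF continuous_clamp_abs h]) auto
  have "(\<lambda>n. l2_norm ?U (\<lambda>x. ?f x - \<psi> n x)) \<longlonglongrightarrow> 0"
  proof (rule tendsto_l2_norm_dominated[OF Um])
    show "(\<lambda>x. ?f x - \<psi> n x) \<in> borel_measurable (lebesgue_on ?U)" for n
      by (intro borel_measurable_diff fm continuous_measurable_lebesgue_on[OF cont])
    show "\<bar>?f x - \<psi> n x\<bar> \<le> 2 * M" for n x
    proof -
      have "\<bar>\<psi> n x\<bar> \<le> 1 * M"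
        unfolding \<psi>_def abs_mult by (intro mult_mono abs_clamp_abs_le M) auto
      then show ?thesis using abs_clamp_abs_le[OF M, of "f x"] by linarith
    qed
    have "AE x in lebesgue. x \<notin> N"
      using N by (auto simp: negligible_iff_null_sets intro: AE_not_in)
    then have "AE x in lebesgue. x \<in> ?U \<longrightarrow> (\<lambda>n. ?f x - \<psi> n x) \<longlonglongrightarrow> 0"
    proof eventually_elim
      case (elim x)
      show ?case
      proof
        assume x: "x \<in> ?U"
        have "(\<lambda>n. h n x) \<longlonglongrightarrow> f x" using lim[OF elim] x by simp
        then have "(\<lambda>n. clamp_abs M (h n x)) \<longlonglongrightarrow> clamp_abs M (f x)"
          using continuous_on_tendsto_compose[OF continuous_clamp_abs[of UNIV M]] by simp
        moreover have "(\<lambda>n. cutoff a b n x) \<longlonglongrightarrow> 1" using cutoff_tendsto[OF ne, of x] x by simp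
        ultimately have "(\<lambda>n. \<psi> n x) \<longlonglongrightarrow> 1 * clamp_abs M (f x)"
          unfolding \<psi>_def by (intro tendsto_mult)
        from tendsto_diff[OF tendsto_const[of "?f x"] this] show "(\<lambda>n. ?f x - \<psi> n x) \<longlonglongrightarrow> 0" by simp
      qed
    qed
    then show "AE x in lebesgue_on ?U. (\<lambda>n. ?f x - \<psi> n x) \<longlonglongrightarrow> 0"
      by (subst AE_restrict_space_iff) auto
  qed
  then have "\<forall>\<^sub>F n in sequentially. l2_norm ?U (\<lambda>x. ?f x - \<psi> n x) < \<epsilon> / 2"
    by (rule order_tendstoD(2)) (use \<epsilon> in simp)
  then obtain n where n: "l2_norm ?U (\<lambda>x. ?f x - \<psi> n x) < \<epsilon> / 2" by (auto simp: eventually_sequentially)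
  have "\<psi> n \<in> l2_space ?U" by (rule continuous_in_l2_space) (auto intro: cont)
  from l2_norm_triangle_diff[OF f fl this] fM n have "l2_norm ?U (\<lambda>x. f x - \<psi> n x) < \<epsilon>" by linarith
  moreover have "\<forall>x. cutoff a b n x = 0 \<longrightarrow> \<psi> n x = 0" by (simp add: \<psi>_def)
  ultimately show ?thesis using cont by blast
qed

section \<open>A Poincare inequality for weak derivatives on an interval\<close>

lemma continuous_antiderivative:
  fixes f :: "real \<Rightarrow> real"
  assumes "continuous_on UNIV f"
  obtains F where "\<And>x. (F has_real_derivative f x) (at x)"
proof -
  have "\<exists>F. \<forall>x. - \<infinity> < ereal x \<longrightarrow> ereal x < \<infinity> \<longrightarrow> (F has_vector_derivative f x) (at x)"
    by (rule einterval_antiderivative) (use assms in \<open>auto simp: continuous_on_eq_continuous_at\<close>)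
  then show ?thesis using that by (auto simp: has_real_derivative_iff_has_vector_derivative)
qed

lemma integral_lebesgue_on_Ioo:
  fixes f :: "real \<Rightarrow> real"
  assumes "continuous_on UNIV f"
  shows "(\<integral>x. f x \<partial>lebesgue_on {a<..<b}) = integral {a..b} f"
proof -
  obtain B where "\<And>x. x \<in> {a<..<b} \<Longrightarrow> \<bar>f x\<bar> \<le> B"
    by (rule continuous_bounded_on_bounded[of "{a<..<b}", OF _ assms]) auto
  then have "integrable (lebesgue_on {a<..<b}) f"
    by (intro integrable_bounded_lebesgue_on[where B = B] continuous_measurable_lebesgue_on assms) auto
  then show ?thesis
    by (simp add: lebesgue_integral_eq_integral integral_open_interval_real)
qed

lemma l2_norm_const_Ioo:
  assumes "0 < T" shows "l2_norm {0<..<T} (\<lambda>x. c) = \<bar>c\<bar> * sqrt T"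
proof -
  have "l2_inner {0<..<T} (\<lambda>x. c) (\<lambda>x. c) = c * c * T"
    unfolding l2_inner_def using assms by (subst integral_lebesgue_on_Ioo) (auto simp: )
  then show ?thesis by (simp add: l2_norm_def real_sqrt_mult)
qed

lemma abs_integral_le_l2_norm:
  assumes T: "0 < (T::real)" and f: "f \<in> l2_space {0<..<T}"
  shows "\<bar>\<integral>x. f x \<partial>lebesgue_on {0<..<T}\<bar> \<le> l2_norm {0<..<T} f * sqrt T"
proof -
  have "(\<lambda>x. 1) \<in> l2_space {0<..<T}" by (rule continuous_in_l2_space) auto
  from l2_inner_Cauchy_Schwarz[OF f this] show ?thesis
    using T by (simp add: l2_norm_const_Ioo) (simp add: l2_inner_def)
qed

text \<open>
  The continuous functions \<open>\<psi>\<close> with compact support and integral \<open>0\<close> are the derivatives of test functions: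
  the primitive that is \<open>0\<close> to
  the left of the support of \<open>\<psi>\<close> is \<open>0\<close> again to the right of it. The norm bound combines
  \<open>\<bar>\<phi> t\<bar> \<le> \<integral> \<bar>\<psi>\<bar>\<close> with the Cauchy-Schwarz inequality.
\<close>

lemma mean_zero_primitive_test_function:
  assumes T: "0 < (T::real)" and \<psi>: "continuous_on UNIV \<psi>" and p: "0 < p" and q: "q < T"
    and supp: "\<And>t. t \<notin> {p..q} \<Longrightarrow> \<psi> t = 0"
    and mean: "(\<integral>t. \<psi> t \<partial>lebesgue_on {0<..<T}) = 0"
  obtains \<phi> where "\<phi> \<in> test_functions {0<..<T}" "\<And>t. partial 1 \<phi> t = \<psi> t"
    "l2_norm {0<..<T} \<phi> \<le> T * l2_norm {0<..<T} \<psi>"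
proof -
  let ?U = "{0<..<T}"
  obtain F where F: "\<And>t. (F has_real_derivative \<psi> t) (at t)"
    using continuous_antiderivative[OF \<psi>] by blast
  define \<phi> where "\<phi> = (\<lambda>t. F t - F 0)"
  have \<phi>: "(\<phi> has_real_derivative \<psi> t) (at t)" for t
    unfolding \<phi>_def using DERIV_diff[OF F DERIV_const] by simp
  have ftc: "(\<psi> has_integral \<phi> t - \<phi> s) {s..t}" if "s \<le> t" for s t
    by (rule fundamental_theorem_of_calculus[OF that])
      (auto simp: has_real_derivative_iff_has_vector_derivative[symmetric]
        intro: has_field_derivative_at_within[OF \<phi>])
  have \<phi>0: "\<phi> 0 = 0" by (simp add: \<phi>_def)
  have \<phi>T: "\<phi> T = 0"
    using integral_unique[OF ftc[of 0 T]] mean T \<phi>0 by (simp add: integral_lebesgue_on_Ioo[OF \<psi>])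
  have const: "\<phi> t = \<phi> s" if "s \<le> t" "t < p \<or> q < s" for s t
  proof -
    have "(\<psi> has_integral 0) {s..t}"
      by (rule has_integral_is_0) (use that supp in auto)
    from has_integral_unique[OF ftc[OF that(1)] this] show ?thesis by simp
  qed
  have zero: "\<phi> t = 0" if "t \<notin> {p..q}" for t
  proof (cases "t < p")
    case True
    then show ?thesis using const[of t 0] const[of 0 t] \<phi>0 p by (cases "t \<le> 0") auto
  next
    case False
    then show ?thesis using that const[of t T] const[of T t] \<phi>T q by (cases "t \<le> T") auto
  qed
  have C1: "C1 \<phi>" "\<And>t. partial 1 \<phi> t = \<psi> t" using C1_real[OF \<phi> \<psi>] by auto
  have sub: "closure {t. \<phi> t \<noteq> 0} \<subseteq> {p..q}"
  proof (rule closure_minimal)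
    show "{t. \<phi> t \<noteq> 0} \<subseteq> {p..q}" using zero by blast
  qed simp
  have "compact (closure {t. \<phi> t \<noteq> 0})"
    using sub by (meson bounded_subset bounded_closed_interval closed_closure compact_eq_bounded_closed)
  then have test: "\<phi> \<in> test_functions ?U"
    using C1(1) sub p q by (fastforce simp: test_functions_iff)
  have \<psi>l: "\<psi> \<in> l2_space ?U" by (rule continuous_in_l2_space[OF _ _ \<psi>]) auto
  have abs\<psi>: "continuous_on UNIV (\<lambda>t. \<bar>\<psi> t\<bar>)" by (intro continuous_intros \<psi>)
  have abs\<psi>l: "(\<lambda>t. \<bar>\<psi> t\<bar>) \<in> l2_space ?U" by (rule continuous_in_l2_space[OF _ _ abs\<psi>]) auto
  have abs_norm: "l2_norm ?U (\<lambda>t. \<bar>\<psi> t\<bar>) = l2_norm ?U \<psi>" by (simp add: l2_norm_def l2_inner_def)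
  have abs_int: "integral {0..T} (\<lambda>t. \<bar>\<psi> t\<bar>) \<le> l2_norm ?U \<psi> * sqrt T"
    using abs_integral_le_l2_norm[OF T abs\<psi>l] unfolding abs_norm integral_lebesgue_on_Ioo[OF abs\<psi>] by linarith
  have bound: "\<bar>\<phi> t\<bar> \<le> l2_norm ?U \<psi> * sqrt T" if "t \<in> ?U" for t
  proof -
    have i: "(\<lambda>t. \<bar>\<psi> t\<bar>) integrable_on {0..s}" for s
      by (rule integrable_continuous_real[OF continuous_on_subset[OF abs\<psi>]]) simp
    have "\<bar>\<phi> t\<bar> = norm (integral {0..t} \<psi>)"
      using integral_unique[OF ftc[of 0 t]] that \<phi>0 by simp
    also have "\<dots> \<le> integral {0..t} (\<lambda>t. \<bar>\<psi> t\<bar>)"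
      by (rule integral_norm_bound_integral[OF _ i])
        (auto intro: integrable_continuous_real[OF continuous_on_subset[OF \<psi>]])
    also have "\<dots> \<le> integral {0..T} (\<lambda>t. \<bar>\<psi> t\<bar>)"
      by (rule integral_subset_le[OF _ i i]) (use that in auto)
    finally show ?thesis using abs_int by linarith
  qed
  have "l2_norm ?U \<phi> \<le> (l2_norm ?U \<psi> * sqrt T) * sqrt (measure lebesgue ?U)"
    by (rule l2_bounded(2)[OF _ continuous_measurable_lebesgue_on[OF C1_continuous[OF C1(1)]] bound])
      (use T in auto)
  also have "\<dots> = T * l2_norm ?U \<psi>" using T by simp
  finally show ?thesis using that test C1(2) by blast
qed

text \<open>
  Where the cutoff is nonzero, \<open>n t (T - t)\<close> is at least \<open>1\<close>, so \<open>t\<close> and \<open>T - t\<close> are at least \<open>1 / (n T)\<close>.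
\<close>

lemma cutoff_interval_support:
  assumes T: "0 < (T::real)"
  obtains p q where "0 < p" "q < T" "\<And>t. t \<notin> {p..q} \<Longrightarrow> cutoff 0 T n t = 0"
proof -
  define p where "p = 1 / (real (Suc n) * T)"
  have p: "0 < p" using T by (simp add: p_def)
  have "t \<in> {p..T - p}" if nz: "cutoff 0 T n t \<noteq> 0" for t
  proof -
    have one: "1 \<le> real n * (t * (T - t))" using cutoff_nonzero_imp[OF nz, of 1] by (simp add: edge_def)
    then have n: "0 < real n" by (cases n) auto
    have "0 < t * (T - t)"
    proof (rule ccontr)
      assume "\<not> 0 < t * (T - t)"
      then have "real n * (t * (T - t)) \<le> 0" using n by (simp add: mult_nonneg_nonpos)
      then show False using one by linarith
    qed
    then have t: "0 < t" "t < T" using T by (auto simp: zero_less_mult_iff)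
    have "p \<le> s" if s: "0 < s" "s \<le> T" "1 \<le> real n * (s * (T - s))" for s
    proof -
      have "s * (T - s) \<le> s * T" using s by (intro mult_left_mono) auto
      then have "real n * (s * (T - s)) \<le> real (Suc n) * (s * T)"
        using s by (intro mult_mono) auto
      then have "1 \<le> s * (real (Suc n) * T)" using s(3) by (simp add: mult.commute mult.left_commute)
      then show ?thesis using T by (simp add: p_def pos_divide_le_eq)
    qed
    from this[of t] this[of "T - t"] show ?thesis using t one by (simp add: mult.commute)
  qed
  then show ?thesis using that[of p "T - p"] p by force
qed

text \<open>
  A continuous approximation \<open>\<psi>0\<close> of \<open>e\<close> with compact support is corrected by a multiple \<open>\<mu>\<close> of a fixed bump of
  integral \<open>1\<close>. The correction is small because \<open>\<mu> = \<integral> \<psi>0 = - \<integral> (e - \<psi>0)\<close>.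
\<close>

lemma mean_zero_approximation:
  assumes T: "0 < (T::real)" and e: "e \<in> l2_space {0<..<T}" and mean: "(\<integral>t. e t \<partial>lebesgue_on {0<..<T}) = 0"
    and \<epsilon>: "0 < \<epsilon>"
  obtains \<psi> p q where "continuous_on UNIV \<psi>" "0 < p" "q < T" "\<And>t. t \<notin> {p..q} \<Longrightarrow> \<psi> t = 0"
    "(\<integral>t. \<psi> t \<partial>lebesgue_on {0<..<T}) = 0" "l2_norm {0<..<T} (\<lambda>t. e t - \<psi> t) < \<epsilon>"
proof -
  let ?U = "{0<..<T}" and ?I = "\<lambda>f. \<integral>t. f t \<partial>lebesgue_on {0<..<T}"
  have box: "?U = box 0 T" and ne: "box 0 T \<noteq> {}" using T by (auto simp: box_real)
  have Um: "?U \<in> lmeasurable" by (rule bounded_set_imp_lmeasurable) auto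
  have int: "integrable (lebesgue_on ?U) f" if "f \<in> l2_space ?U" for f
  proof -
    have "(\<lambda>x. 1) \<in> l2_space ?U" by (rule continuous_in_l2_space) auto
    from l2_space_integrable_mult[OF that this] show ?thesis by simp
  qed
  have cl: "f \<in> l2_space ?U" if "continuous_on UNIV f" for f
    by (rule continuous_in_l2_space[OF _ _ that]) auto
  have cc: "continuous_on UNIV (cutoff 0 T n)" for n by (rule C1_continuous[OF C1_cutoff])
  have "(\<lambda>n. ?I (cutoff 0 T n)) \<longlonglongrightarrow> ?I (indicator ?U)"
  proof (rule integral_dominated_convergence[where w = "\<lambda>x. 1"])
    show "integrable (lebesgue_on ?U) (\<lambda>x. 1 :: real)" by (rule int[OF cl]) auto
    show "AE x in lebesgue_on ?U. (\<lambda>n. cutoff 0 T n x) \<longlonglongrightarrow> indicator ?U x"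
      unfolding box using cutoff_tendsto[OF ne] by simp
    show "cutoff 0 T n \<in> borel_measurable (lebesgue_on ?U)" for n
      by (rule continuous_measurable_lebesgue_on[OF cc])
    show "(indicator ?U :: real \<Rightarrow> real) \<in> borel_measurable (lebesgue_on ?U)"
      by (rule borel_measurable_indicator) simp
  qed simp
  moreover have "?I (indicator ?U) = T"
  proof -
    have "?I (indicator ?U) = ?I (\<lambda>x. 1)"
      by (rule Bochner_Integration.integral_cong) auto
    also have "\<dots> = T" using T by (subst integral_lebesgue_on_Ioo) auto
    finally show ?thesis .
  qed
  ultimately have "(\<lambda>n. ?I (cutoff 0 T n)) \<longlonglongrightarrow> T" by simp
  then have "\<forall>\<^sub>F n in sequentially. 0 < ?I (cutoff 0 T n)" by (rule order_tendstoD(1)[OF _ T])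
  then obtain m where m: "0 < ?I (cutoff 0 T m)" by (auto simp: eventually_sequentially)
  define \<eta> where "\<eta> = (\<lambda>t. cutoff 0 T m t / ?I (cutoff 0 T m))"
  have \<eta>c: "continuous_on UNIV \<eta>" unfolding \<eta>_def using m by (intro continuous_intros cc) auto
  have \<eta>I: "?I \<eta> = 1" unfolding \<eta>_def using m by simp
  \<comment> \<open>the loss of the correction: \<open>\<bar>\<mu>\<bar>\<close> is at most \<open>sqrt T\<close> times the approximation error\<close>
  define K where "K = 1 + sqrt T * l2_norm ?U \<eta>"
  have K: "0 < K" using T by (simp add: K_def add_pos_nonneg)
  obtain \<psi>0 n where \<psi>0: "continuous_on UNIV \<psi>0" "\<And>t. cutoff 0 T n t = 0 \<Longrightarrow> \<psi>0 t = 0"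
    and near: "l2_norm ?U (\<lambda>t. e t - \<psi>0 t) < \<epsilon> / K"
    using l2_dense_continuous_compact_support[OF ne, folded box, OF e, of "\<epsilon> / K"] \<epsilon> K by auto
  define \<mu> where "\<mu> = ?I \<psi>0"
  define \<psi> where "\<psi> = (\<lambda>t. \<psi>0 t - \<mu> * \<eta> t)"
  have el: "(\<lambda>t. e t - \<psi>0 t) \<in> l2_space ?U" by (rule l2_space_diff[OF e cl[OF \<psi>0(1)]])
  have \<psi>c: "continuous_on UNIV \<psi>" unfolding \<psi>_def by (intro continuous_intros \<psi>0 \<eta>c)
  have "?I (\<lambda>t. e t - \<psi>0 t) = - \<mu>"
    using int[OF e] int[OF cl[OF \<psi>0(1)]] mean by (simp add: \<mu>_def)
  then have \<mu>: "\<bar>\<mu>\<bar> \<le> l2_norm ?U (\<lambda>t. e t - \<psi>0 t) * sqrt T"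
    using abs_integral_le_l2_norm[OF T el] by simp
  have "(\<lambda>t. e t - \<psi> t) = (\<lambda>t. (e t - \<psi>0 t) + \<mu> * \<eta> t)" by (rule ext) (simp add: \<psi>_def)
  then have "l2_norm ?U (\<lambda>t. e t - \<psi> t) \<le> l2_norm ?U (\<lambda>t. e t - \<psi>0 t) + \<bar>\<mu>\<bar> * l2_norm ?U \<eta>"
    using l2_norm_triangle[OF el l2_space_cmult[OF cl[OF \<eta>c], of \<mu>]] by (simp add: l2_norm_cmult)
  also have "\<dots> \<le> l2_norm ?U (\<lambda>t. e t - \<psi>0 t) * K"
    using mult_right_mono[OF \<mu> l2_norm_nonneg[of ?U \<eta>]] by (simp add: K_def algebra_simps)
  also have "\<dots> < \<epsilon>" using near K by (simp add: pos_less_divide_eq)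
  finally have close: "l2_norm ?U (\<lambda>t. e t - \<psi> t) < \<epsilon>" .
  have \<psi>I: "?I \<psi> = 0"
    using int[OF cl[OF \<psi>0(1)]] int[OF cl[OF \<eta>c]] \<eta>I by (simp add: \<psi>_def \<mu>_def)
  obtain p1 q1 where 1: "0 < p1" "q1 < T" "\<And>t. t \<notin> {p1..q1} \<Longrightarrow> cutoff 0 T n t = 0"
    using cutoff_interval_support[OF T, of n] by blast
  obtain p2 q2 where 2: "0 < p2" "q2 < T" "\<And>t. t \<notin> {p2..q2} \<Longrightarrow> cutoff 0 T m t = 0"
    using cutoff_interval_support[OF T, of m] by blast
  show ?thesis
  proof (rule that[OF \<psi>c _ _ _ \<psi>I close, of "min p1 p2" "max q1 q2"])
    show "0 < min p1 p2" "max q1 q2 < T" using 1 2 by auto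
    show "\<psi> t = 0" if "t \<notin> {min p1 p2..max q1 q2}" for t
    proof -
      have "t \<notin> {p1..q1}" "t \<notin> {p2..q2}" using that by auto
      then have "cutoff 0 T n t = 0" "cutoff 0 T m t = 0" using 1(3) 2(3) by blast+
      then show ?thesis using \<psi>0(2) by (simp add: \<psi>_def \<eta>_def)
    qed
  qed
qed

text \<open>
  Let \<open>c\<close> be the mean of \<open>d\<close> and \<open>e = d - c\<close>. For \<open>\<psi> = \<phi>'\<close> with a test function \<open>\<phi>\<close>,
  \<open>\<integral> e \<psi> = \<integral> d \<phi>' = - \<integral> r \<phi> \<le> \<parallel>r\<parallel> \<parallel>\<phi>\<parallel> \<le> T \<parallel>r\<parallel> \<parallel>\<psi>\<parallel>\<close>. Such \<open>\<psi>\<close> come arbitrarily close to \<open>e\<close>, which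
  gives \<open>\<parallel>e\<parallel>\<^sup>2 \<le> T \<parallel>r\<parallel> \<parallel>e\<parallel>\<close>.
\<close>

lemma weak_Poincare:
  assumes T: "0 < (T::real)" and d: "d \<in> l2_space {0<..<T}" and r: "r \<in> l2_space {0<..<T}"
    and w: "is_weak_deriv {0<..<T} 1 d r"
  obtains c where "l2_norm {0<..<T} (\<lambda>t. d t - c) \<le> T * l2_norm {0<..<T} r"
proof -
  let ?U = "{0<..<T}"
  define c where "c = (\<integral>t. d t \<partial>lebesgue_on ?U) / T"
  define e where "e = (\<lambda>t. d t - c)"
  have cl: "f \<in> l2_space ?U" if "continuous_on UNIV f" for f
    by (rule continuous_in_l2_space[OF _ _ that]) auto
  have one: "(\<lambda>x. k) \<in> l2_space ?U" for k by (rule cl) auto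
  have el: "e \<in> l2_space ?U" unfolding e_def by (rule l2_space_diff[OF d one])
  have "(\<integral>t. e t \<partial>lebesgue_on ?U) = (\<integral>t. d t \<partial>lebesgue_on ?U) - (\<integral>t. c \<partial>lebesgue_on ?U)"
    unfolding e_def using l2_space_integrable_mult[OF d one[of 1]] l2_space_integrable_mult[OF one[of c] one[of 1]]
    by (intro Bochner_Integration.integral_diff) auto
  also have "(\<integral>t. c \<partial>lebesgue_on ?U) = c * T" using T by (subst integral_lebesgue_on_Ioo) auto
  finally have mean: "(\<integral>t. e t \<partial>lebesgue_on ?U) = 0" using T by (simp add: c_def)
  have approx: "(l2_norm ?U e)\<^sup>2 \<le> l2_norm ?U e * \<delta> + T * l2_norm ?U r * (l2_norm ?U e + \<delta>)" if "0 < \<delta>" for \<delta>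
  proof -
    obtain \<psi> p q where \<psi>: "continuous_on UNIV \<psi>" "0 < p" "q < T" "\<And>t. t \<notin> {p..q} \<Longrightarrow> \<psi> t = 0"
      "(\<integral>t. \<psi> t \<partial>lebesgue_on ?U) = 0" and close: "l2_norm ?U (\<lambda>t. e t - \<psi> t) < \<delta>"
      using mean_zero_approximation[OF T el mean \<open>0 < \<delta>\<close>] by blast
    obtain \<phi> where \<phi>: "\<phi> \<in> test_functions ?U" "\<And>t. partial 1 \<phi> t = \<psi> t"
      and \<phi>_le: "l2_norm ?U \<phi> \<le> T * l2_norm ?U \<psi>"
      using mean_zero_primitive_test_function[OF T \<psi>] by blast
    have \<psi>l: "\<psi> \<in> l2_space ?U" by (rule cl[OF \<psi>(1)])
    have \<phi>l: "\<phi> \<in> l2_space ?U" using \<phi>(1) by (intro cl C1_continuous) (simp add: test_functions_iff)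
    have "l2_inner ?U e \<psi> = l2_inner ?U d \<psi> - l2_inner ?U (\<lambda>t. c) \<psi>"
      unfolding e_def by (rule l2_inner_diff_left[OF d one \<psi>l])
    also have "l2_inner ?U (\<lambda>t. c) \<psi> = 0" using \<psi>(5) by (simp add: l2_inner_def)
    also have "l2_inner ?U d \<psi> = - l2_inner ?U r \<phi>"
      using w[unfolded is_weak_deriv_def, rule_format, OF \<phi>(1)] unfolding \<phi>(2) l2_inner_def .
    finally have e\<psi>: "l2_inner ?U e \<psi> = - l2_inner ?U r \<phi>" by simp
    have "l2_norm ?U \<psi> \<le> l2_norm ?U e + \<delta>"
      using l2_norm_triangle[OF el l2_space_diff[OF \<psi>l el]] close l2_norm_minus_commute[of ?U \<psi> e] by simp
    then have "T * l2_norm ?U \<psi> \<le> T * (l2_norm ?U e + \<delta>)"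
      using T by (simp add: mult_left_mono)
    then have "l2_norm ?U r * l2_norm ?U \<phi> \<le> l2_norm ?U r * (T * (l2_norm ?U e + \<delta>))"
      by (intro mult_left_mono[OF order_trans[OF \<phi>_le]]) auto
    then have i1: "l2_inner ?U e \<psi> \<le> l2_norm ?U r * (T * (l2_norm ?U e + \<delta>))"
      using l2_inner_Cauchy_Schwarz[OF r \<phi>l] e\<psi> by linarith
    have "l2_inner ?U (\<lambda>t. e t - \<psi> t) e \<le> l2_norm ?U (\<lambda>t. e t - \<psi> t) * l2_norm ?U e"
      using l2_inner_Cauchy_Schwarz[OF l2_space_diff[OF el \<psi>l] el] by simp
    also have "\<dots> \<le> \<delta> * l2_norm ?U e" using close by (intro mult_right_mono) auto
    finally have i2: "l2_inner ?U (\<lambda>t. e t - \<psi> t) e \<le> \<delta> * l2_norm ?U e" .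
    have "(l2_norm ?U e)\<^sup>2 = l2_inner ?U e e" unfolding l2_norm_power2 by (simp add: l2_inner_def power2_eq_square)
    also have "\<dots> = l2_inner ?U (\<lambda>t. e t - \<psi> t) e + l2_inner ?U e \<psi>"
      unfolding l2_inner_diff_left[OF el \<psi>l el] by (simp add: l2_inner_def mult.commute)
    finally show ?thesis using i1 i2 by (simp add: algebra_simps)
  qed
  have "(\<lambda>n. l2_norm ?U e * inverse (real (Suc n)) + T * l2_norm ?U r * (l2_norm ?U e + inverse (real (Suc n))))
      \<longlonglongrightarrow> l2_norm ?U e * 0 + T * l2_norm ?U r * (l2_norm ?U e + 0)"
    by (intro tendsto_intros LIMSEQ_inverse_real_of_nat)
  then have "(l2_norm ?U e)\<^sup>2 \<le> l2_norm ?U e * 0 + T * l2_norm ?U r * (l2_norm ?U e + 0)"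
    by (rule Lim_bounded2[where N = 0]) (use approx in simp)
  then have "l2_norm ?U e * l2_norm ?U e \<le> (T * l2_norm ?U r) * l2_norm ?U e" by (simp add: power2_eq_square)
  then have "l2_norm ?U e \<le> T * l2_norm ?U r"
    using T l2_norm_nonneg[of ?U e] by (cases "l2_norm ?U e = 0") (auto simp: mult_le_cancel_right)
  then show ?thesis using that[of c] by (simp add: e_def)
qed

section \<open>Functions with vanishing finite differences\<close>

definition fdiff :: "real \<Rightarrow> (real \<Rightarrow> real) \<Rightarrow> real \<Rightarrow> real" where
  "fdiff h f x = f (x + h) - f x"

lemma Newton_forward_difference:
  "f (x + real m * h) = (\<Sum>j\<le>m. real (m choose j) * (fdiff h ^^ j) f x)"
proof (induction m arbitrary: f)
  case (Suc m)
  have "f (x + real (Suc m) * h) = fdiff h f (x + real m * h) + f (x + real m * h)"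
    by (simp add: fdiff_def algebra_simps)
  also have "\<dots> = (\<Sum>j\<le>m. real (m choose j) * (fdiff h ^^ j) (fdiff h f) x) +
      (\<Sum>j\<le>m. real (m choose j) * (fdiff h ^^ j) f x)"
    by (simp only: Suc.IH)
  also have "(\<Sum>j\<le>m. real (m choose j) * (fdiff h ^^ j) f x) =
      f x + (\<Sum>j\<le>m. real (m choose Suc j) * (fdiff h ^^ Suc j) f x)"
  proof -
    have "(\<Sum>j\<le>m. real (m choose j) * (fdiff h ^^ j) f x) = (\<Sum>j\<le>Suc m. real (m choose j) * (fdiff h ^^ j) f x)"
      by simp
    also have "\<dots> = f x + (\<Sum>j\<le>m. real (m choose Suc j) * (fdiff h ^^ Suc j) f x)"
      by (subst sum.atMost_Suc_shift) simp
    finally show ?thesis .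
  qed
  also have "(\<Sum>j\<le>m. real (m choose j) * (fdiff h ^^ j) (fdiff h f) x) +
      (f x + (\<Sum>j\<le>m. real (m choose Suc j) * (fdiff h ^^ Suc j) f x)) =
      f x + (\<Sum>j\<le>m. real (Suc m choose Suc j) * (fdiff h ^^ Suc j) f x)"
    by (simp add: sum.distrib[symmetric] funpow_swap1 distrib_right)
  also have "\<dots> = (\<Sum>j\<le>Suc m. real (Suc m choose j) * (fdiff h ^^ j) f x)"
    unfolding sum.atMost_Suc_shift by simp
  finally show ?case .
qed simp

lemma fdiff_funpow_eq_0_mono:
  assumes "\<And>x. (fdiff h ^^ k) f x = 0" "k \<le> j"
  shows "(fdiff h ^^ j) f x = 0"
proof -
  have "(fdiff h ^^ (i + k)) f x = 0" for i x
    by (induction i arbitrary: x) (simp_all add: assms(1), simp add: fdiff_def)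
  from this[of "j - k" x] show ?thesis using assms(2) by simp
qed

text \<open>
  Newton's formula expresses \<open>f (x + m h)\<close> by binomial coefficients \<open>m choose j\<close>, which are polynomials in
  \<open>m\<close>; only those with \<open>j < k\<close> contribute.
\<close>

lemma poly_on_progression:
  assumes z: "\<And>x. (fdiff h ^^ k) f x = 0"
  shows "\<exists>p. \<forall>m. f (x + real m * h) = poly p (real m)"
proof -
  define b where "b j = smult (1 / fact j) (\<Prod>i = 0..<j. [:- real i, 1:])" for j
  have b: "poly (b j) (real m) = real (m choose j)" for j m
  proof -
    have "poly (b j) (real m) = (\<Prod>i = 0..<j. real m - real i) / fact j"
      by (simp add: b_def poly_prod)
    also have "\<dots> = real m gchoose j" by (simp add: gbinomial_prod_rev)
    finally show ?thesis by (simp add: binomial_gbinomial)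
  qed
  let ?p = "\<Sum>j<k. smult ((fdiff h ^^ j) f x) (b j)"
  have "f (x + real m * h) = poly ?p (real m)" for m
  proof -
    have "f (x + real m * h) = (\<Sum>j\<le>m. real (m choose j) * (fdiff h ^^ j) f x)"
      by (rule Newton_forward_difference)
    also have "\<dots> = (\<Sum>j\<in>{..m} \<union> {..<k}. real (m choose j) * (fdiff h ^^ j) f x)"
      by (rule sum.mono_neutral_left) (auto simp: binomial_eq_0)
    also have "\<dots> = (\<Sum>j<k. real (m choose j) * (fdiff h ^^ j) f x)"
      by (rule sum.mono_neutral_right) (auto simp: fdiff_funpow_eq_0_mono[OF z])
    also have "\<dots> = poly ?p (real m)" by (simp add: poly_sum b mult.commute)
    finally show ?thesis .
  qed
  then show ?thesis by blast
qed

lemma poly_eqI_naturals: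
  fixes p q :: "real poly"
  assumes "\<And>n. poly p (real n) = poly q (real n)" shows "p = q"
proof (rule ccontr)
  assume "p \<noteq> q"
  then have "finite {x. poly (p - q) x = 0}" by (intro poly_roots_finite) simp
  moreover have "range real \<subseteq> {x. poly (p - q) x = 0}" using assms by auto
  ultimately have "finite (range real)" by (rule finite_subset[rotated])
  then show False using range_inj_infinite[OF inj_of_nat] by blast
qed

text \<open>
  On every progression \<open>- M + m / n\<close> with \<open>m = 0, 1, \<dots>\<close>, the function agrees with a polynomial. All these
  polynomials agree with \<open>f\<close> at the natural numbers, so they are one and the same. Thus \<open>f\<close> is a
  polynomial on the rationals, and by continuity everywhere.
\<close>

lemma Frechet_polynomial:
  fixes f :: "real \<Rightarrow> real"
  assumes cont: "continuous_on UNIV f" and z: "\<And>h x. 0 < h \<Longrightarrow> (fdiff h ^^ k) f x = 0"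
  shows "\<exists>p. f = poly p"
proof -
  obtain p where p: "\<And>m. f (real m) = poly p (real m)"
    using poly_on_progression[OF z[of 1], of 0] by auto
  have rat: "f (real m / real n - real M) = poly p (real m / real n - real M)" if n: "0 < n" for m n M :: nat
  proof -
    have h: "0 < 1 / real n" using n by simp
    obtain q where q: "\<And>m. f (- real M + real m * (1 / real n)) = poly q (real m)"
      using poly_on_progression[OF z[OF h]] by blast
    \<comment> \<open>\<open>q\<close> is a polynomial in the index \<open>m\<close>; \<open>r\<close> is the same polynomial in \<open>y = - M + m / n\<close>\<close>
    define r where "r = pcompose q [:real M * real n, real n:]"
    have r: "poly r (- real M + real m * (1 / real n)) = f (- real M + real m * (1 / real n))" for m
    proof -
      have "real M * real n + real n * (- real M + real m * (1 / real n)) = real m"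
        using n by (simp add: distrib_left right_diff_distrib)
      moreover have "poly r y = poly q (real M * real n + real n * y)" for y
        by (simp add: r_def poly_pcompose mult.commute)
      ultimately show ?thesis using q[of m] by simp
    qed
    have "r = p"
    proof (rule poly_eqI_naturals)
      fix j
      have "- real M + real ((j + M) * n) * (1 / real n) = real j" using n by simp
      then show "poly r (real j) = poly p (real j)" using r[of "(j + M) * n"] p[of j] by simp
    qed
    then show ?thesis using r[of m] by (simp add: algebra_simps)
  qed
  have Q: "f x = poly p x" if "x \<in> \<rat>" for x
  proof -
    obtain M :: nat where M: "- x < real M" using reals_Archimedean2 by blast
    have "x + real M \<in> \<rat>" using that by simp
    then obtain m n :: nat where mn: "n \<noteq> 0" "\<bar>x + real M\<bar> = real m / real n"
      by (rule Rats_abs_nat_div_natE)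
    then have "x = real m / real n - real M" using M by simp
    then show ?thesis using rat[of n m M] mn by simp
  qed
  have "closed {x. f x = poly p x}"
    using cont by (intro closed_Collect_eq) (auto intro!: continuous_intros)
  then have "closure \<rat> \<subseteq> {x. f x = poly p x}" by (rule closure_minimal[rotated]) (use Q in auto)
  then have "f = poly p" by (auto simp: Rats_closure_real)
  then show ?thesis by blast
qed

section \<open>Uniform density of networks\<close>

text \<open>
  Inner weights are required to be nonzero because such a network is to become the second derivative
  of another one, which means dividing the outer weights by the squares of the inner ones.
\<close>

definition nets :: "(real \<Rightarrow> real) \<Rightarrow> (real \<Rightarrow> real) set" where
  "nets \<tau> = {f. \<exists>m A W B. (\<forall>i<m. W i \<noteq> 0) \<and> f = net \<tau> m A W B}"

lemma nets_zero: "(\<lambda>t. 0) \<in> nets \<tau>"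
  unfolding nets_def
  by (rule CollectI, rule exI[of _ 0], intro exI[of _ "\<lambda>i. 0"]) (simp add: net_def fun_eq_iff)

lemma net_append:
  "net \<tau> (m + n) (\<lambda>i. if i < m then A i else A' (i - m)) (\<lambda>i. if i < m then W i else W' (i - m))
    (\<lambda>i. if i < m then B i else B' (i - m)) t = net \<tau> m A W B t + net \<tau> n A' W' B' t"
proof -
  let ?u = "\<lambda>i. (if i < m then A i else A' (i - m)) *
    \<tau> ((if i < m then W i else W' (i - m)) * t + (if i < m then B i else B' (i - m)))"
  have "{..<m + n} = {..<m} \<union> (\<lambda>i. i + m) ` {..<n}"
  proof (intro set_eqI iffI)
    fix i assume "i \<in> {..<m + n}"
    then show "i \<in> {..<m} \<union> (\<lambda>i. i + m) ` {..<n}"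
      by (cases "i < m") (auto intro!: image_eqI[of _ _ "i - m"])
  qed auto
  then have "sum ?u {..<m + n} = sum ?u {..<m} + sum ?u ((\<lambda>i. i + m) ` {..<n})"
    by (simp only:) (rule sum.union_disjoint, auto)
  also have "sum ?u {..<m} = (\<Sum>i<m. A i * \<tau> (W i * t + B i))"
    by (rule sum.cong) auto
  also have "sum ?u ((\<lambda>i. i + m) ` {..<n}) = (\<Sum>i<n. A' i * \<tau> (W' i * t + B' i))"
    by (subst sum.reindex) (auto simp: inj_on_def)
  finally show ?thesis by (simp add: net_def)
qed

lemma nets_add: assumes "f \<in> nets \<tau>" "g \<in> nets \<tau>" shows "(\<lambda>t. f t + g t) \<in> nets \<tau>"
proof -
  obtain m A W B where f: "\<forall>i<m. W i \<noteq> 0" "f = net \<tau> m A W B" using assms(1) unfolding nets_def by blast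
  obtain n A' W' B' where g: "\<forall>i<n. W' i \<noteq> 0" "g = net \<tau> n A' W' B'" using assms(2) unfolding nets_def by blast
  let ?W = "\<lambda>i. if i < m then W i else W' (i - m)"
  have "\<forall>i<m + n. ?W i \<noteq> 0" using f(1) g(1) by auto
  moreover have "(\<lambda>t. f t + g t) = net \<tau> (m + n) (\<lambda>i. if i < m then A i else A' (i - m)) ?W
      (\<lambda>i. if i < m then B i else B' (i - m))"
    unfolding f(2) g(2) by (rule ext) (simp only: net_append)
  ultimately show ?thesis
    unfolding nets_def by (intro CollectI exI[of _ "m + n"] exI[of _ ?W] exI conjI)
qed

lemma nets_cmult: assumes "f \<in> nets \<tau>" shows "(\<lambda>t. c * f t) \<in> nets \<tau>"
proof -
  obtain m A W B where f: "\<forall>i<m. W i \<noteq> 0" "f = net \<tau> m A W B" using assms unfolding nets_def by blast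
  have "(\<lambda>t. c * f t) = net \<tau> m (\<lambda>i. c * A i) W B"
    unfolding f(2) by (rule ext) (simp add: net_def sum_distrib_left mult.assoc)
  then show ?thesis using f(1) unfolding nets_def by blast
qed

lemma nets_ridge: "w \<noteq> 0 \<Longrightarrow> (\<lambda>t. \<tau> (w * t + b)) \<in> nets \<tau>"
  unfolding nets_def
  by (rule CollectI, rule exI[of _ 1], rule exI[of _ "\<lambda>i. 1"], rule exI[of _ "\<lambda>i. w"], rule exI[of _ "\<lambda>i. b"])
    (auto simp: net_def)

definition approximable :: "(real \<Rightarrow> real) \<Rightarrow> real \<Rightarrow> (real \<Rightarrow> real) \<Rightarrow> bool" where
  "approximable \<tau> T f \<longleftrightarrow> (\<forall>\<epsilon>>0. \<exists>g\<in>nets \<tau>. \<forall>t\<in>{0..T}. \<bar>f t - g t\<bar> < \<epsilon>)"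

lemma approximable_nets: "f \<in> nets \<tau> \<Longrightarrow> approximable \<tau> T f"
  unfolding approximable_def by (intro allI impI bexI[of _ f]) auto

lemma approximable_limit:
  assumes "\<And>\<epsilon>. 0 < \<epsilon> \<Longrightarrow> \<exists>g. approximable \<tau> T g \<and> (\<forall>t\<in>{0..T}. \<bar>f t - g t\<bar> < \<epsilon>)"
  shows "approximable \<tau> T f"
  unfolding approximable_def
proof (intro allI impI)
  fix \<epsilon> :: real assume \<epsilon>: "0 < \<epsilon>"
  obtain g where g: "approximable \<tau> T g" "\<forall>t\<in>{0..T}. \<bar>f t - g t\<bar> < \<epsilon> / 2"
    using assms[of "\<epsilon> / 2"] \<epsilon> by auto
  obtain n where n: "n \<in> nets \<tau>" "\<forall>t\<in>{0..T}. \<bar>g t - n t\<bar> < \<epsilon> / 2"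
    using g(1) half_gt_zero[OF \<epsilon>] unfolding approximable_def by blast
  have "\<forall>t\<in>{0..T}. \<bar>f t - n t\<bar> < \<epsilon>"
  proof
    fix t assume "t \<in> {0..T}"
    then have "\<bar>f t - g t\<bar> < \<epsilon> / 2" "\<bar>g t - n t\<bar> < \<epsilon> / 2" using g(2) n(2) by blast+
    then show "\<bar>f t - n t\<bar> < \<epsilon>" by linarith
  qed
  then show "\<exists>g\<in>nets \<tau>. \<forall>t\<in>{0..T}. \<bar>f t - g t\<bar> < \<epsilon>" using n(1) by blast
qed

lemma approximable_add:
  assumes f: "approximable \<tau> T f" and g: "approximable \<tau> T g"
  shows "approximable \<tau> T (\<lambda>t. f t + g t)"
  unfolding approximable_def
proof (intro allI impI)
  fix \<epsilon> :: real assume "0 < \<epsilon>"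
  then have h: "0 < \<epsilon> / 2" by simp
  obtain m where m: "m \<in> nets \<tau>" "\<forall>t\<in>{0..T}. \<bar>f t - m t\<bar> < \<epsilon> / 2"
    using f h unfolding approximable_def by blast
  obtain n where n: "n \<in> nets \<tau>" "\<forall>t\<in>{0..T}. \<bar>g t - n t\<bar> < \<epsilon> / 2"
    using g h unfolding approximable_def by blast
  have "\<forall>t\<in>{0..T}. \<bar>f t + g t - (m t + n t)\<bar> < \<epsilon>"
  proof
    fix t assume "t \<in> {0..T}"
    then have "\<bar>f t - m t\<bar> < \<epsilon> / 2" "\<bar>g t - n t\<bar> < \<epsilon> / 2" using m(2) n(2) by blast+
    then show "\<bar>f t + g t - (m t + n t)\<bar> < \<epsilon>" by linarith
  qed
  then show "\<exists>k\<in>nets \<tau>. \<forall>t\<in>{0..T}. \<bar>f t + g t - k t\<bar> < \<epsilon>" by (rule bexI[OF _ nets_add[OF m(1) n(1)]])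
qed

lemma approximable_cmult:
  assumes f: "approximable \<tau> T f" shows "approximable \<tau> T (\<lambda>t. c * f t)"
proof (cases "c = 0")
  case True
  then show ?thesis using approximable_nets[OF nets_zero] by simp
next
  case False
  show ?thesis
    unfolding approximable_def
  proof (intro allI impI)
    fix \<epsilon> :: real assume "0 < \<epsilon>"
    then have h: "0 < \<epsilon> / \<bar>c\<bar>" using False by simp
    obtain m where m: "m \<in> nets \<tau>" "\<forall>t\<in>{0..T}. \<bar>f t - m t\<bar> < \<epsilon> / \<bar>c\<bar>"
      using f h unfolding approximable_def by blast
    have "\<forall>t\<in>{0..T}. \<bar>c * f t - c * m t\<bar> < \<epsilon>"
    proof
      fix t assume "t \<in> {0..T}"
      then have "\<bar>f t - m t\<bar> < \<epsilon> / \<bar>c\<bar>" using m(2) by blast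
      then show "\<bar>c * f t - c * m t\<bar> < \<epsilon>"
        using False by (simp add: right_diff_distrib[symmetric] abs_mult pos_less_divide_eq mult.commute)
    qed
    then show "\<exists>k\<in>nets \<tau>. \<forall>t\<in>{0..T}. \<bar>c * f t - k t\<bar> < \<epsilon>" by (rule bexI[OF _ nets_cmult[OF m(1)]])
  qed
qed

lemma approximable_sum:
  "(\<And>i. i \<in> I \<Longrightarrow> approximable \<tau> T (f i)) \<Longrightarrow> approximable \<tau> T (\<lambda>t. \<Sum>i\<in>I. f i t)"
  by (induction I rule: infinite_finite_induct)
    (auto intro: approximable_add approximable_nets nets_zero)

text \<open>
  The function \<open>t\<^sup>k G(w t + b)\<close> is the \<open>k\<close>-th derivative with respect to \<open>w\<close> of \<open>F(w t + b)\<close> when \<open>G\<close> is the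
  \<open>k\<close>-th derivative of \<open>F\<close>.
\<close>

definition ridge_good :: "(real \<Rightarrow> real) \<Rightarrow> real \<Rightarrow> nat \<Rightarrow> (real \<Rightarrow> real) \<Rightarrow> bool" where
  "ridge_good \<tau> T k G \<longleftrightarrow> (\<forall>w b. approximable \<tau> T (\<lambda>t. t ^ k * G (w * t + b)))"

text \<open>
  For \<open>w = 0\<close> the function is constant in \<open>t\<close>; it is a uniform limit of networks with inner weights
  tending to \<open>0\<close>.
\<close>

lemma ridge_good_self:
  assumes T: "0 < T" and \<tau>: "continuous_on UNIV \<tau>"
  shows "ridge_good \<tau> T 0 \<tau>"
  unfolding ridge_good_def
proof (intro allI)
  fix w b
  show "approximable \<tau> T (\<lambda>t. t ^ 0 * \<tau> (w * t + b))"
  proof (cases "w = 0")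
    case False
    then show ?thesis using approximable_nets[OF nets_ridge[OF False]] by simp
  next
    case True
    show ?thesis
    proof (rule approximable_limit)
      fix \<epsilon> :: real assume "0 < \<epsilon>"
      moreover have "isCont \<tau> b" using \<tau> by (simp add: continuous_on_eq_continuous_at)
      ultimately obtain \<delta> where \<delta>: "0 < \<delta>" "\<And>y. dist y b < \<delta> \<Longrightarrow> dist (\<tau> y) (\<tau> b) < \<epsilon>"
        unfolding continuous_at_eps_delta by blast
      let ?\<eta> = "\<delta> / (T + 1)"
      have \<eta>: "?\<eta> \<noteq> 0" using \<delta>(1) T by simp
      have "\<bar>\<tau> b - \<tau> (?\<eta> * t + b)\<bar> < \<epsilon>" if t: "t \<in> {0..T}" for t
      proof -
        have "?\<eta> * t \<le> ?\<eta> * T" using t \<delta>(1) T by (intro mult_left_mono) auto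
        also have "\<dots> < \<delta>" using \<delta>(1) T by (simp add: divide_less_eq)
        finally have "dist (?\<eta> * t + b) b < \<delta>" using t \<delta>(1) T by (simp add: dist_real_def)
        from \<delta>(2)[OF this] show ?thesis by (simp add: dist_real_def abs_minus_commute)
      qed
      then show "\<exists>g. approximable \<tau> T g \<and> (\<forall>t\<in>{0..T}. \<bar>t ^ 0 * \<tau> (w * t + b) - g t\<bar> < \<epsilon>)"
        using approximable_nets[OF nets_ridge[OF \<eta>, of \<tau> b]] True
        by (intro exI[of _ "\<lambda>t. \<tau> (?\<eta> * t + b)"]) auto
    qed
  qed
qed

lemma uniformly_continuous_on_interval:
  fixes F :: "real \<Rightarrow> real"
  assumes "continuous_on UNIV F" "0 < \<epsilon>"
  obtains \<delta> where "0 < \<delta>" "\<And>x y. \<bar>x\<bar> \<le> R \<Longrightarrow> \<bar>y\<bar> \<le> R \<Longrightarrow> \<bar>x - y\<bar> < \<delta> \<Longrightarrow> \<bar>F x - F y\<bar> < \<epsilon>"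
proof -
  have "uniformly_continuous_on {-R..R} F"
    by (rule compact_uniformly_continuous[OF continuous_on_subset[OF assms(1)]]) auto
  then obtain \<delta> where \<delta>: "0 < \<delta>" "\<forall>x\<in>{-R..R}. \<forall>y\<in>{-R..R}. dist y x < \<delta> \<longrightarrow> dist (F y) (F x) < \<epsilon>"
    unfolding uniformly_continuous_on_def using assms(2) by blast
  show ?thesis
  proof (rule that[OF \<delta>(1)])
    fix x y assume "\<bar>x\<bar> \<le> R" "\<bar>y\<bar> \<le> R" "\<bar>x - y\<bar> < \<delta>"
    then have "x \<in> {-R..R}" "y \<in> {-R..R}" "dist x y < \<delta>" by (auto simp: dist_real_def)
    then have "dist (F x) (F y) < \<epsilon>" using \<delta>(2) by blast
    then show "\<bar>F x - F y\<bar> < \<epsilon>" by (simp add: dist_real_def)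
  qed
qed

text \<open>
  The difference \<open>fdiff h A x\<close> is the integral of \<open>F\<close> over \<open>[x, x + h]\<close>. Its Riemann sums are combinations of
  translates of \<open>F\<close> and converge uniformly on bounded sets.
\<close>

lemma ridge_good_fdiff_antiderivative:
  assumes T: "0 < T" and h: "0 < h" and F: "continuous_on UNIV F"
    and A: "\<And>x. (A has_real_derivative F x) (at x)" and good: "ridge_good \<tau> T k F"
  shows "ridge_good \<tau> T k (fdiff h A)"
  unfolding ridge_good_def
proof (intro allI)
  fix w b
  show "approximable \<tau> T (\<lambda>t. t ^ k * fdiff h A (w * t + b))"
  proof (rule approximable_limit)
    fix \<epsilon> :: real assume \<epsilon>: "0 < \<epsilon>"
    define R where "R = \<bar>w\<bar> * T + \<bar>b\<bar> + h"
    \<comment> \<open>all arguments of \<open>F\<close> lie in \<open>{-R..R}\<close>; the factor \<open>t\<^sup>k\<close> and the window length divide the tolerance\<close>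
    define \<epsilon>' where "\<epsilon>' = \<epsilon> / 2 / (T ^ k * h)"
    have \<epsilon>': "0 < \<epsilon>'" using \<epsilon> T h by (simp add: \<epsilon>'_def)
    obtain \<delta> where \<delta>: "0 < \<delta>" "\<And>x y. \<bar>x\<bar> \<le> R \<Longrightarrow> \<bar>y\<bar> \<le> R \<Longrightarrow> \<bar>x - y\<bar> < \<delta> \<Longrightarrow> \<bar>F x - F y\<bar> < \<epsilon>'"
      using uniformly_continuous_on_interval[OF F \<epsilon>'] by blast
    obtain n :: nat where n: "h / \<delta> < real n" using reals_Archimedean2 by blast
    have "0 < real n" by (rule less_trans[OF divide_pos_pos[OF h \<delta>(1)] n])
    then have "0 < n" by simp
    note n = n this
    define s where "s = h / real n"
    have s: "0 < s" "s < \<delta>" "real n * s = h"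
      using n h \<delta>(1) by (simp_all add: s_def pos_divide_less_eq mult.commute)
    let ?g = "\<lambda>t. \<Sum>i<n. s * (t ^ k * F (w * t + (b + real i * s)))"
    have app: "approximable \<tau> T ?g"
      using good unfolding ridge_good_def by (intro approximable_sum approximable_cmult) blast
    have "\<bar>t ^ k * fdiff h A (w * t + b) - ?g t\<bar> < \<epsilon>" if t: "t \<in> {0..T}" for t
    proof -
      let ?x = "w * t + b"
      have x: "\<bar>?x\<bar> + h \<le> R"
      proof -
        have "\<bar>w * t\<bar> \<le> \<bar>w\<bar> * T" using t by (simp add: abs_mult mult_left_mono)
        then show ?thesis unfolding R_def by linarith
      qed
      have step: "\<bar>(A (?x + real (Suc i) * s) - A (?x + real i * s)) - s * F (?x + real i * s)\<bar> \<le> s * \<epsilon>'"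
        if i: "i < n" for i
      proof -
        have less: "?x + real i * s < ?x + real (Suc i) * s" using s(1) by (simp add: algebra_simps)
        obtain z where z: "?x + real i * s < z" "z < ?x + real (Suc i) * s"
          "A (?x + real (Suc i) * s) - A (?x + real i * s) = (?x + real (Suc i) * s - (?x + real i * s)) * F z"
          using MVT2[OF less, of A F] A by blast
        have "real (Suc i) * s \<le> real n * s" using i s(1) by (intro mult_right_mono) auto
        moreover have suc: "real (Suc i) * s = real i * s + s" by (simp add: algebra_simps)
        moreover have "0 \<le> real i * s" using s(1) by simp
        ultimately have "\<bar>z\<bar> \<le> R" "\<bar>?x + real i * s\<bar> \<le> R" "\<bar>z - (?x + real i * s)\<bar> < \<delta>"
          using x z(1,2) s unfolding suc by linarith+
        then have "\<bar>F z - F (?x + real i * s)\<bar> < \<epsilon>'" by (rule \<delta>(2))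
        moreover have "(A (?x + real (Suc i) * s) - A (?x + real i * s)) - s * F (?x + real i * s) =
            s * (F z - F (?x + real i * s))"
          unfolding z(3) by (simp add: algebra_simps)
        ultimately show ?thesis using s(1) by (simp add: abs_mult)
      qed
      have eq: "fdiff h A ?x - (\<Sum>i<n. s * F (?x + real i * s)) =
          (\<Sum>i<n. (A (?x + real (Suc i) * s) - A (?x + real i * s)) - s * F (?x + real i * s))"
        using sum_lessThan_telescope[of "\<lambda>i. A (?x + real i * s)" n] s(3)
        by (simp add: sum_subtractf fdiff_def)
      have "\<bar>fdiff h A ?x - (\<Sum>i<n. s * F (?x + real i * s))\<bar> \<le> (\<Sum>i<n. s * \<epsilon>')"
        unfolding eq by (rule order_trans[OF sum_abs sum_mono]) (use step in simp)
      also have "\<dots> = real n * s * \<epsilon>'" by simp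
      also have "\<dots> = h * \<epsilon>'" unfolding s(3) ..
      finally have le: "\<bar>fdiff h A ?x - (\<Sum>i<n. s * F (?x + real i * s))\<bar> \<le> h * \<epsilon>'" .
      have "?g t = t ^ k * (\<Sum>i<n. s * F (?x + real i * s))"
        by (simp add: sum_distrib_left add.assoc mult.left_commute)
      then have "\<bar>t ^ k * fdiff h A ?x - ?g t\<bar> = \<bar>t ^ k\<bar> * \<bar>fdiff h A ?x - (\<Sum>i<n. s * F (?x + real i * s))\<bar>"
        by (simp add: right_diff_distrib abs_mult[symmetric])
      also have "\<dots> \<le> T ^ k * (h * \<epsilon>')"
      proof (rule mult_mono[OF _ le])
        show "\<bar>t ^ k\<bar> \<le> T ^ k" using t by (simp add: power_mono)
      qed (use T in auto)
      also have "\<dots> = \<epsilon> / 2" using T h by (simp add: \<epsilon>'_def)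
      finally show ?thesis using \<epsilon> by linarith
    qed
    then show "\<exists>g. approximable \<tau> T g \<and> (\<forall>t\<in>{0..T}. \<bar>t ^ k * fdiff h A (w * t + b) - g t\<bar> < \<epsilon>)"
      using app by blast
  qed
qed

text \<open>
  Difference quotients of \<open>t\<^sup>k G(w t + b)\<close> with respect to \<open>w\<close> converge to \<open>t\<^sup>k\<^sup>+\<^sup>1 G'(w t + b)\<close>, uniformly for
  \<open>t\<close> in the interval.
\<close>

lemma ridge_good_derivative:
  assumes T: "0 < T" and G: "\<And>x. (G has_real_derivative G' x) (at x)" and cont: "continuous_on UNIV G'"
    and good: "ridge_good \<tau> T k G"
  shows "ridge_good \<tau> T (Suc k) G'"
  unfolding ridge_good_def
proof (intro allI)
  fix w b
  show "approximable \<tau> T (\<lambda>t. t ^ Suc k * G' (w * t + b))"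
  proof (rule approximable_limit)
    fix \<epsilon> :: real assume \<epsilon>: "0 < \<epsilon>"
    define R where "R = \<bar>w\<bar> * T + \<bar>b\<bar> + T"
    define \<epsilon>' where "\<epsilon>' = \<epsilon> / 2 / T ^ Suc k"
    have \<epsilon>': "0 < \<epsilon>'" using \<epsilon> T by (simp add: \<epsilon>'_def)
    obtain \<delta> where \<delta>: "0 < \<delta>" "\<And>x y. \<bar>x\<bar> \<le> R \<Longrightarrow> \<bar>y\<bar> \<le> R \<Longrightarrow> \<bar>x - y\<bar> < \<delta> \<Longrightarrow> \<bar>G' x - G' y\<bar> < \<epsilon>'"
      using uniformly_continuous_on_interval[OF cont \<epsilon>'] by blast
    \<comment> \<open>the step in \<open>w\<close>; it is at most \<open>1\<close> so that \<open>(w + \<eta>) t + b\<close> stays in \<open>{-R..R}\<close>\<close>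
    define \<eta> where "\<eta> = min 1 (\<delta> / (2 * T))"
    have \<eta>: "0 < \<eta>" "\<eta> \<le> 1" "\<eta> * T < \<delta>"
    proof -
      show "0 < \<eta>" "\<eta> \<le> 1" using \<delta>(1) T by (auto simp: \<eta>_def)
      have "\<eta> * T \<le> \<delta> / (2 * T) * T" unfolding \<eta>_def using T by (intro mult_right_mono) auto
      also have "\<dots> < \<delta>" using T \<delta>(1) by simp
      finally show "\<eta> * T < \<delta>" .
    qed
    let ?g = "\<lambda>t. (1 / \<eta>) * (t ^ k * G ((w + \<eta>) * t + b)) + (- 1 / \<eta>) * (t ^ k * G (w * t + b))"
    have app: "approximable \<tau> T ?g"
      using good unfolding ridge_good_def by (intro approximable_add approximable_cmult) blast+
    have "\<bar>t ^ Suc k * G' (w * t + b) - ?g t\<bar> < \<epsilon>" if t: "t \<in> {0..T}" for t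
    proof (cases "t = 0")
      case True
      then show ?thesis using \<epsilon> by simp
    next
      case False
      let ?x = "w * t + b"
      have t0: "0 < t" using t False by simp
      have less: "?x < ?x + \<eta> * t" using \<eta>(1) t0 by simp
      obtain z where z: "?x < z" "z < ?x + \<eta> * t" "G (?x + \<eta> * t) - G ?x = (?x + \<eta> * t - ?x) * G' z"
        using MVT2[OF less, of G G'] G by blast
      have "\<bar>w * t\<bar> \<le> \<bar>w\<bar> * T" using t by (simp add: abs_mult mult_left_mono)
      moreover have "\<eta> * t \<le> \<eta> * T" using \<eta>(1) t by simp
      moreover have "\<eta> * T \<le> T" using \<eta>(1,2) T by simp
      ultimately have "\<bar>?x\<bar> \<le> R" "\<bar>z\<bar> \<le> R" "\<bar>?x - z\<bar> < \<delta>"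
        using z(1,2) \<eta>(3) unfolding R_def by linarith+
      then have le: "\<bar>G' ?x - G' z\<bar> < \<epsilon>'" by (rule \<delta>(2))
      have "?g t = (t ^ k / \<eta>) * (G (?x + \<eta> * t) - G ?x)"
        by (simp add: algebra_simps diff_divide_distrib)
      also have "\<dots> = t ^ Suc k * G' z" unfolding z(3) using \<eta>(1) by simp
      finally have "\<bar>t ^ Suc k * G' ?x - ?g t\<bar> = t ^ Suc k * \<bar>G' ?x - G' z\<bar>"
        using t0 by (simp only: right_diff_distrib[symmetric] abs_mult) simp
      also have "\<dots> \<le> T ^ Suc k * \<epsilon>'"
        using le t0 t by (intro mult_mono power_mono) auto
      also have "\<dots> = \<epsilon> / 2" using T by (simp add: \<epsilon>'_def)
      finally show ?thesis using \<epsilon> by linarith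
    qed
    then show "\<exists>g. approximable \<tau> T g \<and> (\<forall>t\<in>{0..T}. \<bar>t ^ Suc k * G' (w * t + b) - g t\<bar> < \<epsilon>)"
      using app by blast
  qed
qed

lemma continuous_fdiff_funpow:
  "continuous_on UNIV f \<Longrightarrow> continuous_on UNIV ((fdiff h ^^ j) f)"
proof (induction j)
  case (Suc j)
  have "continuous_on UNIV (\<lambda>x. (fdiff h ^^ j) f (x + h) - (fdiff h ^^ j) f x)"
    by (intro continuous_on_diff Suc continuous_on_compose2[OF Suc.IH[OF Suc.prems]])
      (auto intro!: continuous_intros)
  then show ?case by (simp add: fdiff_def[abs_def])
qed simp

lemma has_real_derivative_fdiff_funpow:
  assumes "\<And>x. (A has_real_derivative f x) (at x)"
  shows "((fdiff h ^^ j) A has_real_derivative (fdiff h ^^ j) f x) (at x)"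
proof (induction j arbitrary: x)
  case (Suc j)
  have "((\<lambda>x. x + h) has_real_derivative 1) (at x)" by (auto intro!: derivative_eq_intros)
  from DERIV_diff[OF DERIV_chain2[OF Suc this] Suc]
  show ?case by (simp add: fdiff_def[abs_def])
qed (simp add: assms)

text \<open>
  Let \<open>A\<^sub>0 = \<tau>\<close> and let \<open>A\<^sub>j\<^sub>+\<^sub>1\<close> be an antiderivative of \<open>A\<^sub>j\<close>. Each passage from the \<open>j\<close>-th difference of \<open>A\<^sub>j\<close> to
  the difference of order \<open>j + 1\<close> of \<open>A\<^sub>j\<^sub>+\<^sub>1\<close> is an integration over a window of length \<open>h\<close>. After \<open>k\<close> such
  steps, \<open>k\<close> derivatives lead from the \<open>k\<close>-th difference of \<open>A\<^sub>k\<close> back to that of \<open>\<tau>\<close> and collect the power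
  \<open>t\<^sup>k\<close>.
\<close>

lemma approximable_monomial_times_fdiff:
  assumes T: "0 < T" and h: "0 < h" and \<tau>: "continuous_on UNIV \<tau>"
  shows "approximable \<tau> T (\<lambda>t. t ^ k * (fdiff h ^^ k) \<tau> b)"
proof -
  let ?anti = "\<lambda>f g. continuous_on UNIV g \<and> (\<forall>x. (g has_real_derivative f x) (at x))"
  have step: "\<exists>g. ?anti f g" if f: "continuous_on UNIV f" for f :: "real \<Rightarrow> real"
  proof -
    obtain g where g: "\<And>x. (g has_real_derivative f x) (at x)" using continuous_antiderivative[OF f] by blast
    have "continuous_on UNIV g" by (rule DERIV_continuous_on) (rule g)
    then show ?thesis using g by blast
  qed
  define A where "A = rec_nat \<tau> (\<lambda>n f. SOME g. ?anti f g)"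
  have A0: "A 0 = \<tau>" and AS: "A (Suc n) = (SOME g. ?anti (A n) g)" for n by (simp_all add: A_def)
  have anti: "?anti (A n) (A (Suc n))" if "continuous_on UNIV (A n)" for n
    unfolding AS by (rule someI_ex[OF step[OF that]])
  have Ac: "continuous_on UNIV (A n)" for n
  proof (induction n)
    case 0 then show ?case using \<tau> A0 by simp
  next
    case (Suc n) then show ?case using anti by simp
  qed
  have Ad: "(A (Suc n) has_real_derivative A n x) (at x)" for n x using anti[OF Ac] by simp
  have up: "ridge_good \<tau> T 0 ((fdiff h ^^ j) (A j))" for j
  proof (induction j)
    case 0
    then show ?case using ridge_good_self[OF T \<tau>] A0 by simp
  next
    case (Suc j)
    have "ridge_good \<tau> T 0 (fdiff h ((fdiff h ^^ j) (A (Suc j))))"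
      by (rule ridge_good_fdiff_antiderivative[OF T h continuous_fdiff_funpow[OF Ac]
            has_real_derivative_fdiff_funpow[OF Ad] Suc])
    then show ?case by simp
  qed
  have down: "j \<le> k \<Longrightarrow> ridge_good \<tau> T j ((fdiff h ^^ k) (A (k - j)))" for j
  proof (induction j)
    case 0
    then show ?case using up[of k] by simp
  next
    case (Suc j)
    then have eq: "k - j = Suc (k - Suc j)" by simp
    have "ridge_good \<tau> T j ((fdiff h ^^ k) (A (Suc (k - Suc j))))"
      using Suc unfolding eq[symmetric] by simp
    then show ?case
      by (rule ridge_good_derivative[OF T has_real_derivative_fdiff_funpow[OF Ad] continuous_fdiff_funpow[OF Ac]])
  qed
  have "ridge_good \<tau> T k ((fdiff h ^^ k) \<tau>)" using down[of k] A0 by simp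
  then have "approximable \<tau> T (\<lambda>t. t ^ k * (fdiff h ^^ k) \<tau> (0 * t + b))" unfolding ridge_good_def by blast
  then show ?thesis by simp
qed

text \<open>
  For each \<open>k\<close> some \<open>k\<close>-th difference of \<open>\<tau>\<close> is nonzero, and the preceding lemma can be divided by it, so
  that all monomials are limits of networks.
\<close>

theorem nonpolynomial_nets_dense:
  assumes T: "0 < T" and \<tau>: "continuous_on UNIV \<tau>" and np: "\<not> (\<exists>p :: real poly. \<tau> = poly p)"
    and f: "continuous_on {0..T} f"
  shows "approximable \<tau> T f"
proof -
  have mono: "approximable \<tau> T (\<lambda>t. t ^ k)" for k
  proof -
    obtain h b where h: "0 < h" and nz: "(fdiff h ^^ k) \<tau> b \<noteq> 0"
      using Frechet_polynomial[OF \<tau>, of k] np by blast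
    from approximable_cmult[OF approximable_monomial_times_fdiff[OF T h \<tau>, of k b], of "1 / (fdiff h ^^ k) \<tau> b"]
    show ?thesis using nz by simp
  qed
  show ?thesis
  proof (rule approximable_limit)
    fix \<epsilon> :: real assume "0 < \<epsilon>"
    then obtain g where g: "real_polynomial_function g" "\<And>t. t \<in> {0..T} \<Longrightarrow> \<bar>f t - g t\<bar> < \<epsilon>"
      using Stone_Weierstrass_real_polynomial_function[OF compact_Icc f] by blast
    then obtain a n where "g = (\<lambda>t. \<Sum>i\<le>n. a i * t ^ i)" using real_polynomial_function_iff_sum by blast
    then have "approximable \<tau> T g" by (simp add: approximable_sum approximable_cmult mono)
    then show "\<exists>g. approximable \<tau> T g \<and> (\<forall>t\<in>{0..T}. \<bar>f t - g t\<bar> < \<epsilon>)" using g(2) by blast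
  qed
qed

section \<open>Density of networks in the second-order Sobolev space\<close>

lemma poly_antiderivative: "\<exists>q. pderiv q = (p :: real poly)"
proof -
  have "pderiv (\<Sum>i\<le>n. monom (coeff p i / real (Suc i)) (Suc i)) = (\<Sum>i\<le>n. monom (coeff p i) i)" for n
    by (induction n) (simp_all add: pderiv_add pderiv_monom del: of_nat_Suc)
  from this[of "degree p"] show ?thesis unfolding poly_as_sum_of_monoms by blast
qed

lemma polynomial_of_derivative:
  assumes f: "\<And>x. (f has_real_derivative poly p x) (at x)"
  shows "\<exists>q. f = poly q"
proof -
  obtain q where q: "pderiv q = p" using poly_antiderivative by blast
  have "((\<lambda>x. f x - poly q x) has_real_derivative 0) (at x)" for x
    using DERIV_diff[OF f poly_DERIV[of q x]] by (simp add: q)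
  then have "f x - poly q x = f 0 - poly q 0" for x
    using DERIV_isconst_all[of "\<lambda>x. f x - poly q x" x 0] by blast
  then have "f x = poly (q + [:f 0 - poly q 0:]) x" for x by (simp add: algebra_simps)
  then show ?thesis by blast
qed

lemma continuous_on_of_derivative:
  assumes "\<And>x::real. (f has_real_derivative f' x) (at x)" shows "continuous_on S f"
  by (rule DERIV_continuous_on[OF has_field_derivative_at_within[OF assms]])

text \<open>
  A twice continuously differentiable activation function that is not a polynomial, together with its
  derivatives.
\<close>

locale activation =
  fixes \<sigma> \<sigma>1 \<sigma>2 :: "real \<Rightarrow> real"
  assumes \<sigma>1: "\<And>x. (\<sigma> has_real_derivative \<sigma>1 x) (at x)"
    and \<sigma>2: "\<And>x. (\<sigma>1 has_real_derivative \<sigma>2 x) (at x)"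
    and cont: "continuous_on UNIV \<sigma>2"
    and nonpoly: "\<not> (\<exists>p :: real poly. \<sigma> = poly p)"
begin

lemma nonpoly2: "\<not> (\<exists>p :: real poly. \<sigma>2 = poly p)"
proof
  assume "\<exists>p :: real poly. \<sigma>2 = poly p"
  then obtain p where "\<sigma>2 = poly p" by blast
  then obtain q where "\<sigma>1 = poly q" using polynomial_of_derivative[of \<sigma>1 p] \<sigma>2 by auto
  then show False using polynomial_of_derivative[of \<sigma> q] \<sigma>1 nonpoly by auto
qed

lemma continuous_\<sigma>: "continuous_on S \<sigma>" and continuous_\<sigma>1: "continuous_on S \<sigma>1"
  by (rule continuous_on_of_derivative, rule \<sigma>1, rule continuous_on_of_derivative, rule \<sigma>2)

lemma has_real_derivative_net:
  assumes "\<And>x. (\<rho> has_real_derivative \<rho>' x) (at x)"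
  shows "(net \<rho> m A W B has_real_derivative net \<rho>' m (\<lambda>i. A i * W i) W B t) (at t)"
proof -
  have "((\<lambda>t. A i * \<rho> (W i * t + B i)) has_real_derivative (A i * W i) * \<rho>' (W i * t + B i)) (at t)" for i
  proof -
    have "((\<lambda>t. W i * t + B i) has_real_derivative W i) (at t)" by (auto intro!: derivative_eq_intros)
    from DERIV_cmult[OF DERIV_chain2[OF assms this], of "A i"] show ?thesis by (simp add: mult.assoc mult.commute)
  qed
  then show ?thesis unfolding net_def[abs_def] by (intro DERIV_sum)
qed

lemma continuous_net:
  assumes "continuous_on UNIV \<rho>" shows "continuous_on UNIV (net \<rho> m A W B)"
proof -
  have "continuous_on UNIV (\<lambda>t. A i * \<rho> (W i * t + B i))" for i
    by (rule continuous_on_mult[OF continuous_on_const continuous_on_compose2[OF assms]])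
      (auto intro!: continuous_intros)
  then show ?thesis unfolding net_def[abs_def] by (intro continuous_on_sum)
qed

text \<open>
  A network together with its first two derivatives.
\<close>

definition net_jet :: "(real \<Rightarrow> real) \<Rightarrow> (real \<Rightarrow> real) \<Rightarrow> (real \<Rightarrow> real) \<Rightarrow> bool" where
  "net_jet f f1 f2 \<longleftrightarrow> (\<exists>m A W B. f = net \<sigma> m A W B \<and> f1 = net \<sigma>1 m (\<lambda>i. A i * W i) W B \<and>
     f2 = net \<sigma>2 m (\<lambda>i. A i * W i * W i) W B)"

lemma net_jet_derivatives:
  assumes "net_jet f f1 f2"
  shows "(f has_real_derivative f1 t) (at t)" "(f1 has_real_derivative f2 t) (at t)" "continuous_on UNIV f2"
  using assms has_real_derivative_net[of \<sigma> \<sigma>1] has_real_derivative_net[of \<sigma>1 \<sigma>2] \<sigma>1 \<sigma>2 continuous_net[OF cont]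
  unfolding net_jet_def by auto

lemma net_jet_add:
  assumes "net_jet f f1 f2" "net_jet g g1 g2"
  shows "net_jet (\<lambda>t. f t + g t) (\<lambda>t. f1 t + g1 t) (\<lambda>t. f2 t + g2 t)"
proof -
  obtain m A W B where f: "f = net \<sigma> m A W B" "f1 = net \<sigma>1 m (\<lambda>i. A i * W i) W B"
    "f2 = net \<sigma>2 m (\<lambda>i. A i * W i * W i) W B" using assms(1) unfolding net_jet_def by blast
  obtain n A' W' B' where g: "g = net \<sigma> n A' W' B'" "g1 = net \<sigma>1 n (\<lambda>i. A' i * W' i) W' B'"
    "g2 = net \<sigma>2 n (\<lambda>i. A' i * W' i * W' i) W' B'" using assms(2) unfolding net_jet_def by blast
  let ?A = "\<lambda>i. if i < m then A i else A' (i - m)" and ?W = "\<lambda>i. if i < m then W i else W' (i - m)"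
    and ?B = "\<lambda>i. if i < m then B i else B' (i - m)"
  have 1: "(\<lambda>i. ?A i * ?W i) = (\<lambda>i. if i < m then A i * W i else A' (i - m) * W' (i - m))"
    by (rule ext) simp
  have 2: "(\<lambda>i. ?A i * ?W i * ?W i) = (\<lambda>i. if i < m then A i * W i * W i else A' (i - m) * W' (i - m) * W' (i - m))"
    by (rule ext) simp
  show ?thesis
    unfolding net_jet_def
  proof (intro exI conjI)
    show "(\<lambda>t. f t + g t) = net \<sigma> (m + n) ?A ?W ?B" unfolding f g by (rule ext) (rule net_append[symmetric])
    show "(\<lambda>t. f1 t + g1 t) = net \<sigma>1 (m + n) (\<lambda>i. ?A i * ?W i) ?W ?B"
      unfolding f g 1 by (rule ext) (rule net_append[symmetric])
    show "(\<lambda>t. f2 t + g2 t) = net \<sigma>2 (m + n) (\<lambda>i. ?A i * ?W i * ?W i) ?W ?B"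
      unfolding f g 2 by (rule ext) (rule net_append[symmetric])
  qed
qed

lemma net_jet_ridge:
  "net_jet (\<lambda>t. a * \<sigma> (w * t + b)) (\<lambda>t. a * w * \<sigma>1 (w * t + b)) (\<lambda>t. a * w * w * \<sigma>2 (w * t + b))"
  unfolding net_jet_def
  by (rule exI[of _ 1], rule exI[of _ "\<lambda>i. a"], rule exI[of _ "\<lambda>i. w"], rule exI[of _ "\<lambda>i. b"])
    (simp add: net_def fun_eq_iff)

lemma nonzero_value: assumes "continuous_on UNIV \<rho>" "\<not> (\<exists>p :: real poly. \<rho> = poly p)" shows "\<exists>b. \<rho> b \<noteq> 0"
proof (rule ccontr)
  assume "\<nexists>b. \<rho> b \<noteq> 0"
  then have "\<rho> = poly 0" by auto
  then show False using assms(2) by blast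
qed

text \<open>
  The first bound is Taylor's formula at \<open>b\<close>, with the length of the interval absorbed into \<open>M\<close>. One \<open>M\<close>
  serves all \<open>w \<le> 1\<close> because the arguments \<open>w t + b\<close> stay in a fixed compact interval.
\<close>

lemma Taylor_bounds:
  assumes T: "0 < (T::real)"
  obtains M where "0 \<le> M"
    "\<And>w t. 0 < w \<Longrightarrow> w \<le> 1 \<Longrightarrow> t \<in> {0..T} \<Longrightarrow> \<bar>\<sigma> (w * t + b) - \<sigma> b - w * t * \<sigma>1 b\<bar> \<le> M * w * w"
    "\<And>w t. 0 < w \<Longrightarrow> w \<le> 1 \<Longrightarrow> t \<in> {0..T} \<Longrightarrow> \<bar>\<sigma>2 (w * t + b)\<bar> \<le> M"
proof -
  define R where "R = T + \<bar>b\<bar>"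
  obtain M2 where M2: "0 \<le> M2" "\<And>x. x \<in> {-R..R} \<Longrightarrow> \<bar>\<sigma>2 x\<bar> \<le> M2"
    by (rule continuous_bounded_on_bounded[of "{-R..R}" \<sigma>2, OF _ cont]) auto
  define M where "M = M2 * T * T + M2"
  have M: "0 \<le> M" "M2 * T * T \<le> M" "M2 \<le> M" using M2(1) T by (auto simp: M_def)
  have all: "\<bar>\<sigma> (w * t + b) - \<sigma> b - w * t * \<sigma>1 b\<bar> \<le> M * w * w \<and> \<bar>\<sigma>2 (w * t + b)\<bar> \<le> M"
    if w: "0 < w" "w \<le> 1" and t: "t \<in> {0..T}" for w t
  proof -
    define x where "x = w * t"
    have x: "0 \<le> x" "x \<le> T" "x \<le> w * T"
      using w t mult_mono[of w 1 t T] by (auto simp: x_def mult_left_mono)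
    have inR: "y \<in> {-R..R}" if "b \<le> y" "y \<le> x + b" for y using that x by (auto simp: R_def)
    have "\<bar>\<sigma>2 (x + b)\<bar> \<le> M" using M2(2)[OF inR, of "x + b"] x M(3) by simp
    moreover have "\<bar>\<sigma> (x + b) - \<sigma> b - x * \<sigma>1 b\<bar> \<le> M * w * w"
    proof (cases "x = 0")
      case True
      then show ?thesis using M(1) w by simp
    next
      case False
      then have less: "b < x + b" using x by simp
      obtain z where z: "b < z" "z < x + b" and fz: "\<sigma> (x + b) - \<sigma> b = (x + b - b) * \<sigma>1 z"
        using MVT2[OF less, of \<sigma> \<sigma>1] \<sigma>1 by blast
      obtain y where y: "b < y" "y < z" and fy: "\<sigma>1 z - \<sigma>1 b = (z - b) * \<sigma>2 y"
        using MVT2[OF z(1), of \<sigma>1 \<sigma>2] \<sigma>2 by blast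
      have b2: "\<bar>\<sigma>2 y\<bar> \<le> M2" using M2(2)[OF inR, of y] y z by simp
      have "\<sigma> (x + b) - \<sigma> b - x * \<sigma>1 b = x * (\<sigma>1 z - \<sigma>1 b)"
        unfolding fz by (simp add: right_diff_distrib)
      then have "\<bar>\<sigma> (x + b) - \<sigma> b - x * \<sigma>1 b\<bar> = x * ((z - b) * \<bar>\<sigma>2 y\<bar>)"
        unfolding fy using x(1) z(1) by (simp add: abs_mult)
      also have "\<dots> \<le> (w * T) * ((w * T) * M2)"
        using x b2 w T z by (intro mult_mono) auto
      also have "\<dots> = (M2 * T * T) * (w * w)" by (simp add: mult.commute mult.left_commute)
      also have "\<dots> \<le> M * (w * w)" using M(2) by (intro mult_right_mono) auto
      finally show ?thesis by (simp add: mult.assoc)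
    qed
    ultimately show ?thesis unfolding x_def by blast
  qed
  show ?thesis by (rule that[OF M(1)]) (use all in blast)+
qed

text \<open>
  The linear part is approximated by \<open>c1 (\<sigma>(w t + b) - \<sigma> b) / (w \<sigma>1 b)\<close> with \<open>\<sigma>1 b \<noteq> 0\<close> and a small \<open>w\<close>. The
  second derivative is of order \<open>w\<close>, since it carries \<open>w\<^sup>2\<close> from the chain rule and \<open>1 / w\<close> from the outer
  weight. The constant part is represented exactly.
\<close>

lemma net_jet_approx_affine:
  assumes T: "0 < (T::real)" and \<epsilon>: "0 < \<epsilon>"
  shows "\<exists>f f1 f2. net_jet f f1 f2 \<and> (\<forall>t\<in>{0..T}. \<bar>f t - (c0 + c1 * t)\<bar> \<le> \<epsilon> \<and> \<bar>f2 t\<bar> \<le> \<epsilon>)"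
proof -
  have np1: "\<not> (\<exists>p :: real poly. \<sigma>1 = poly p)"
    using polynomial_of_derivative[of \<sigma>] \<sigma>1 nonpoly by auto
  obtain b0 where b0: "\<sigma> b0 \<noteq> 0" using nonzero_value[OF continuous_\<sigma> nonpoly] by blast
  obtain b where b: "\<sigma>1 b \<noteq> 0" using nonzero_value[OF continuous_\<sigma>1 np1] by blast
  obtain M where M: "0 \<le> M"
    and near: "\<And>w t. 0 < w \<Longrightarrow> w \<le> 1 \<Longrightarrow> t \<in> {0..T} \<Longrightarrow> \<bar>\<sigma> (w * t + b) - \<sigma> b - w * t * \<sigma>1 b\<bar> \<le> M * w * w"
    and small: "\<And>w t. 0 < w \<Longrightarrow> w \<le> 1 \<Longrightarrow> t \<in> {0..T} \<Longrightarrow> \<bar>\<sigma>2 (w * t + b)\<bar> \<le> M"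
    by (rule Taylor_bounds[OF T, of b]) blast
  define a where "a = c1 / \<sigma>1 b"
  define w where "w = min 1 (\<epsilon> / (\<bar>a\<bar> * M + 1))"
  have pos: "0 < \<bar>a\<bar> * M + 1" using M by (simp add: add_nonneg_pos)
  have w: "0 < w" "w \<le> 1" using pos \<epsilon> by (auto simp: w_def)
  have "w \<le> \<epsilon> / (\<bar>a\<bar> * M + 1)" by (simp add: w_def)
  then have "w * (\<bar>a\<bar> * M + 1) \<le> \<epsilon>" using pos by (simp add: pos_le_divide_eq)
  then have le: "\<bar>a\<bar> * (M * w) \<le> \<epsilon>" using w(1) by (simp add: algebra_simps)
  \<comment> \<open>the two neurons with inner weight \<open>0\<close> are constants\<close>
  let ?f = "\<lambda>t. (a / w) * \<sigma> (w * t + b) + ((- a / w) * \<sigma> (0 * t + b) + (c0 / \<sigma> b0) * \<sigma> (0 * t + b0))"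
  let ?f2 = "\<lambda>t. (a / w) * w * w * \<sigma>2 (w * t + b) +
    ((- a / w) * 0 * 0 * \<sigma>2 (0 * t + b) + (c0 / \<sigma> b0) * 0 * 0 * \<sigma>2 (0 * t + b0))"
  have "\<bar>?f t - (c0 + c1 * t)\<bar> \<le> \<epsilon> \<and> \<bar>?f2 t\<bar> \<le> \<epsilon>" if t: "t \<in> {0..T}" for t
  proof
    note B = near[OF w t] small[OF w t]
    have "?f t - (c0 + c1 * t) = (a / w) * (\<sigma> (w * t + b) - \<sigma> b - w * t * \<sigma>1 b)"
      using b b0 w(1) by (simp add: a_def right_diff_distrib)
    then have "\<bar>?f t - (c0 + c1 * t)\<bar> = (\<bar>a\<bar> / w) * \<bar>\<sigma> (w * t + b) - \<sigma> b - w * t * \<sigma>1 b\<bar>" using w(1) by (simp add: abs_mult)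
    also have "\<dots> \<le> (\<bar>a\<bar> / w) * (M * w * w)" using B w(1) by (intro mult_left_mono) auto
    also have "\<dots> = \<bar>a\<bar> * (M * w)" using w(1) by simp
    finally show "\<bar>?f t - (c0 + c1 * t)\<bar> \<le> \<epsilon>" using le by linarith
    have "\<bar>?f2 t\<bar> = \<bar>a\<bar> * (w * \<bar>\<sigma>2 (w * t + b)\<bar>)" using w(1) by (simp add: abs_mult)
    also have "\<dots> \<le> \<bar>a\<bar> * (w * M)" using B w by (intro mult_left_mono) auto
    finally show "\<bar>?f2 t\<bar> \<le> \<epsilon>" using le by (simp add: mult.commute)
  qed
  then show ?thesis
    using net_jet_add[OF net_jet_ridge[of "a / w" w b]
        net_jet_add[OF net_jet_ridge[of "- a / w" 0 b] net_jet_ridge[of "c0 / \<sigma> b0" 0 b0]]] by blast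
qed

lemma net_jet_of_nets:
  assumes "g \<in> nets \<sigma>2" shows "\<exists>f f1. net_jet f f1 g"
proof -
  obtain m A W B where W: "\<forall>i<m. W i \<noteq> 0" and g: "g = net \<sigma>2 m A W B" using assms unfolding nets_def by blast
  let ?A = "\<lambda>i. A i / (W i * W i)"
  have "g = net \<sigma>2 m (\<lambda>i. ?A i * W i * W i) W B"
    unfolding g net_def[abs_def] using W by (intro ext sum.cong) auto
  then show ?thesis unfolding net_jet_def by (intro exI conjI) (rule refl, rule refl)
qed

end

lemma is_weak_deriv_diff:
  assumes U: "bounded U" "U \<in> sets lebesgue" and e: "e \<in> Basis"
    and f: "f \<in> l2_space U" "f' \<in> l2_space U" "is_weak_deriv U e f f'"
    and g: "g \<in> l2_space U" "g' \<in> l2_space U" "is_weak_deriv U e g g'"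
  shows "is_weak_deriv U e (\<lambda>x. f x - g x) (\<lambda>x. f' x - g' x)"
  unfolding is_weak_deriv_def
proof
  fix \<phi> assume \<phi>: "\<phi> \<in> test_functions U"
  then have C1: "C1 \<phi>" by (simp add: test_functions_iff)
  have p: "partial e \<phi> \<in> l2_space U" by (rule continuous_in_l2_space[OF U C1_continuous_partial[OF C1 e]])
  have q: "\<phi> \<in> l2_space U" by (rule continuous_in_l2_space[OF U C1_continuous[OF C1]])
  show "(\<integral>x. (f x - g x) * partial e \<phi> x \<partial>lebesgue_on U) = - (\<integral>x. (f' x - g' x) * \<phi> x \<partial>lebesgue_on U)"
    using l2_inner_diff_left[OF f(1) g(1) p] l2_inner_diff_left[OF f(2) g(2) q]
      f(3)[unfolded is_weak_deriv_def, rule_format, OF \<phi>] g(3)[unfolded is_weak_deriv_def, rule_format, OF \<phi>]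
    unfolding l2_inner_def by linarith
qed

lemma H2_space_weak_derivs:
  assumes "u \<in> H2_space {0<..<T}"
  shows "u \<in> l2_space {0<..<(T::real)}" "weak_deriv {0<..<T} 1 u \<in> l2_space {0<..<T}"
    "is_weak_deriv {0<..<T} 1 u (weak_deriv {0<..<T} 1 u)"
    "weak_deriv {0<..<T} 1 (weak_deriv {0<..<T} 1 u) \<in> l2_space {0<..<T}"
    "is_weak_deriv {0<..<T} 1 (weak_deriv {0<..<T} 1 u) (weak_deriv {0<..<T} 1 (weak_deriv {0<..<T} 1 u))"
proof -
  let ?U = "{0<..<T}"
  have u: "u \<in> H1_space ?U" and v: "weak_deriv ?U 1 u \<in> H1_space ?U" using assms by (auto simp: H2_space_def)
  show "u \<in> l2_space ?U" using u by (simp add: H1_space_def)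
  have 1: "\<exists>h\<in>l2_space ?U. is_weak_deriv ?U 1 u h" using u by (simp add: H1_space_def)
  have 2: "\<exists>h\<in>l2_space ?U. is_weak_deriv ?U 1 (weak_deriv ?U 1 u) h" using v by (simp add: H1_space_def)
  show "weak_deriv ?U 1 u \<in> l2_space ?U" "is_weak_deriv ?U 1 u (weak_deriv ?U 1 u)"
    by (rule weak_deriv_properties[OF 1])+
  show "weak_deriv ?U 1 (weak_deriv ?U 1 u) \<in> l2_space ?U"
    "is_weak_deriv ?U 1 (weak_deriv ?U 1 u) (weak_deriv ?U 1 (weak_deriv ?U 1 u))"
    by (rule weak_deriv_properties[OF 2])+
qed

text \<open>
  The Poincare inequality for \<open>f1 - u'\<close> yields the slope \<open>c1\<close>; applied to \<open>f - c1 t - u\<close>, whose weak derivative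
  is \<open>f1 - c1 - u'\<close>, it yields \<open>c0\<close>.
\<close>

lemma C2_near_H2_modulo_affine:
  assumes T: "0 < (T::real)" and u: "u \<in> H2_space {0<..<T}"
    and f: "\<And>t. (f has_real_derivative f1 t) (at t)" "\<And>t. (f1 has_real_derivative f2 t) (at t)"
    and c: "continuous_on UNIV f2"
  obtains c0 c1 where "l2_norm {0<..<T} (\<lambda>t. f t - (c0 + c1 * t) - u t) \<le>
    T * (T * l2_norm {0<..<T} (\<lambda>t. f2 t - weak_deriv {0<..<T} 1 (weak_deriv {0<..<T} 1 u) t))"
proof -
  let ?U = "{0<..<T}" let ?v1 = "weak_deriv ?U 1 u" let ?v2 = "weak_deriv ?U 1 ?v1"
  note w = H2_space_weak_derivs[OF u]
  have U: "bounded ?U" "?U \<in> sets lebesgue" and one: "(1::real) \<in> Basis" by auto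
  have cl: "h \<in> l2_space ?U" if "continuous_on UNIV h" for h by (rule continuous_in_l2_space[OF U that])
  have wd: "is_weak_deriv ?U 1 h h'" if "\<And>t. (h has_real_derivative h' t) (at t)" "continuous_on UNIV h'" for h h'
  proof -
    have "partial 1 h = h'" using C1_real(2)[OF that] by (rule ext)
    then show ?thesis using C1_is_weak_deriv[OF C1_real(1)[OF that] U(2) one] by simp
  qed
  have c1': "continuous_on UNIV f1" by (rule DERIV_continuous_on) (rule f(2))
  have c0': "continuous_on UNIV f" by (rule DERIV_continuous_on) (rule f(1))
  have "is_weak_deriv ?U 1 (\<lambda>t. f1 t - ?v1 t) (\<lambda>t. f2 t - ?v2 t)"
    by (rule is_weak_deriv_diff[OF U one cl[OF c1'] cl[OF c] wd[OF f(2) c] w(2,4,5)])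
  then obtain c1 where c1: "l2_norm ?U (\<lambda>t. f1 t - ?v1 t - c1) \<le> T * l2_norm ?U (\<lambda>t. f2 t - ?v2 t)"
    using weak_Poincare[OF T l2_space_diff[OF cl[OF c1'] w(2)] l2_space_diff[OF cl[OF c] w(4)]] by blast
  have g: "((\<lambda>t. f t - c1 * t) has_real_derivative f1 t - c1) (at t)" for t
    using f(1) by (auto intro!: derivative_eq_intros)
  have gc1: "continuous_on UNIV (\<lambda>t. f1 t - c1)" by (intro continuous_intros c1')
  have gc0: "continuous_on UNIV (\<lambda>t. f t - c1 * t)" by (intro continuous_intros c0')
  have "is_weak_deriv ?U 1 (\<lambda>t. (f t - c1 * t) - u t) (\<lambda>t. (f1 t - c1) - ?v1 t)"
    by (rule is_weak_deriv_diff[OF U one cl[OF gc0] cl[OF gc1] wd[OF g gc1] w(1,2,3)])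
  then obtain c0 where c0: "l2_norm ?U (\<lambda>t. (f t - c1 * t) - u t - c0) \<le> T * l2_norm ?U (\<lambda>t. (f1 t - c1) - ?v1 t)"
    using weak_Poincare[OF T l2_space_diff[OF cl[OF gc0] w(1)] l2_space_diff[OF cl[OF gc1] w(2)]] by blast
  have "(\<lambda>t. (f t - c1 * t) - u t - c0) = (\<lambda>t. f t - (c0 + c1 * t) - u t)"
    "(\<lambda>t. (f1 t - c1) - ?v1 t) = (\<lambda>t. f1 t - ?v1 t - c1)" by (rule ext, simp)+
  then have "l2_norm ?U (\<lambda>t. f t - (c0 + c1 * t) - u t) \<le> T * l2_norm ?U (\<lambda>t. f1 t - ?v1 t - c1)"
    using c0 by simp
  also have "\<dots> \<le> T * (T * l2_norm ?U (\<lambda>t. f2 t - ?v2 t))" using c1 T by (intro mult_left_mono) auto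
  finally show ?thesis using that by blast
qed

lemma l2_norm_le_sup_Ioo:
  assumes T: "0 < (T::real)" and c: "continuous_on UNIV f" and le: "\<And>t. t \<in> {0..T} \<Longrightarrow> \<bar>f t\<bar> \<le> B" and B: "0 \<le> B"
  shows "l2_norm {0<..<T} f \<le> B * sqrt T"
proof -
  have "l2_norm {0<..<T} f \<le> B * sqrt (measure lebesgue {0<..<T})"
    by (rule l2_bounded(2)[OF _ continuous_measurable_lebesgue_on[OF c] _ B]) (use le in auto)
  then show ?thesis using T by simp
qed

text \<open>
  The second derivative is approximated first, by way of a continuous function. The first network is then
  off from \<open>u\<close> by an affine function, up to a small error, and a second network cancels that function
  with little effect on the second derivative.
\<close>

lemma (in activation) nets_dense_H2:
  assumes T: "0 < (T::real)" and u: "u \<in> H2_space {0<..<T}" and \<epsilon>: "0 < \<epsilon>"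
  shows "\<exists>f f1 f2. net_jet f f1 f2 \<and> l2_norm {0<..<T} (\<lambda>t. f t - u t) < \<epsilon> \<and>
    l2_norm {0<..<T} (\<lambda>t. f2 t - weak_deriv {0<..<T} 1 (weak_deriv {0<..<T} 1 u) t) < \<epsilon>"
proof -
  let ?U = "{0<..<T}" let ?v2 = "weak_deriv ?U 1 (weak_deriv ?U 1 u)"
  note w = H2_space_weak_derivs[OF u]
  have cl: "h \<in> l2_space ?U" if "continuous_on UNIV h" for h by (rule continuous_in_l2_space[OF _ _ that]) auto
  \<comment> \<open>\<open>\<eta>\<close> bounds \<open>L\<^sup>2\<close> errors and \<open>\<kappa>\<close> uniform ones; a uniform error \<open>\<kappa>\<close> has \<open>L\<^sup>2\<close> norm at most \<open>\<eta>\<close>\<close>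
  define \<eta> where "\<eta> = \<epsilon> / (4 * (1 + T * T + sqrt T))"
  have S: "0 < 1 + T * T + sqrt T" using T by (intro add_pos_pos) auto
  have \<eta>: "0 < \<eta>" using \<epsilon> S by (simp add: \<eta>_def)
  have \<eta>e: "4 * \<eta> + 4 * (\<eta> * (T * T)) + 4 * (\<eta> * sqrt T) = \<epsilon>"
  proof -
    have "\<eta> * (4 * (1 + T * T + sqrt T)) = \<epsilon>" using S by (simp add: \<eta>_def)
    then show ?thesis by (simp add: algebra_simps)
  qed
  have pos: "0 \<le> \<eta> * (T * T)" "0 \<le> \<eta> * sqrt T" using \<eta> T by simp_all
  define \<kappa> where "\<kappa> = \<eta> / sqrt T"
  have \<kappa>: "0 < \<kappa>" "\<kappa> * sqrt T = \<eta>" using \<eta> T by (simp_all add: \<kappa>_def)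
  have ne: "box 0 T \<noteq> {}" and box: "?U = box 0 T" using T by (auto simp: box_real)
  obtain q where q: "continuous_on UNIV q" "l2_norm ?U (\<lambda>t. ?v2 t - q t) < \<eta>"
    using l2_dense_continuous_compact_support[OF ne, folded box, OF w(4) \<eta>] by blast
  obtain g where g: "g \<in> nets \<sigma>2" "\<And>t. t \<in> {0..T} \<Longrightarrow> \<bar>q t - g t\<bar> < \<kappa>"
    using nonpolynomial_nets_dense[OF T cont nonpoly2 continuous_on_subset[OF q(1) subset_UNIV]] \<kappa>(1)
    unfolding approximable_def by blast
  obtain f f1 where f: "net_jet f f1 g" using net_jet_of_nets[OF g(1)] by blast
  note fd = net_jet_derivatives[OF f]
  have "l2_norm ?U (\<lambda>t. g t - q t) \<le> \<kappa> * sqrt T"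
    by (rule l2_norm_le_sup_Ioo[OF T]) (use fd(3) q(1) g(2) \<kappa>(1) in
      \<open>auto intro!: continuous_on_diff simp: abs_minus_commute less_imp_le\<close>)
  then have r: "l2_norm ?U (\<lambda>t. g t - ?v2 t) < 2 * \<eta>"
    using l2_norm_triangle_diff[OF cl[OF fd(3)] cl[OF q(1)] w(4)] q(2) \<kappa>(2)
      l2_norm_minus_commute[of ?U q ?v2] by linarith
  obtain c0 c1 where c: "l2_norm ?U (\<lambda>t. f t - (c0 + c1 * t) - u t) \<le> T * (T * l2_norm ?U (\<lambda>t. g t - ?v2 t))"
    using C2_near_H2_modulo_affine[OF T u fd] by blast
  obtain p p1 p2 where p: "net_jet p p1 p2" "\<And>t. t \<in> {0..T} \<Longrightarrow> \<bar>p t - (- c0 + - c1 * t)\<bar> \<le> \<kappa> \<and> \<bar>p2 t\<bar> \<le> \<kappa>"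
    using net_jet_approx_affine[OF T \<kappa>(1)] by blast
  let ?f = "\<lambda>t. f t + p t" and ?f1 = "\<lambda>t. f1 t + p1 t" and ?f2 = "\<lambda>t. g t + p2 t"
  have jet: "net_jet ?f ?f1 ?f2" by (rule net_jet_add[OF f p(1)])
  note pd = net_jet_derivatives[OF p(1)]
  have cf: "continuous_on UNIV f" "continuous_on UNIV p"
    by (rule continuous_on_of_derivative, rule fd(1), rule continuous_on_of_derivative, rule pd(1))
  have cp: "continuous_on UNIV (\<lambda>t. p t - (- c0 + - c1 * t))" by (intro continuous_intros cf)
  have "l2_norm ?U (\<lambda>t. p t - (- c0 + - c1 * t)) \<le> \<kappa> * sqrt T"
    by (rule l2_norm_le_sup_Ioo[OF T cp]) (use p(2) \<kappa>(1) in auto)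
  then have aff: "l2_norm ?U (\<lambda>t. p t - (- c0 + - c1 * t)) \<le> \<eta>" using \<kappa>(2) by simp
  have "l2_norm ?U p2 \<le> \<kappa> * sqrt T"
    by (rule l2_norm_le_sup_Ioo[OF T pd(3)]) (use p(2) \<kappa>(1) in auto)
  then have aff2: "l2_norm ?U p2 \<le> \<eta>" using \<kappa>(2) by simp
  have "l2_norm ?U (\<lambda>t. ?f2 t - ?v2 t) = l2_norm ?U (\<lambda>t. (g t - ?v2 t) + p2 t)"
    by (rule arg_cong[where f = "l2_norm ?U"], rule ext) simp
  also have "\<dots> \<le> l2_norm ?U (\<lambda>t. g t - ?v2 t) + l2_norm ?U p2"
    by (rule l2_norm_triangle[OF l2_space_diff[OF cl[OF fd(3)] w(4)] cl[OF pd(3)]])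
  also have "\<dots> < \<epsilon>" using r aff2 \<eta>e pos \<eta> by linarith
  finally have e2: "l2_norm ?U (\<lambda>t. ?f2 t - ?v2 t) < \<epsilon>" .
  have cr: "continuous_on UNIV (\<lambda>t. f t - (c0 + c1 * t))" by (intro continuous_intros cf)
  have "l2_norm ?U (\<lambda>t. ?f t - u t) =
      l2_norm ?U (\<lambda>t. (f t - (c0 + c1 * t) - u t) + (p t - (- c0 + - c1 * t)))"
    by (rule arg_cong[where f = "l2_norm ?U"], rule ext) simp
  also have "\<dots> \<le> l2_norm ?U (\<lambda>t. f t - (c0 + c1 * t) - u t) + l2_norm ?U (\<lambda>t. p t - (- c0 + - c1 * t))"
    by (rule l2_norm_triangle[OF l2_space_diff[OF cl[OF cr] w(1)] cl[OF cp]])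
  also have "\<dots> \<le> 2 * (\<eta> * (T * T)) + \<eta>"
  proof -
    have "T * (T * l2_norm ?U (\<lambda>t. g t - ?v2 t)) \<le> T * (T * (2 * \<eta>))"
      using r T by (intro mult_left_mono) auto
    then show ?thesis using c aff by (simp add: mult.commute mult.left_commute)
  qed
  also have "\<dots> < \<epsilon>" using \<eta>e pos \<eta> by linarith
  finally have e0: "l2_norm ?U (\<lambda>t. ?f t - u t) < \<epsilon>" .
  show ?thesis using jet e0 e2 by blast
qed

section \<open>The Galerkin residual\<close>

lemma H10_norm_nonneg: "0 \<le> \<alpha> \<Longrightarrow> 0 \<le> H10_norm U \<alpha> u"
  unfolding H10_norm_def H10_inner_def
  by (rule real_sqrt_ge_zero, rule Bochner_Integration.integral_nonneg)
    (simp add: sum_nonneg mult.assoc)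

text \<open>
  The Cauchy-Schwarz inequality, the Lipschitz bound of \<open>g\<close> and the norm bound for combinations of
  eigenfunctions, applied to the combination with coefficients \<open>d - d'\<close>.
\<close>

lemma galerkin_nonlinearity_Lipschitz:
  fixes g :: "real \<Rightarrow> real"
  assumes \<alpha>: "0 \<le> \<alpha>" and I: "finite I"
    and maps: "\<And>u. u \<in> H10_space (cube :: (real^'n::{finite,linorder}) set) \<Longrightarrow> g \<circ> u \<in> l2_space cube"
    and Lip: "\<And>u v. u \<in> H10_space (cube :: (real^'n::{finite,linorder}) set) \<Longrightarrow> v \<in> H10_space cube \<Longrightarrow>
          l2_norm cube ((g \<circ> u) - (g \<circ> v)) \<le> L * H10_norm cube \<alpha> (u - v)"
  shows "\<exists>K\<ge>0. \<forall>d d'. \<bar>l2_inner (cube :: (real^'n::{finite,linorder}) set) (g \<circ> (\<lambda>x. \<Sum>l\<in>I. d l * eigfun l x)) (eigfun j) -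
    l2_inner (cube :: (real^'n::{finite,linorder}) set) (g \<circ> (\<lambda>x. \<Sum>l\<in>I. d' l * eigfun l x)) (eigfun j)\<bar> \<le> K * (\<Sum>l\<in>I. \<bar>d l - d' l\<bar>)"
proof -
  let ?C = "cube :: (real, 'n) vec set"
  let ?u = "\<lambda>d. (\<lambda>x::(real, 'n) vec. \<Sum>l\<in>I. d l * eigfun l x)"
  let ?E = "l2_norm ?C (eigfun j)"
  obtain H where H: "0 \<le> H" "\<And>d. H10_norm ?C \<alpha> (?u d) \<le> H * (\<Sum>l\<in>I. \<bar>d l\<bar>)"
    using H10_norm_eigfun_combination_le[OF \<alpha> I] by blast
  have bound: "\<bar>l2_inner ?C (g \<circ> ?u d) (eigfun j) - l2_inner ?C (g \<circ> ?u d') (eigfun j)\<bar>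
      \<le> (\<bar>L\<bar> * H * ?E) * (\<Sum>l\<in>I. \<bar>d l - d' l\<bar>)" for d d'
  proof -
    have in1: "?u d \<in> H10_space ?C" and in2: "?u d' \<in> H10_space ?C"
      by (rule eigfun_combination_in_H10)+
    have diff: "?u d - ?u d' = ?u (\<lambda>l. d l - d' l)"
      by (rule ext) (simp add: sum_subtractf left_diff_distrib)
    have gdiff: "(g \<circ> ?u d) - (g \<circ> ?u d') = (\<lambda>x. (g \<circ> ?u d) x - (g \<circ> ?u d') x)"
      by (rule ext) simp
    have "\<bar>l2_inner ?C (g \<circ> ?u d) (eigfun j) - l2_inner ?C (g \<circ> ?u d') (eigfun j)\<bar> =
        \<bar>l2_inner ?C (\<lambda>x. (g \<circ> ?u d) x - (g \<circ> ?u d') x) (eigfun j)\<bar>"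
      using l2_inner_diff_left[OF maps[OF in1] maps[OF in2] eigfun_in_l2_space[of j]] by simp
    also have "\<dots> \<le> l2_norm ?C (\<lambda>x. (g \<circ> ?u d) x - (g \<circ> ?u d') x) * ?E"
      by (rule l2_inner_Cauchy_Schwarz[OF l2_space_diff[OF maps[OF in1] maps[OF in2]] eigfun_in_l2_space])
    also have "\<dots> \<le> (\<bar>L\<bar> * (H * (\<Sum>l\<in>I. \<bar>d l - d' l\<bar>))) * ?E"
    proof (rule mult_right_mono)
      have "l2_norm ?C (\<lambda>x. (g \<circ> ?u d) x - (g \<circ> ?u d') x) \<le> L * H10_norm ?C \<alpha> (?u (\<lambda>l. d l - d' l))"
        using Lip[OF in1 in2] unfolding gdiff diff .
      also have "\<dots> \<le> \<bar>L\<bar> * H10_norm ?C \<alpha> (?u (\<lambda>l. d l - d' l))"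
        by (rule mult_right_mono) (use H10_norm_nonneg[OF \<alpha>] in auto)
      also have "\<dots> \<le> \<bar>L\<bar> * (H * (\<Sum>l\<in>I. \<bar>d l - d' l\<bar>))"
        by (rule mult_left_mono[OF H(2)]) simp
      finally show "l2_norm ?C (\<lambda>x. (g \<circ> ?u d) x - (g \<circ> ?u d') x) \<le> \<bar>L\<bar> * (H * (\<Sum>l\<in>I. \<bar>d l - d' l\<bar>))" .
    qed simp
    finally show ?thesis by (simp add: mult.commute mult.left_commute)
  qed
  show ?thesis
  proof (intro exI[of _ "\<bar>L\<bar> * H * ?E"] conjI allI)
    show "0 \<le> \<bar>L\<bar> * H * ?E" using H(1) by simp
  qed (rule bound)
qed

lemma continuous_of_Lipschitz_in_coefficients:
  fixes a :: "nat \<Rightarrow> real \<Rightarrow> real"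
  assumes Lip: "\<And>d d'. \<bar>\<Gamma> d - \<Gamma> d'\<bar> \<le> K * (\<Sum>l\<in>I. \<bar>d l - d' l\<bar>)"
    and a: "\<And>l. l \<in> I \<Longrightarrow> continuous_on UNIV (a l)"
  shows "continuous_on UNIV (\<lambda>t. \<Gamma> (\<lambda>l. a l t) :: real)"
  unfolding continuous_on_def
proof
  fix t
  have "((\<lambda>s. K * (\<Sum>l\<in>I. \<bar>a l s - a l t\<bar>)) \<longlongrightarrow> K * (\<Sum>l\<in>I. \<bar>a l t - a l t\<bar>)) (at t)"
    using a by (intro tendsto_intros) (auto simp: continuous_on_def)
  then have lim: "((\<lambda>s. K * (\<Sum>l\<in>I. \<bar>a l s - a l t\<bar>)) \<longlongrightarrow> 0) (at t)" by simp
  have "((\<lambda>s. \<Gamma> (\<lambda>l. a l s) - \<Gamma> (\<lambda>l. a l t)) \<longlongrightarrow> 0) (at t)"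
  proof (rule tendsto_0_le[OF lim, where K = 1])
    show "\<forall>\<^sub>F s in at t. norm (\<Gamma> (\<lambda>l. a l s) - \<Gamma> (\<lambda>l. a l t)) \<le> norm (K * (\<Sum>l\<in>I. \<bar>a l s - a l t\<bar>)) * 1"
    proof (intro always_eventually allI)
      fix s
      show "norm (\<Gamma> (\<lambda>l. a l s) - \<Gamma> (\<lambda>l. a l t)) \<le> norm (K * (\<Sum>l\<in>I. \<bar>a l s - a l t\<bar>)) * 1"
        using Lip[of "\<lambda>l. a l s" "\<lambda>l. a l t"] unfolding real_norm_def by linarith
    qed
  qed
  then show "((\<lambda>t. \<Gamma> (\<lambda>l. a l t)) \<longlongrightarrow> \<Gamma> (\<lambda>l. a l t)) (at t within UNIV)"
    by (simp add: LIM_zero_iff)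
qed

text \<open>
  Neurons with outer weight \<open>0\<close> bring several networks to a common width.
\<close>

lemma net_pad:
  "m \<le> M \<Longrightarrow> net \<sigma> M (\<lambda>i. if i < m then A i else 0) W B = net \<sigma> m A W B"
proof (rule ext)
  fix t assume "m \<le> M"
  then show "net \<sigma> M (\<lambda>i. if i < m then A i else 0) W B t = net \<sigma> m A W B t"
    unfolding net_def by (intro sum.mono_neutral_cong_right) auto
qed

lemma abs_in_l2_space:
  assumes "f \<in> l2_space U" shows "(\<lambda>x. \<bar>f x\<bar>) \<in> l2_space U" "l2_norm U (\<lambda>x. \<bar>f x\<bar>) = l2_norm U f"
  using assms by (auto simp: l2_space_def l2_norm_def l2_inner_def)

lemma residual_l2_norm_le:
  fixes r p :: "nat \<Rightarrow> real \<Rightarrow> real"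
  assumes R: "R \<in> borel_measurable (lebesgue_on U)"
    and r: "r j \<in> l2_space U" "l2_norm U (r j) \<le> \<delta>"
    and p: "\<And>l. l \<in> I \<Longrightarrow> p l \<in> l2_space U" "\<And>l. l \<in> I \<Longrightarrow> l2_norm U (p l) \<le> \<delta>"
    and j: "j \<in> I" and K: "0 \<le> K"
    and le: "AE t in lebesgue_on U. \<bar>R t\<bar> \<le> \<bar>r j t\<bar> + \<bar>\<mu>\<bar> * \<bar>p j t\<bar> + K * (\<Sum>l\<in>I. \<bar>p l t\<bar>)"
  shows "l2_norm U R \<le> (1 + \<bar>\<mu>\<bar> + K * card I) * \<delta>"
proof -
  let ?S = "\<lambda>t. \<Sum>l\<in>I. \<bar>p l t\<bar>"
  have S: "?S \<in> l2_space U" by (rule l2_space_sum) (rule abs_in_l2_space(1)[OF p(1)])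
  have "l2_norm U ?S \<le> (\<Sum>l\<in>I. l2_norm U (\<lambda>t. \<bar>p l t\<bar>))" by (rule l2_norm_sum) (rule abs_in_l2_space(1)[OF p(1)])
  also have "\<dots> \<le> of_nat (card I) * \<delta>"
    by (rule sum_bounded_above) (simp add: abs_in_l2_space(2)[OF p(1)] p(2))
  finally have Sle: "l2_norm U ?S \<le> of_nat (card I) * \<delta>" .
  have q: "(\<lambda>t. \<bar>\<mu>\<bar> * \<bar>p j t\<bar>) \<in> l2_space U" by (rule l2_space_cmult[OF abs_in_l2_space(1)[OF p(1)[OF j]]])
  have qle: "l2_norm U (\<lambda>t. \<bar>\<mu>\<bar> * \<bar>p j t\<bar>) \<le> \<bar>\<mu>\<bar> * \<delta>"
    unfolding l2_norm_cmult abs_in_l2_space(2)[OF p(1)[OF j]] using p(2)[OF j] by (simp add: mult_left_mono)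
  have KS: "(\<lambda>t. K * ?S t) \<in> l2_space U" by (rule l2_space_cmult[OF S])
  have KSle: "l2_norm U (\<lambda>t. K * ?S t) \<le> K * (of_nat (card I) * \<delta>)"
    unfolding l2_norm_cmult using Sle K by (simp add: mult_left_mono)
  have rq: "(\<lambda>t. \<bar>r j t\<bar> + \<bar>\<mu>\<bar> * \<bar>p j t\<bar>) \<in> l2_space U" by (rule l2_space_add[OF abs_in_l2_space(1)[OF r(1)] q])
  let ?h = "\<lambda>t. \<bar>r j t\<bar> + \<bar>\<mu>\<bar> * \<bar>p j t\<bar> + K * ?S t"
  have h: "?h \<in> l2_space U" by (rule l2_space_add[OF rq KS])
  have "AE t in lebesgue_on U. \<bar>R t\<bar> \<le> \<bar>?h t\<bar>"
    using le by eventually_elim linarith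
  then have "l2_norm U R \<le> l2_norm U ?h" by (rule l2_norm_mono_AE(2)[OF R h])
  also have "\<dots> \<le> l2_norm U (\<lambda>t. \<bar>r j t\<bar> + \<bar>\<mu>\<bar> * \<bar>p j t\<bar>) + l2_norm U (\<lambda>t. K * ?S t)"
    by (rule l2_norm_triangle[OF rq KS])
  also have "\<dots> \<le> (\<delta> + \<bar>\<mu>\<bar> * \<delta>) + K * (of_nat (card I) * \<delta>)"
    using l2_norm_triangle[OF abs_in_l2_space(1)[OF r(1)] q] r(2) qle KSle
    unfolding abs_in_l2_space(2)[OF r(1)] by linarith
  also have "\<dots> = (1 + \<bar>\<mu>\<bar> + K * card I) * \<delta>" by (simp add: algebra_simps)
  finally show ?thesis .
qed

theorem theorem13:
  fixes \<omega> :: "(real^'n::{finite,linorder}) set"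
    and T \<alpha> Lg \<epsilon>c :: real
    and \<Phi>0 \<Phi>T :: "'n state"
    and G :: "'n state \<Rightarrow> 'n state"
    and f :: "real \<Rightarrow> real^'n::{finite,linorder} \<Rightarrow> real"
    and g \<sigma> :: "real \<Rightarrow> real"
    and P Pc mc :: nat
    and Ac Wc Bc :: "nat \<Rightarrow> nat \<Rightarrow> real"
    and c as :: "nat \<Rightarrow> real \<Rightarrow> real"
  assumes omega: "open \<omega>" "\<omega> \<noteq> {}" "\<omega> \<subseteq> cube"
    and T: "0 < T"
    and alpha: "0 \<le> \<alpha>"
    and gcc: "geometric_control \<omega> T"
    and data: "\<Phi>0 \<in> energy_space" "\<Phi>T \<in> energy_space"
    and f_L2: "(\<lambda>(t, x). f t x) \<in> l2_space ({0<..<T} \<times> \<omega>)"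
    and control: "exact_control \<alpha> \<omega> T G \<Phi>0 \<Phi>T (\<lambda>t. (\<lambda>x. 0, f t))"
    and sigma: "C2_function \<sigma>" "\<not> (\<exists>p :: real poly. \<sigma> = poly p)"
    and G: "\<And>\<Phi>. \<Phi> \<in> energy_space \<Longrightarrow> G \<Phi> = (\<lambda>x. 0, g \<circ> fst \<Phi>)"
    and g_maps: "\<And>u. u \<in> H10_space (cube :: (real^'n::{finite,linorder}) set) \<Longrightarrow> g \<circ> u \<in> l2_space cube"
    and g_Lipschitz: "\<And>u v. u \<in> H10_space (cube :: (real^'n::{finite,linorder}) set) \<Longrightarrow> v \<in> H10_space cube \<Longrightarrow>
          l2_norm cube ((g \<circ> u) - (g \<circ> v)) \<le> Lg * H10_norm cube \<alpha> (u - v)"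
    and P: "1 \<le> P"
    and c_def: "c = control_coeff \<sigma> Pc mc Ac Wc Bc"
    and eps_c: "0 < \<epsilon>c"
    and control_approx: "energy_L2_norm \<alpha> T (\<lambda>t. localize \<omega> (\<lambda>x. 0, neural_control Pc c t)
          - localize \<omega> (\<lambda>x. 0, f t)) < \<epsilon>c"
    and galerkin_reg: "\<And>j. j \<in> {1..P} \<Longrightarrow> as j \<in> H2_space {0<..<T}"
    and galerkin_sol: "\<And>j. j \<in> {1..P} \<Longrightarrow> AE t in lebesgue_on {0<..<T}.
          galerkin_lhs \<alpha> \<omega> g P c as
            (\<lambda>l. weak_deriv {0<..<T} 1 (weak_deriv {0<..<T} 1 (as l))) j t = 0"
  shows "\<forall>\<epsilon>>0. \<exists>ma\<ge>1. \<exists>Aa Wa Ba :: nat \<Rightarrow> nat \<Rightarrow> real.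
    let a = (\<lambda>j. net \<sigma> ma (Aa j) (Wa j) (Ba j));
        R = galerkin_lhs \<alpha> \<omega> g P c a (\<lambda>l. deriv (deriv (a l)))
    in (\<forall>j\<in>{1..P}. R j \<in> l2_space {0<..<T}) \<and>
       (\<Sum>j=1..P. (l2_norm {0<..<T} (R j))\<^sup>2) < \<epsilon>"
proof (intro allI impI)
  fix \<epsilon> :: real assume \<epsilon>: "0 < \<epsilon>"
  let ?U = "{0<..<T}" and ?I = "{1..P}" and ?C = "cube :: (real, 'n) vec set"
  obtain \<sigma>1 \<sigma>2 where "\<And>x. (\<sigma> has_real_derivative \<sigma>1 x) (at x)"
    "\<And>x. (\<sigma>1 has_real_derivative \<sigma>2 x) (at x)" "continuous_on UNIV \<sigma>2"
    using sigma(1) unfolding C2_function_def by blast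
  then interpret activation \<sigma> \<sigma>1 \<sigma>2 using sigma(2) by unfold_locales auto
  define \<Gamma> where "\<Gamma> j d = l2_inner ?C (g \<circ> (\<lambda>x. \<Sum>l\<in>?I. d l * eigfun l x)) (eigfun j)" for j and d :: "nat \<Rightarrow> real"
  have "\<exists>K\<ge>0. \<forall>d d'. \<bar>\<Gamma> j d - \<Gamma> j d'\<bar> \<le> K * (\<Sum>l\<in>?I. \<bar>d l - d' l\<bar>)" for j
    unfolding \<Gamma>_def by (rule galerkin_nonlinearity_Lipschitz[OF alpha _ g_maps g_Lipschitz]) simp_all
  then obtain K where K: "\<And>j. 0 \<le> K j" "\<And>j d d'. \<bar>\<Gamma> j d - \<Gamma> j d'\<bar> \<le> K j * (\<Sum>l\<in>?I. \<bar>d l - d' l\<bar>)" by metis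
  define \<mu> where "\<mu> j = eigval TYPE('n) j + \<alpha>" for j
  \<comment> \<open>an error \<open>\<delta>\<close> of all networks leads to a residual of norm at most \<open>D j * \<delta>\<close>\<close>
  define D where "D j = 1 + \<bar>\<mu> j\<bar> + K j * card ?I" for j
  define S where "S = (\<Sum>j\<in>?I. (D j)\<^sup>2)"
  have S: "0 \<le> S" by (simp add: S_def sum_nonneg)
  define \<delta> where "\<delta> = min 1 (\<epsilon> / (S + 1))"
  have \<delta>: "0 < \<delta>" "\<delta> \<le> 1" using \<epsilon> S by (auto simp: \<delta>_def)
  have "\<delta> * (S + 1) \<le> \<epsilon>"
  proof -
    have "\<delta> \<le> \<epsilon> / (S + 1)" by (simp add: \<delta>_def)
    then show ?thesis using S by (simp add: pos_le_divide_eq)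
  qed
  then have \<delta>S: "\<delta> * S < \<epsilon>" using \<delta>(1) by (simp add: distrib_left)
  let ?v2 = "\<lambda>l. weak_deriv ?U 1 (weak_deriv ?U 1 (as l))"
  have "\<forall>l\<in>?I. \<exists>f f1 f2. net_jet f f1 f2 \<and> l2_norm ?U (\<lambda>t. f t - as l t) < \<delta> \<and> l2_norm ?U (\<lambda>t. f2 t - ?v2 l t) < \<delta>"
    using nets_dense_H2[OF T galerkin_reg \<delta>(1)] by blast
  then obtain f f1 f2 where jet: "\<And>l. l \<in> ?I \<Longrightarrow> net_jet (f l) (f1 l) (f2 l)"
    and near: "\<And>l. l \<in> ?I \<Longrightarrow> l2_norm ?U (\<lambda>t. f l t - as l t) < \<delta>"
    and near2: "\<And>l. l \<in> ?I \<Longrightarrow> l2_norm ?U (\<lambda>t. f2 l t - ?v2 l t) < \<delta>"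
    unfolding bchoice_iff by blast
  have "\<forall>l\<in>?I. \<exists>m A W B. f l = net \<sigma> m A W B" using jet unfolding net_jet_def by blast
  then obtain m A W B where net: "\<And>l. l \<in> ?I \<Longrightarrow> f l = net \<sigma> (m l) (A l) (W l) (B l)"
    unfolding bchoice_iff by blast
  \<comment> \<open>a common width, at least \<open>1\<close>\<close>
  define M where "M = Suc (\<Sum>l\<in>?I. m l)"
  define A' where "A' l = (\<lambda>i. if i < m l then A l i else 0)" for l
  define a where "a = (\<lambda>l. net \<sigma> M (A' l) (W l) (B l))"
  have a_eq: "a l = f l" if l: "l \<in> ?I" for l
  proof -
    have "m l \<le> (\<Sum>l\<in>?I. m l)" by (rule member_le_sum[OF l]) auto
    then have "m l \<le> M" by (simp add: M_def)
    then show ?thesis unfolding a_def A'_def net[OF l] by (rule net_pad)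
  qed
  have dd: "deriv (deriv (a l)) = f2 l" if l: "l \<in> ?I" for l
  proof -
    have "deriv (f l) = f1 l" using DERIV_imp_deriv[OF net_jet_derivatives(1)[OF jet[OF l]]] by blast
    moreover have "deriv (f1 l) = f2 l" using DERIV_imp_deriv[OF net_jet_derivatives(2)[OF jet[OF l]]] by blast
    ultimately show ?thesis by (simp add: a_eq[OF l])
  qed
  define R where "R = galerkin_lhs \<alpha> \<omega> g P c a (\<lambda>l. deriv (deriv (a l)))"
  define c0 where "c0 j t = (\<Sum>l=1..P. M_coeff \<omega> j l * c l t)" for j t
  have R_eq: "R j t = f2 j t + \<mu> j * f j t + \<Gamma> j (\<lambda>l. f l t) + c0 j t" if j: "j \<in> ?I" for j t
  proof -
    have "(\<lambda>x::(real, 'n) vec. \<Sum>l = 1..P. a l t * eigfun l x) = (\<lambda>x. \<Sum>l = 1..P. f l t * eigfun l x)"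
      by (intro ext sum.cong refl) (simp add: a_eq)
    then show ?thesis
      unfolding R_def galerkin_lhs_def dd[OF j] \<mu>_def \<Gamma>_def c0_def by (simp add: a_eq[OF j])
  qed
  have fc: "continuous_on UNIV (f l)" if l: "l \<in> ?I" for l
    by (rule continuous_on_of_derivative[OF net_jet_derivatives(1)[OF jet[OF l]]])
  have cc: "continuous_on UNIV (c l)" for l
  proof (cases "l \<le> Pc")
    case True
    then have "c l = net \<sigma> mc (Ac l) (Wc l) (Bc l)" unfolding c_def control_coeff_def by (intro ext) simp
    then show ?thesis using continuous_net[OF continuous_\<sigma>] by simp
  next
    case False
    then have "c l = (\<lambda>t. 0)" unfolding c_def control_coeff_def by (intro ext) simp
    then show ?thesis by simp
  qed
  have Rc: "continuous_on UNIV (R j)" if j: "j \<in> ?I" for j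
  proof -
    have "continuous_on UNIV (\<lambda>t. \<Gamma> j (\<lambda>l. f l t))"
      by (rule continuous_of_Lipschitz_in_coefficients[OF K(2) fc])
    then have "continuous_on UNIV (\<lambda>t. f2 j t + \<mu> j * f j t + \<Gamma> j (\<lambda>l. f l t) + c0 j t)"
      unfolding c0_def by (intro continuous_on_add continuous_on_mult continuous_on_const continuous_on_sum
          net_jet_derivatives(3)[OF jet[OF j]] fc[OF j] cc)
    then show ?thesis unfolding R_eq[OF j, abs_def, symmetric] .
  qed
  have cl: "h \<in> l2_space ?U" if "continuous_on UNIV h" for h by (rule continuous_in_l2_space[OF _ _ that]) auto
  have R_le: "l2_norm ?U (R j) \<le> D j * \<delta>" if j: "j \<in> ?I" for j
    unfolding D_def
  proof (rule residual_l2_norm_le[where r = "\<lambda>j t. f2 j t - ?v2 j t" and p = "\<lambda>l t. f l t - as l t"])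
    show "R j \<in> borel_measurable (lebesgue_on ?U)" by (rule continuous_measurable_lebesgue_on[OF Rc[OF j]])
    show "(\<lambda>t. f2 j t - ?v2 j t) \<in> l2_space ?U"
      by (rule l2_space_diff[OF cl[OF net_jet_derivatives(3)[OF jet[OF j]]] H2_space_weak_derivs(4)[OF galerkin_reg[OF j]]])
    show "l2_norm ?U (\<lambda>t. f2 j t - ?v2 j t) \<le> \<delta>" using near2[OF j] by simp
    show "(\<lambda>t. f l t - as l t) \<in> l2_space ?U" if l: "l \<in> ?I" for l
      by (rule l2_space_diff[OF cl[OF fc[OF l]] H2_space_weak_derivs(1)[OF galerkin_reg[OF l]]])
    show "l2_norm ?U (\<lambda>t. f l t - as l t) \<le> \<delta>" if l: "l \<in> ?I" for l using near[OF l] by simp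
    show "AE t in lebesgue_on ?U. \<bar>R j t\<bar> \<le> \<bar>f2 j t - ?v2 j t\<bar> + \<bar>\<mu> j\<bar> * \<bar>f j t - as j t\<bar> +
        K j * (\<Sum>l\<in>?I. \<bar>f l t - as l t\<bar>)"
      using galerkin_sol[OF j]
    proof eventually_elim
      case (elim t)
      then have "?v2 j t + \<mu> j * as j t + \<Gamma> j (\<lambda>l. as l t) + c0 j t = 0"
        unfolding galerkin_lhs_def \<mu>_def \<Gamma>_def c0_def .
      then have "R j t = (f2 j t - ?v2 j t) + \<mu> j * (f j t - as j t) + (\<Gamma> j (\<lambda>l. f l t) - \<Gamma> j (\<lambda>l. as l t))"
        unfolding R_eq[OF j] right_diff_distrib by linarith
      then show ?case
        using K(2)[of j "\<lambda>l. f l t" "\<lambda>l. as l t"] unfolding abs_mult[symmetric] by linarith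
    qed
  qed (use j K(1) in auto)
  have "(\<Sum>j=1..P. (l2_norm ?U (R j))\<^sup>2) \<le> (\<Sum>j\<in>?I. \<delta> * (D j)\<^sup>2)"
  proof (rule sum_mono)
    fix j assume j: "j \<in> ?I"
    have "(l2_norm ?U (R j))\<^sup>2 \<le> (D j * \<delta>)\<^sup>2" by (rule power_mono[OF R_le[OF j]]) simp
    also have "\<dots> = (\<delta> * \<delta>) * (D j)\<^sup>2" by (simp add: power2_eq_square)
    also have "\<dots> \<le> \<delta> * (D j)\<^sup>2" using \<delta> by (intro mult_right_mono) auto
    finally show "(l2_norm ?U (R j))\<^sup>2 \<le> \<delta> * (D j)\<^sup>2" .
  qed
  also have "\<dots> = \<delta> * S" by (simp add: S_def sum_distrib_left)
  finally have small: "(\<Sum>j=1..P. (l2_norm ?U (R j))\<^sup>2) < \<epsilon>" using \<delta>S by linarith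
  have l2: "\<forall>j\<in>?I. R j \<in> l2_space ?U" using cl[OF Rc] by blast
  show "\<exists>ma\<ge>1. \<exists>Aa Wa Ba :: nat \<Rightarrow> nat \<Rightarrow> real.
    let a = (\<lambda>j. net \<sigma> ma (Aa j) (Wa j) (Ba j));
        R = galerkin_lhs \<alpha> \<omega> g P c a (\<lambda>l. deriv (deriv (a l)))
    in (\<forall>j\<in>{1..P}. R j \<in> l2_space {0<..<T}) \<and>
       (\<Sum>j=1..P. (l2_norm {0<..<T} (R j))\<^sup>2) < \<epsilon>"
    unfolding Let_def
  proof (rule exI[of _ M], rule conjI)
    show "1 \<le> M" by (simp add: M_def)
  next
    show "\<exists>Aa Wa Ba. (\<forall>j\<in>?I. galerkin_lhs \<alpha> \<omega> g P c (\<lambda>j. net \<sigma> M (Aa j) (Wa j) (Ba j))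
          (\<lambda>l. deriv (deriv (net \<sigma> M (Aa l) (Wa l) (Ba l)))) j \<in> l2_space ?U) \<and>
        (\<Sum>j=1..P. (l2_norm ?U (galerkin_lhs \<alpha> \<omega> g P c (\<lambda>j. net \<sigma> M (Aa j) (Wa j) (Ba j))
          (\<lambda>l. deriv (deriv (net \<sigma> M (Aa l) (Wa l) (Ba l)))) j))\<^sup>2) < \<epsilon>"
      by (rule exI[of _ A'], rule exI[of _ W], rule exI[of _ B],
          rule conjI[OF l2 small, unfolded R_def a_def])
  qed
qed

end
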